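(* Let $F$ be a finite extension of $\mathbb Q_p$, $B$ the quaternion division algebra over $F$, $E/F$ the unramified quadratic extension (embedded in $B$), and $\mathcal O=\mathcal O_{2r+1}(E)$ with $r\ge0$. Let $\pi$ be a smooth irreducible complex representation of $B^\times$ with central character $\omega$. Suppose $\pi$ is minimal and $\Omega$ is a minimally ramified extension of $\omega|_{\mathfrak o_F^\times}$ to $\mathcal O^\times$. Then $\pi^\Omega=0$ unless $c(\pi)\le 2r+1$ and one of the following holds: (i) $\dim\pi=1$, in which case $\dim\pi^\Omega=1$; or (ii) $\dim\pi>1$ and $c(\pi)$ is odd, in which case $\dim\pi^\Omega=1$; or (iii) $c(\pi)$ is even and $c(\omega)=\frac{c(\pi)}2$.
   Context: $\mathfrak o_F$ is the integer ring of $F$ and $\mathfrak p_E$ the prime ideal of $\mathfrak o_E$. $\mathcal O_B$ is the maximal order of $B$, $\mathfrak P$ its maximal ideal, $\mathcal U^0=\mathcal O_B^\times$, $\mathcal U^n=1+\mathfrak P^n$ for $n\ge1$. For $s\ge1$, $\mathcal O_s(E)=\mathfrak o_E+\mathfrak P^{s-1}$, so $\mathcal O_s(E)^\times=\mathfrak o_E^\times\,\mathcal U^{s-1}$. For a character $\chi$ of $F^\times$, $\mathfrak o_F^\times$ or $\mathfrak o_E^\times$, $c(\chi)$ is the least $n\ge0$ such that $\chi$ is trivial on the $n$-th unit group ($\mathfrak u^0=\mathfrak o^\times$, $\mathfrak u^n=1+\mathfrak p^n$). $c(\pi)$ is the conductor exponent of the Jacquet–Langlands transfer of $\pi$ to $\mathrm{GL}_2(F)$;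 equivalently, the least $n\ge1$ such that $\pi$ is trivial on $\mathcal U^{n-1}$. $\pi\otimes\mu=(\mu\circ N_{B/F})\cdot\pi$ for a character $\mu$ of $F^\times$ ($N_{B/F}$ the reduced norm), and $\pi$ is minimal if $c(\pi)\le c(\pi\otimes\mu)$ for all $\mu$. A minimally ramified extension $\Omega$ of $\omega|_{\mathfrak o_F^\times}$ to $\mathcal O^\times$ (with $E/F$ unramified and $\mathcal O=\mathcal O_{2r+1}(E)$) is a character of $\mathcal O^\times$, trivial on $\mathcal U^{2r}$, agreeing with $\omega$ on $\mathfrak o_F^\times$, with $c_E(\Omega):=c(\Omega|_{\mathfrak o_E^\times})=c(\omega)$. $\pi^\Omega=\{v\in\pi:\pi(g)v=\Omega(g)v\text{ for all }g\in\mathcal O^\times\}$. *)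

theory Defs
  imports
    "HOL-Analysis.Analysis"
    "HOL-Computational_Algebra.Computational_Algebra"
begin

section \<open>The fields\<close>

definition padic_abs :: "nat \<Rightarrow> rat \<Rightarrow> real" where
  "padic_abs p q =
     (if q = 0 then 0
      else real p powi (int (multiplicity (int p) (snd (quotient_of q)))
                      - int (multiplicity (int p) (fst (quotient_of q)))))"

text \<open>
  The field \<open>\<rat>\<^sub>p\<close> is the completion of \<open>\<rat>\<close> at the \<open>p\<close>-adic absolute value:
  \<open>nrm\<close> is a complete absolute value on the type \<open>'k\<close> that extends the \<open>p\<close>-adic one
  and for which \<open>\<rat>\<close> is dense.
\<close>
definition is_Qp :: "nat \<Rightarrow> ('k::field_char_0 \<Rightarrow> real) \<Rightarrow> bool" where
  "is_Qp p nrm \<longleftrightarrow>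
     prime p \<and>
     (\<forall>x. 0 \<le> nrm x) \<and> (\<forall>x. nrm x = 0 \<longleftrightarrow> x = 0) \<and>
     (\<forall>x y. nrm (x * y) = nrm x * nrm y) \<and>
     (\<forall>x y. nrm (x + y) \<le> nrm x + nrm y) \<and>
     (\<forall>q. nrm (of_rat q) = padic_abs p q) \<and>
     (\<forall>x. \<forall>e>0. \<exists>q. nrm (x - of_rat q) < e) \<and>
     (\<forall>X :: nat \<Rightarrow> 'k. (\<forall>e>0. \<exists>M. \<forall>m\<ge>M. \<forall>n\<ge>M. nrm (X m - X n) < e)
        \<longrightarrow> (\<exists>L. (\<lambda>n. nrm (X n - L)) \<longlonglongrightarrow> 0))"

definition unital_ring_hom :: "('a::ring_1 \<Rightarrow> 'c::ring_1) \<Rightarrow> bool" where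
  "unital_ring_hom h \<longleftrightarrow>
     h 1 = 1 \<and> (\<forall>x y. h (x + y) = h x + h y) \<and> (\<forall>x y. h (x * y) = h x * h y)"

definition scale_along :: "('a::field \<Rightarrow> 'c::ring_1) \<Rightarrow> 'a \<Rightarrow> 'c \<Rightarrow> 'c" where
  "scale_along h a x = h a * x"

definition finite_extension :: "('k::field \<Rightarrow> 'f::field) \<Rightarrow> bool" where
  "finite_extension j \<longleftrightarrow>
     unital_ring_hom j \<and> (\<exists>Basis. finite_dimensional_vector_space (scale_along j) Basis)"

text \<open>The integral closure of \<open>\<int>\<^sub>p\<close> in an extension \<open>j\<close> of \<open>\<rat>\<^sub>p\<close>.\<close>
definition integer_ring :: "('k::field \<Rightarrow> real) \<Rightarrow> ('k \<Rightarrow> 'f::field) \<Rightarrow> 'f set" where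
  "integer_ring nrm j =
     {x. \<exists>f. lead_coeff f = 1 \<and> (\<forall>i. nrm (coeff f i) \<le> 1) \<and> poly (map_poly j f) x = 0}"


section \<open>Ideals, unit groups and topology\<close>

definition two_sided_ideal :: "'a::ring_1 set \<Rightarrow> 'a set \<Rightarrow> bool" where
  "two_sided_ideal R I \<longleftrightarrow>
     I \<subseteq> R \<and> 0 \<in> I \<and> (\<forall>x\<in>I. \<forall>y\<in>I. x - y \<in> I) \<and>
     (\<forall>a\<in>R. \<forall>x\<in>I. a * x \<in> I \<and> x * a \<in> I)"

definition is_maximal_ideal :: "'a::ring_1 set \<Rightarrow> 'a set \<Rightarrow> bool" where
  "is_maximal_ideal R I \<longleftrightarrow>
     two_sided_ideal R I \<and> I \<noteq> R \<and>
     (\<forall>J. two_sided_ideal R J \<and> I \<subseteq> J \<longrightarrow> J = I \<or> J = R)"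

text \<open>
  Only used for \<open>\<oo>\<^sub>F\<close>, \<open>\<oo>\<^sub>E\<close> and the maximal order of \<open>B\<close>, each of
  which has exactly one maximal two-sided ideal.
\<close>
definition max_ideal :: "'a::ring_1 set \<Rightarrow> 'a set" where
  "max_ideal R = (THE I. is_maximal_ideal R I)"

definition ideal_times :: "'a::ring_1 set \<Rightarrow> 'a set \<Rightarrow> 'a set" where
  "ideal_times I J =
     {\<Sum>i<m. a i * b i | (m::nat) a b. \<forall>i<m. a i \<in> I \<and> b i \<in> J}"

primrec ideal_power :: "'a::ring_1 set \<Rightarrow> 'a set \<Rightarrow> nat \<Rightarrow> 'a set" where
  "ideal_power R I 0 = R"
| "ideal_power R I (Suc n) = ideal_times (ideal_power R I n) I"

definition unit_group :: "'a::ring_1 set \<Rightarrow> 'a set" where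
  "unit_group R = {x \<in> R. \<exists>y\<in>R. x * y = 1 \<and> y * x = 1}"

definition higher_units :: "'a::ring_1 set \<Rightarrow> nat \<Rightarrow> 'a set" where
  "higher_units R n =
     (if n = 0 then unit_group R
      else {1 + x | x. x \<in> ideal_power R (max_ideal R) n})"

text \<open>
  The valuation topology on the whole type (the fraction field of \<open>R\<close>, or \<open>B\<close>), with
  the powers of the maximal ideal of \<open>R\<close> as a neighbourhood basis of \<open>0\<close>.
\<close>
definition adic_topology :: "'a::ring_1 set \<Rightarrow> 'a topology" where
  "adic_topology R =
     topology_generated_by {(\<lambda>y. x + y) ` ideal_power R (max_ideal R) n | x n. True}"

definition is_character :: "'a::ring_1 set \<Rightarrow> 'a set \<Rightarrow> ('a \<Rightarrow> complex) \<Rightarrow> bool" where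
  "is_character R G \<theta> \<longleftrightarrow>
     (\<forall>x\<in>G. \<theta> x \<noteq> 0) \<and> (\<forall>x\<in>G. \<forall>y\<in>G. \<theta> (x * y) = \<theta> x * \<theta> y) \<and>
     continuous_map (subtopology (adic_topology R) G) euclidean \<theta>"

definition char_conductor :: "'a::ring_1 set \<Rightarrow> ('a \<Rightarrow> complex) \<Rightarrow> nat" where
  "char_conductor R \<theta> = (LEAST n. \<forall>x\<in>higher_units R n. \<theta> x = 1)"


section \<open>The unramified quadratic extension\<close>

definition unramified_quadratic ::
  "('k::field \<Rightarrow> real) \<Rightarrow> ('k \<Rightarrow> 'f::field) \<Rightarrow> ('f \<Rightarrow> 'e::field) \<Rightarrow> bool" where
  "unramified_quadratic nrm jF jE \<longleftrightarrow>
     unital_ring_hom jE \<and> vector_space.dim (scale_along jE) (UNIV :: 'e set) = 2 \<and>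
     (let oF = integer_ring nrm jF; oE = integer_ring nrm (jE \<circ> jF)
      in ideal_times oE (jE ` max_ideal oF) = max_ideal oE)"


section \<open>The quaternion algebra\<close>

definition quaternion_division_algebra :: "('f::field \<Rightarrow> 'b::division_ring) \<Rightarrow> bool" where
  "quaternion_division_algebra jB \<longleftrightarrow>
     unital_ring_hom jB \<and> range jB = {z. \<forall>x. z * x = x * z} \<and>
     vector_space.dim (scale_along jB) (UNIV :: 'b set) = 4"

text \<open>An order is a subring that is also a full \<open>oF\<close>-lattice in \<open>B\<close>.\<close>
definition is_order :: "'f::field set \<Rightarrow> ('f \<Rightarrow> 'b::division_ring) \<Rightarrow> 'b set \<Rightarrow> bool" where
  "is_order oF jB R \<longleftrightarrow>
     1 \<in> R \<and> (\<forall>x\<in>R. \<forall>y\<in>R. x - y \<in> R \<and> x * y \<in> R) \<and>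
     (\<exists>S. finite S \<and> R = {\<Sum>s\<in>S. jB (c s) * s | c. \<forall>s\<in>S. c s \<in> oF}) \<and>
     module.span (scale_along jB) R = UNIV"

text \<open>The maximal order of a division algebra over a local field is unique.\<close>
definition maximal_order :: "'f::field set \<Rightarrow> ('f \<Rightarrow> 'b::division_ring) \<Rightarrow> 'b set" where
  "maximal_order oF jB =
     (THE R. is_order oF jB R \<and> (\<forall>R'. is_order oF jB R' \<and> R \<subseteq> R' \<longrightarrow> R' = R))"

definition standard_involution ::
  "('f::field \<Rightarrow> 'b::division_ring) \<Rightarrow> ('b \<Rightarrow> 'b) \<Rightarrow> bool" where
  "standard_involution jB \<sigma> \<longleftrightarrow>
     Vector_Spaces.linear (scale_along jB) (scale_along jB) \<sigma> \<and> \<sigma> 1 = 1 \<and>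
     (\<forall>x. \<sigma> (\<sigma> x) = x) \<and> (\<forall>x y. \<sigma> (x * y) = \<sigma> y * \<sigma> x) \<and>
     (\<forall>x. x * \<sigma> x \<in> range jB)"

text \<open>
  A quaternion algebra has exactly one standard involution (quaternion conjugation), and
  the reduced norm of \<open>x\<close> is the product of \<open>x\<close> and its conjugate.
\<close>
definition reduced_norm :: "('f::field \<Rightarrow> 'b::division_ring) \<Rightarrow> 'b \<Rightarrow> 'f" where
  "reduced_norm jB x = (THE n. \<exists>\<sigma>. standard_involution jB \<sigma> \<and> jB n = x * \<sigma> x)"

text \<open>
  The order \<open>\<oo>\<^sub>E + \<PP>\<^bsup>s-1\<^esup>\<close>, for \<open>s \<ge> 1\<close>; here \<open>emb\<close> is the embedding of \<open>E\<close> in \<open>B\<close>.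
\<close>
definition order_s ::
  "'e::field set \<Rightarrow> 'b::division_ring set \<Rightarrow> ('e \<Rightarrow> 'b) \<Rightarrow> nat \<Rightarrow> 'b set" where
  "order_s oE OB emb s =
     {emb a + x | a x. a \<in> oE \<and> x \<in> ideal_power OB (max_ideal OB) (s - 1)}"


section \<open>Representations of the multiplicative group of the quaternion algebra\<close>

text \<open>
  The representation space is the type \<open>'v\<close> with scalar multiplication \<open>smul\<close>; only the
  values of \<open>\<pi>\<close> at nonzero arguments matter.
\<close>
definition smooth_irrep ::
  "'b::division_ring set \<Rightarrow> (complex \<Rightarrow> 'v::ab_group_add \<Rightarrow> 'v) \<Rightarrow> ('b \<Rightarrow> 'v \<Rightarrow> 'v) \<Rightarrow> bool" where
  "smooth_irrep OB smul \<pi> \<longleftrightarrow>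
     vector_space smul \<and>
     (\<forall>g. g \<noteq> 0 \<longrightarrow> Vector_Spaces.linear smul smul (\<pi> g)) \<and>
     \<pi> 1 = id \<and> (\<forall>g h. g \<noteq> 0 \<and> h \<noteq> 0 \<longrightarrow> \<pi> (g * h) = \<pi> g \<circ> \<pi> h) \<and>
     (\<forall>v. openin (subtopology (adic_topology OB) (- {0})) {g. g \<noteq> 0 \<and> \<pi> g v = v}) \<and>
     (\<exists>v::'v. v \<noteq> 0) \<and>
     (\<forall>W. module.subspace smul W \<and> (\<forall>g. g \<noteq> 0 \<longrightarrow> \<pi> g ` W \<subseteq> W)
        \<longrightarrow> W = {0} \<or> W = UNIV)"

definition has_central_character ::
  "('f::field \<Rightarrow> 'b::division_ring) \<Rightarrow> (complex \<Rightarrow> 'v::ab_group_add \<Rightarrow> 'v)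
     \<Rightarrow> ('b \<Rightarrow> 'v \<Rightarrow> 'v) \<Rightarrow> ('f \<Rightarrow> complex) \<Rightarrow> bool" where
  "has_central_character jB smul \<pi> \<omega> \<longleftrightarrow>
     (\<forall>z v. z \<noteq> 0 \<longrightarrow> \<pi> (jB z) v = smul (\<omega> z) v)"

text \<open>
  This is the conductor exponent of the Jacquet-Langlands transfer of \<open>\<pi>\<close> to
  \<open>GL\<^sub>2(F)\<close>, expressed on the quaternionic side.
\<close>
definition rep_conductor ::
  "'b::division_ring set \<Rightarrow> ('b \<Rightarrow> 'v \<Rightarrow> 'v) \<Rightarrow> nat" where
  "rep_conductor OB \<pi> = (LEAST n. 1 \<le> n \<and> (\<forall>g\<in>higher_units OB (n - 1). \<forall>v. \<pi> g v = v))"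

definition twist ::
  "('f::field \<Rightarrow> 'b::division_ring) \<Rightarrow> (complex \<Rightarrow> 'v \<Rightarrow> 'v)
     \<Rightarrow> ('b \<Rightarrow> 'v \<Rightarrow> 'v) \<Rightarrow> ('f \<Rightarrow> complex) \<Rightarrow> 'b \<Rightarrow> 'v \<Rightarrow> 'v" where
  "twist jB smul \<pi> \<mu> g v = smul (\<mu> (reduced_norm jB g)) (\<pi> g v)"

definition minimal_rep ::
  "'f::field set \<Rightarrow> ('f \<Rightarrow> 'b::division_ring) \<Rightarrow> 'b set \<Rightarrow> (complex \<Rightarrow> 'v \<Rightarrow> 'v)
     \<Rightarrow> ('b \<Rightarrow> 'v \<Rightarrow> 'v) \<Rightarrow> bool" where
  "minimal_rep oF jB OB smul \<pi> \<longleftrightarrow>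
     (\<forall>\<mu>. is_character oF (- {0}) \<mu>
        \<longrightarrow> rep_conductor OB \<pi> \<le> rep_conductor OB (twist jB smul \<pi> \<mu>))"

definition minimally_ramified_extension ::
  "'f::field set \<Rightarrow> 'e::field set \<Rightarrow> 'b::division_ring set \<Rightarrow> ('f \<Rightarrow> 'b) \<Rightarrow> ('e \<Rightarrow> 'b)
     \<Rightarrow> nat \<Rightarrow> ('f \<Rightarrow> complex) \<Rightarrow> ('b \<Rightarrow> complex) \<Rightarrow> bool" where
  "minimally_ramified_extension oF oE OB jB emb r \<omega> \<Omega> \<longleftrightarrow>
     is_character OB (unit_group (order_s oE OB emb (2 * r + 1))) \<Omega> \<and>
     (\<forall>g\<in>higher_units OB (2 * r). \<Omega> g = 1) \<and>
     (\<forall>a\<in>unit_group oF. \<Omega> (jB a) = \<omega> a) \<and>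
     char_conductor oE (\<Omega> \<circ> emb) = char_conductor oF \<omega>"

definition eigenspace ::
  "'b::ring_1 set \<Rightarrow> (complex \<Rightarrow> 'v \<Rightarrow> 'v) \<Rightarrow> ('b \<Rightarrow> 'v \<Rightarrow> 'v) \<Rightarrow> ('b \<Rightarrow> complex) \<Rightarrow> 'v set" where
  "eigenspace R smul \<pi> \<Omega> = {v. \<forall>g\<in>unit_group R. \<pi> g v = smul (\<Omega> g) v}"

end

theory Submission
  imports Defs "HOL-Number_Theory.Cong"
begin

text \<open>
  All arithmetic takes place inside \<open>B\<close>. Its absolute value is the spectral norm
  \<open>lim \<parallel>x\<^sup>n\<parallel>\<^sup>1\<^sup>/\<^sup>n\<close> of a coordinate norm over \<open>\<rat>\<^sub>p\<close>: by compactness the coordinate norm is multiplicative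
  up to a constant, so the spectral norm is multiplicative on commuting elements and invariant under
  conjugation, hence multiplicative, because the square of the norm of \<open>x\<close> is the norm of \<open>x * cj x\<close>.
  The elements of norm at most \<open>1\<close> form the integral closures and the maximal order.

  If \<open>\<pi>\<^sup>\<Omega>\<close> is nonzero, then \<open>\<pi>\<close> has vectors fixed by the normal subgroup \<open>\<U>\<^sup>2\<^sup>r\<close>, so \<open>c(\<pi>) \<le> 2r + 1\<close>.
  A one-dimensional \<open>\<pi>\<close> factors through the reduced norm, because elements of norm \<open>1\<close> are commutators,
  so minimality makes it trivial on \<open>\<U>\<^sup>0\<close>.
  If \<open>c(\<pi>) = 2n + 2\<close> and \<open>c(\<omega>) \<le> n\<close>, an \<open>\<Omega>\<close>-eigenvector is fixed by \<open>\<U>\<^sup>2\<^sup>n\<close>, which is impossible.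
  The space \<open>\<pi>\<^sup>\<Omega>\<close> is at most a line by Gelfand's trick for the pair \<open>E\<^sup>\<times> \<subseteq> B\<^sup>\<times>\<close>.
  If \<open>c(\<pi>) = 2m + 1\<close>, conjugating an element of \<open>\<oo>\<^sub>E\<^sup>\<times>\<close> far from \<open>F\<close> by elements of \<open>\<U>\<^sup>1\<close> multiplies it by all
  elements of \<open>\<U>\<^sup>2\<^sup>m\<^sup>-\<^sup>1\<close> modulo \<open>\<U>\<^sup>2\<^sup>m\<close>, so its average over \<open>\<U>\<^sup>1\<close> vanishes; hence the average of the projection
  onto \<open>\<pi>\<^sup>\<Omega>\<close> is a nonzero scalar, and \<open>\<pi>\<^sup>\<Omega>\<close> is nonzero.
\<close>

section \<open>The field of \<open>p\<close>-adic numbers\<close>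

text \<open>The definitions describe the integer rings by integral equations, and the maximal order
  and the ideals by uniqueness, so one multiplicative norm on \<open>B\<close> has to come before
  everything else. Reading it off powers makes it canonical, which is what invariance under
  conjugation needs.

  The split between odd and even conductors is a matter of parity. As \<open>E\<close> is
  unramified, nonzero elements of \<open>E\<close> have norms \<open>rho powi k\<close>, while
  \<open>wB\<close>, which acts on \<open>E\<close> as the Galois conjugation, has norm the square
  root of \<open>rho\<close>. So even layers of the unit filtration of \<open>B\<close> are
  represented by \<open>E\<close> and odd layers by \<open>E * wB\<close>. If the last layer on
  which \<open>\<pi>\<close> is nontrivial is even, \<open>\<Omega>\<close> alone governs it; if it
  is odd, conjugation inside \<open>B\<close> reaches it.

  Residue characteristic 2 shapes the arithmetic of \<open>E\<close>: the generator
  \<open>ii\<close> with square in \<open>F\<close> has \<open>ii - cj ii = 2 * ii\<close>, so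
  \<open>1\<close> and a scaled \<open>ii\<close> need not span the integers. The unit
  \<open>uu\<close>, for which \<open>uu - cj uu\<close> is a unit too, takes over. Integrals over
  compact groups become finite sums over their images.\<close>

locale padic_numbers =
  fixes p :: nat and nrm :: "'k::field_char_0 \<Rightarrow> real"
  assumes Qp: "is_Qp p nrm"
begin

lemma prime_p: "prime p" using Qp by (simp add: is_Qp_def)
lemma p_gt_1: "1 < p" using prime_p prime_gt_1_nat by blast
lemma nrm_nonneg [simp]: "0 \<le> nrm x" using Qp by (simp add: is_Qp_def)
lemma nrm_eq_0 [simp]: "nrm x = 0 \<longleftrightarrow> x = 0" using Qp by (simp add: is_Qp_def)
lemma nrm_0 [simp]: "nrm 0 = 0" by simp
lemma nrm_mult: "nrm (x * y) = nrm x * nrm y" using Qp by (simp add: is_Qp_def)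
lemma nrm_triangle: "nrm (x + y) \<le> nrm x + nrm y" using Qp by (simp add: is_Qp_def)
lemma nrm_rat: "nrm (of_rat q) = padic_abs p q" using Qp by (simp add: is_Qp_def)
lemma nrm_dense: "e > 0 \<Longrightarrow> \<exists>q. nrm (x - of_rat q) < e" using Qp by (simp add: is_Qp_def)
lemma nrm_complete:
  "(\<And>e. e > 0 \<Longrightarrow> \<exists>M. \<forall>m\<ge>M. \<forall>n\<ge>M. nrm (X m - X n) < e) \<Longrightarrow> \<exists>L. (\<lambda>n. nrm (X n - L)) \<longlonglongrightarrow> 0"
  using Qp by (simp add: is_Qp_def)

lemma nrm_1 [simp]: "nrm 1 = 1"
proof -
  have "nrm 1 * nrm 1 = nrm 1 * 1" using nrm_mult[of 1 1] by simp
  then show ?thesis by (metis mult_left_cancel nrm_eq_0 zero_neq_one)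
qed

lemma nrm_power: "nrm (x ^ n) = nrm x ^ n"
  by (induction n) (auto simp: nrm_mult)

lemma nrm_minus [simp]: "nrm (- x) = nrm x"
proof -
  have "nrm (-1) ^ 2 = 1" by (simp flip: nrm_power)
  then have "nrm (-1) = 1" using nrm_nonneg[of "-1"] by (simp add: power2_eq_1_iff)
  then show ?thesis using nrm_mult[of "-1" x] by simp
qed

lemma nrm_int: "m \<noteq> 0 \<Longrightarrow> nrm (of_int m) = real p powi (- int (multiplicity (int p) m))"
proof -
  assume m: "m \<noteq> 0"
  have "quotient_of (rat_of_int m) = (m, 1)"
    by (metis quotient_of_int Rat.of_int_def)
  then have "padic_abs p (rat_of_int m) = real p powi (- int (multiplicity (int p) m))"
    using m by (simp add: padic_abs_def)
  then show ?thesis using nrm_rat[of "rat_of_int m"] by simp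
qed

lemma nrm_int_le_1: "nrm (of_int m) \<le> 1"
proof (cases "m = 0")
  case False
  then show ?thesis using nrm_int p_gt_1
    by (simp add: power_int_minus inverse_le_1_iff)
qed simp

lemma nrm_nat_le_1: "nrm (of_nat n) \<le> 1"
  using nrm_int_le_1[of "int n"] by simp

lemma nrm_p: "nrm (of_nat p) = 1 / real p"
proof -
  have "multiplicity (int p) (int p) = 1"
    using prime_p by (simp add: multiplicity_self prime_gt_0_nat)
  then show ?thesis using nrm_int[of "int p"] p_gt_1
    by (simp add: power_int_minus divide_simps)
qed

lemma nrm_int_coprime: "\<not> int p dvd m \<Longrightarrow> nrm (of_int m) = 1"
  by (cases "m = 0") (auto simp: nrm_int not_dvd_imp_multiplicity_0)

text \<open>Integers have norm at most 1, so the binomial theorem bounds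
  \<open>nrm (x + y) ^ n\<close> by \<open>(n + 1) * M ^ n\<close>; a ratio to \<open>M\<close>
  above 1 would outgrow the linear factor.\<close>

lemma nrm_add: "nrm (x + y) \<le> max (nrm x) (nrm y)"
proof -
  define M where "M = max (nrm x) (nrm y)"
  have M0: "0 \<le> M" by (simp add: M_def le_max_iff_disj)
  have sum_le: "nrm (sum f A) \<le> (\<Sum>a\<in>A. nrm (f a))" if "finite A" for f :: "nat \<Rightarrow> 'k" and A
    using that
  proof (induction A)
    case (insert a A)
    then show ?case using nrm_triangle[of "f a" "sum f A"] by simp
  qed simp
  have pow: "nrm (x + y) ^ n \<le> (real n + 1) * M ^ n" for n
  proof -
    have "nrm (x + y) ^ n = nrm (\<Sum>k\<le>n. of_nat (n choose k) * x ^ k * y ^ (n - k))"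
      by (simp add: binomial_ring flip: nrm_power)
    also have "\<dots> \<le> (\<Sum>k\<le>n. nrm (of_nat (n choose k) * x ^ k * y ^ (n - k)))"
      by (rule sum_le) simp
    also have "\<dots> \<le> (\<Sum>k\<le>n. M ^ n)"
    proof (rule sum_mono)
      fix k assume "k \<in> {..n}"
      then have k: "k + (n - k) = n" by simp
      have "nrm (of_nat (n choose k) * x ^ k * y ^ (n - k)) \<le> 1 * M ^ k * M ^ (n - k)"
        unfolding nrm_mult nrm_power
        by (intro mult_mono power_mono nrm_nat_le_1) (auto simp: M_def M0 le_max_iff_disj)
      also have "\<dots> = M ^ n" using k by (simp flip: power_add)
      finally show "nrm (of_nat (n choose k) * x ^ k * y ^ (n - k)) \<le> M ^ n" .
    qed
    finally show ?thesis by (simp add: add.commute)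
  qed
  show ?thesis
  proof (rule ccontr)
    assume "\<not> ?thesis"
    then have gt: "nrm (x + y) > M" by (simp only: M_def not_le)
    show False
    proof (cases "M = 0")
      case True
      then show False using pow[of 1] gt by simp
    next
      case False
      then have "M > 0" using M0 by simp
      define t where "t = nrm (x + y) / M"
      have t: "t > 1" using gt \<open>M > 0\<close> by (simp add: t_def)
      have "t ^ n \<le> real n + 1" for n
        using pow[of n] \<open>M > 0\<close> by (simp add: t_def power_divide divide_simps)
      moreover have "eventually (\<lambda>n. t ^ n > real n + 1) sequentially"
      proof -
        have "(\<lambda>n. (real n + 1) / t ^ n) \<longlonglongrightarrow> 0"
        proof -
          have "(\<lambda>n. real n / t ^ n) \<longlonglongrightarrow> 0"
            using powser_times_n_limit_0[of "1 / t"] t by (simp add: divide_simps power_one_over)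
          moreover have "(\<lambda>n. 1 / t ^ n) \<longlonglongrightarrow> 0"
            using LIMSEQ_realpow_zero[of "1 / t"] t by (simp add: power_one_over)
          ultimately show ?thesis
            using tendsto_add by (fastforce simp: add_divide_distrib)
        qed
        then have "eventually (\<lambda>n. (real n + 1) / t ^ n < 1) sequentially"
          by (rule order_tendstoD) simp
        then show ?thesis
          by eventually_elim (use t in \<open>simp add: divide_simps split: if_splits\<close>)
      qed
      ultimately show False
        by (metis (no_types, lifting) eventually_sequentially order.refl not_le)
    qed
  qed
qed

lemma nrm_diff: "nrm (x - y) \<le> max (nrm x) (nrm y)"
  using nrm_add[of x "-y"] by simp

lemma nrm_sum: "0 \<le> M \<Longrightarrow> (\<And>a. a \<in> A \<Longrightarrow> nrm (f a) \<le> M) \<Longrightarrow> nrm (sum f A) \<le> M"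
proof (induction A rule: infinite_finite_induct)
  case (insert a A)
  then have "max (nrm (f a)) (nrm (sum f A)) \<le> M" by simp
  with nrm_add[of "f a" "sum f A"] have "nrm (f a + sum f A) \<le> M" by linarith
  with insert show ?case by simp
qed auto


text \<open>The denominator \<open>b\<close> of a \<open>p\<close>-integral fraction is prime to
  \<open>p\<close>, so it has an inverse \<open>c\<close> modulo \<open>p ^ k\<close>, and the
  residue is \<open>a * c\<close>.\<close>

lemma rat_residue:
  assumes "nrm (of_rat q) \<le> 1"
  shows "\<exists>n<p ^ k. nrm (of_rat q - of_nat n) \<le> (1 / real p) ^ k"
proof (cases "q = 0")
  case True
  then show ?thesis using p_gt_1 by (intro exI[of _ 0]) auto
next
  case False
  obtain a b where ab: "quotient_of q = (a, b)" by force
  then have b: "b > 0" and cop: "coprime a b" and q: "q = of_int a / of_int b"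
    by (auto simp: quotient_of_denom_pos quotient_of_coprime quotient_of_div)
  have a0: "a \<noteq> 0" using False q by auto
  have pb: "\<not> int p dvd b"
  proof
    assume d: "int p dvd b"
    then have "\<not> int p dvd a" using cop prime_p
      by (meson coprime_common_divisor not_prime_unit prime_nat_int_transfer)
    then have "multiplicity (int p) a = 0" by (rule not_dvd_imp_multiplicity_0)
    moreover have "multiplicity (int p) b > 0"
      using d b prime_p by (simp add: prime_multiplicity_gt_zero_iff)
    ultimately have "padic_abs p q > 1"
      using False ab p_gt_1 by (simp add: padic_abs_def)
    then show False using assms nrm_rat by simp
  qed
  have nb: "nrm (of_int b) = 1" by (rule nrm_int_coprime[OF pb])
  have "coprime (int p) b"
    using pb prime_p by (intro prime_imp_coprime) auto
  then have "coprime b (int p ^ k)"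
    by (simp add: coprime_commute)
  then obtain c where c: "[b * c = 1] (mod (int p ^ k))"
    using cong_solve_coprime_int by blast
  define n where "n = nat ((a * c) mod (int p ^ k))"
  have n: "int n = (a * c) mod (int p ^ k)" using p_gt_1 by (simp add: n_def)
  have "[b * int n = a] (mod (int p ^ k))"
  proof -
    have "[int n = a * c] (mod (int p ^ k))" by (simp add: n cong_def)
    then have "[b * int n = b * (a * c)] (mod (int p ^ k))" by (rule cong_scalar_left)
    also have "b * (a * c) = a * (b * c)" by simp
    also have "[a * (b * c) = a * 1] (mod (int p ^ k))" using c by (rule cong_scalar_left)
    finally show ?thesis by simp
  qed
  then obtain d where d: "a - b * int n = int p ^ k * d"
    by (metis cong_iff_dvd_diff cong_sym dvdE)
  have eq: "of_int b * (of_rat q - of_nat n) = (of_nat p ^ k * of_int d :: 'k)"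
  proof -
    have "of_int b * (of_rat q - of_nat n) = (of_int (a - b * int n) :: 'k)"
      using b by (simp add: q of_rat_divide algebra_simps)
    then show ?thesis by (simp add: d)
  qed
  have "nrm (of_rat q - of_nat n) = nrm (of_nat p ^ k * of_int d :: 'k)"
    unfolding eq[symmetric] by (simp add: nrm_mult nb)
  also have "\<dots> \<le> (1 / real p) ^ k"
    by (simp add: nrm_mult nrm_power nrm_p nrm_int_le_1 mult_left_le)
  finally have "nrm (of_rat q - of_nat n) \<le> (1 / real p) ^ k" .
  moreover have "n < p ^ k"
  proof -
    have "int n < int p ^ k" using n p_gt_1 by simp
    then show ?thesis by (metis of_nat_less_iff of_nat_power)
  qed
  ultimately show ?thesis by blast
qed

text \<open>Density of the rationals passes the residues on to all integral elements. Having
  finitely many of them at each level is the source of all compactness below.\<close>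

lemma residue:
  assumes "nrm x \<le> 1"
  shows "\<exists>n<p ^ k. nrm (x - of_nat n) \<le> (1 / real p) ^ k"
proof -
  have pos: "0 < (1 / real p) ^ k" using p_gt_1 by simp
  obtain q where q: "nrm (x - of_rat q) < (1 / real p) ^ k" using nrm_dense[OF pos] by blast
  have le1: "(1 / real p) ^ k \<le> 1" using p_gt_1 by (intro power_le_one) auto
  have "nrm (of_rat q) \<le> 1"
    using nrm_diff[of x "x - of_rat q"] q le1 assms by simp
  then obtain n where "n < p ^ k" "nrm (of_rat q - of_nat n) \<le> (1 / real p) ^ k"
    using rat_residue by blast
  moreover have "nrm (x - of_nat n) \<le> max (nrm (x - of_rat q)) (nrm (of_rat q - of_nat n))"
    using nrm_add[of "x - of_rat q" "of_rat q - of_nat n"] by simp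
  ultimately show ?thesis using q by (intro exI[of _ n]) auto
qed

end

section \<open>Finite-dimensional division algebras over the \<open>p\<close>-adic numbers\<close>

lemma unital_ring_hom_facts:
  assumes "unital_ring_hom h"
  shows "h 1 = 1" "h (x + y) = h x + h y" "h (x * y) = h x * h y" "h 0 = 0" "h (- x) = - h x"
    "h (x - y) = h x - h y" "h (x ^ n) = h x ^ n" "h (of_nat n) = of_nat n" "h (sum f A) = (\<Sum>a\<in>A. h (f a))"
proof -
  show 1: "h 1 = 1" and add: "h (x + y) = h x + h y" and m: "h (x * y) = h x * h y" for x y
    using assms by (auto simp: unital_ring_hom_def)
  show 0: "h 0 = 0" using add[of 0 0] by simp
  show min: "h (- x) = - h x" for x using add[of "- x" x] 0 by (simp add: add_eq_0_iff2)
  show "h (x - y) = h x - h y" using add[of x "- y"] min by simp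
  show "h (x ^ n) = h x ^ n" by (induction n) (auto simp: 1 m)
  show "h (of_nat n) = of_nat n" by (induction n) (auto simp: 0 1 add)
  show "h (sum f A) = (\<Sum>a\<in>A. h (f a))"
    by (induction A rule: infinite_finite_induct) (auto simp: 0 add)
qed

lemma unital_ring_hom_eq_0:
  fixes h :: "'a::division_ring \<Rightarrow> 'c::ring_1"
  assumes "unital_ring_hom h"
  shows "h x = 0 \<longleftrightarrow> x = 0"
proof -
  note facts = unital_ring_hom_facts[OF assms]
  have "h x \<noteq> 0" if "x \<noteq> 0"
  proof
    assume "h x = 0"
    then have "h (x * inverse x) = 0" by (simp add: facts)
    then show False using that facts by simp
  qed
  then show ?thesis using facts by auto
qed

lemma unital_ring_hom_inverse:
  fixes h :: "'a::division_ring \<Rightarrow> 'c::division_ring"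
  assumes "unital_ring_hom h"
  shows "h (inverse x) = inverse (h x)"
proof (cases "x = 0")
  case False
  have "h x * h (inverse x) = 1"
    using False by (simp add: unital_ring_hom_facts(1)[OF assms] flip: unital_ring_hom_facts(3)[OF assms])
  then show ?thesis by (rule inverse_unique[symmetric])
qed (simp add: unital_ring_hom_facts[OF assms])

lemma vector_space_scale_along:
  "unital_ring_hom h \<Longrightarrow> vector_space (scale_along h)"
  by unfold_locales (auto simp: scale_along_def unital_ring_hom_facts algebra_simps)

lemma conj_power:
  fixes z x :: "'b::division_ring"
  assumes "z \<noteq> 0"
  shows "(z * x * inverse z) ^ n = z * x ^ n * inverse z"
proof (induction n)
  case (Suc n)
  have "(z * x * inverse z) ^ Suc n = z * x * (inverse z * z) * x ^ n * inverse z"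
    unfolding power_Suc Suc by (simp only: mult.assoc)
  also have "\<dots> = z * x ^ Suc n * inverse z" using assms by simp (simp add: mult.assoc)
  finally show ?case .
qed (use assms in simp)

locale padic_division_algebra = padic_numbers p nrm
  for p :: nat and nrm :: "'k::field_char_0 \<Rightarrow> real" +
  fixes j :: "'k \<Rightarrow> 'b::division_ring" and Bs :: "'b set"
  assumes j_hom: "unital_ring_hom j"
    and j_central: "j a * x = x * j a"
    and fin_dim: "finite_dimensional_vector_space (scale_along j) Bs"
begin

sublocale V: finite_dimensional_vector_space "scale_along j" Bs
  by (rule fin_dim)

lemmas j_simps [simp] = unital_ring_hom_facts[OF j_hom]
lemma j_eq_0 [simp]: "j a = 0 \<longleftrightarrow> a = 0" by (rule unital_ring_hom_eq_0[OF j_hom])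

section \<open>Coordinates over the p-adic numbers and their maximum norm\<close>

abbreviation co :: "'b \<Rightarrow> 'b \<Rightarrow> 'k" where "co \<equiv> V.representation Bs"

lemma co_add: "co (x + y) b = co x b + co y b"
  by (subst V.representation_add) (auto simp: V.independent_Basis V.span_Basis)

lemma co_scale: "co (j a * x) b = a * co x b"
  using V.representation_scale[of Bs x a] by (auto simp: V.independent_Basis V.span_Basis scale_along_def)

lemma co_minus: "co (- x) b = - co x b"
  using co_scale[of "-1" x b] by simp

lemma co_diff: "co (x - y) b = co x b - co y b"
  using co_add[of x "- y" b] by (simp add: co_minus)

lemma co_expand: "x = (\<Sum>b\<in>Bs. j (co x b) * b)"
  using V.sum_representation_eq[of Bs x Bs] V.independent_Basis V.span_Basis V.finite_Basis
  by (auto simp: scale_along_def)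

lemma co_combination:
  assumes "b \<in> Bs"
  shows "co (\<Sum>b\<in>Bs. j (c b) * b) b = c b"
proof -
  have sum: "co (\<Sum>b\<in>A. j (c b) * b) b' = (\<Sum>b\<in>A. c b * co b b')" if "finite A" for A b'
    using that
  proof (induction A)
    case empty
    then show ?case using co_scale[of 0 0 b'] by simp
  qed (auto simp: co_add co_scale)
  have "co (\<Sum>b\<in>Bs. j (c b) * b) b = (\<Sum>b'\<in>Bs. if b = b' then c b' else 0)"
    unfolding sum[OF V.finite_Basis]
    by (intro sum.cong refl) (auto simp: V.representation_basis V.independent_Basis)
  also have "\<dots> = c b" using assms V.finite_Basis by simp
  finally show ?thesis .
qed

lemma Bs_nonempty: "Bs \<noteq> {}"
proof
  assume "Bs = {}"
  then have "(1::'b) = 0" using co_expand[of 1] by simp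
  then show False by simp
qed

definition bn :: "'b \<Rightarrow> real" where "bn x = Max ((\<lambda>b. nrm (co x b)) ` Bs)"

lemma bn_le_iff: "bn x \<le> M \<longleftrightarrow> (\<forall>b\<in>Bs. nrm (co x b) \<le> M)"
  unfolding bn_def using V.finite_Basis Bs_nonempty by (subst Max_le_iff) auto

lemma bn_less_iff: "bn x < M \<longleftrightarrow> (\<forall>b\<in>Bs. nrm (co x b) < M)"
  unfolding bn_def using V.finite_Basis Bs_nonempty by (subst Max_less_iff) auto

lemma nrm_co_le: "b \<in> Bs \<Longrightarrow> nrm (co x b) \<le> bn x"
  using bn_le_iff[of x "bn x"] by auto

lemma bn_attained: "\<exists>b\<in>Bs. bn x = nrm (co x b)"
proof -
  have "bn x \<in> (\<lambda>b. nrm (co x b)) ` Bs"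
    unfolding bn_def using V.finite_Basis Bs_nonempty by (intro Max_in) auto
  then show ?thesis by auto
qed

lemma bn_nonneg [simp]: "0 \<le> bn x"
  using bn_attained[of x] by auto

lemma bn_eq_0 [simp]: "bn x = 0 \<longleftrightarrow> x = 0"
proof
  assume "bn x = 0"
  then have "nrm (co x b) \<le> 0" if "b \<in> Bs" for b using bn_le_iff[of x 0] that by auto
  then have "co x b = 0" if "b \<in> Bs" for b using that nrm_nonneg[of "co x b"] by (metis antisym nrm_eq_0)
  then show "x = 0" using co_expand[of x] by simp
next
  assume "x = 0"
  then show "bn x = 0" using co_scale[of 0 0] bn_attained[of 0] by auto
qed

lemma bn_0 [simp]: "bn 0 = 0" by simp

lemma bn_pos: "x \<noteq> 0 \<Longrightarrow> 0 < bn x"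
  using bn_nonneg[of x] bn_eq_0[of x] by linarith

lemma bn_scale: "bn (j a * x) = nrm a * bn x"
proof (rule antisym)
  show "bn (j a * x) \<le> nrm a * bn x"
    by (auto simp: bn_le_iff co_scale nrm_mult intro!: mult_left_mono nrm_co_le)
  obtain b where b: "b \<in> Bs" "bn x = nrm (co x b)" using bn_attained by blast
  show "nrm a * bn x \<le> bn (j a * x)"
    using nrm_co_le[OF b(1), of "j a * x"] b by (simp add: co_scale nrm_mult)
qed

lemma bn_minus [simp]: "bn (- x) = bn x"
  using bn_scale[of "-1" x] by simp

lemma bn_add: "bn (x + y) \<le> max (bn x) (bn y)"
  unfolding bn_le_iff co_add
proof
  fix b assume "b \<in> Bs"
  then show "nrm (co x b + co y b) \<le> max (bn x) (bn y)"
    using nrm_add[of "co x b" "co y b"] nrm_co_le[of b x] nrm_co_le[of b y] by linarith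
qed

lemma bn_diff: "bn (x - y) \<le> max (bn x) (bn y)"
  using bn_add[of x "- y"] by simp

lemma bn_commute: "bn (x - y) = bn (y - x)"
  by (metis minus_diff_eq bn_minus)

lemma bn_sum: "0 \<le> M \<Longrightarrow> (\<And>a. a \<in> A \<Longrightarrow> bn (f a) \<le> M) \<Longrightarrow> bn (sum f A) \<le> M"
proof (induction A rule: infinite_finite_induct)
  case (insert a A)
  then have "max (bn (f a)) (bn (sum f A)) \<le> M" by simp
  with bn_add[of "f a" "sum f A"] have "bn (f a + sum f A) \<le> M" by linarith
  with insert show ?case by simp
qed auto

text \<open>Continuity of linear functionals; they later separate points from subspaces and bound
  coefficients.\<close>

lemma functional_bounded:
  assumes add: "\<And>x y. l (x + y) = l x + l y" and scale: "\<And>a x. l (j a * x) = a * l x"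
  shows "\<exists>C>0. \<forall>x. nrm (l x) \<le> C * bn x"
proof -
  define C where "C = Max (nrm ` l ` Bs) + 1"
  have Cb: "nrm (l b) \<le> C" if "b \<in> Bs" for b
  proof -
    have "nrm (l b) \<le> Max (nrm ` l ` Bs)" using that V.finite_Basis by (intro Max_ge) auto
    then show ?thesis by (simp add: C_def)
  qed
  then have C: "0 \<le> C" using Bs_nonempty nrm_nonneg order_trans by blast
  have "nrm (l x) \<le> C * bn x" for x
  proof -
    have l0: "l 0 = 0" using scale[of 0 0] by simp
    have lsum: "l (sum f A) = (\<Sum>a\<in>A. l (f a))" for f and A :: "'b set"
      by (induction A rule: infinite_finite_induct) (auto simp: add l0)
    have "nrm (l x) = nrm (\<Sum>b\<in>Bs. co x b * l b)"
      by (subst co_expand[of x]) (simp add: lsum scale)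
    also have "\<dots> \<le> C * bn x"
    proof (rule nrm_sum)
      fix b assume b: "b \<in> Bs"
      have "nrm (co x b) * nrm (l b) \<le> bn x * C"
        using b by (intro mult_mono nrm_co_le Cb) auto
      then show "nrm (co x b * l b) \<le> C * bn x" by (simp add: nrm_mult mult.commute)
    qed (simp add: C)
    finally show ?thesis .
  qed
  moreover have "nrm (l x) \<le> (C + 1) * bn x" for x
    using order_trans[OF calculation[of x], of "(C + 1) * bn x"] by (simp add: distrib_right)
  ultimately show ?thesis using C by (intro exI[of _ "C + 1"]) auto
qed

lemma bn_mult_bounded: "\<exists>C>0. \<forall>x y. bn (x * y) \<le> C * bn x * bn y"
proof -
  define C where "C = Max ((\<lambda>(b, b'). bn (b * b')) ` (Bs \<times> Bs))"
  have Cb: "bn (b * b') \<le> C" if "b \<in> Bs" "b' \<in> Bs" for b b'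
    unfolding C_def using that V.finite_Basis by (intro Max_ge) (auto intro!: image_eqI[of _ _ "(b, b')"])
  then have C: "0 \<le> C" using Bs_nonempty bn_nonneg order_trans by blast
  have "bn (x * y) \<le> C * bn x * bn y" for x y
  proof -
    have "x * y = (\<Sum>b\<in>Bs. \<Sum>b'\<in>Bs. j (co x b * co y b') * (b * b'))"
    proof -
      have "j a * b * (j c * d) = j (a * c) * (b * d)" for a b c d
      proof -
        have "j a * b * (j c * d) = j a * (b * j c) * d" by (simp only: mult.assoc)
        also have "b * j c = j c * b" by (rule j_central[symmetric])
        finally show ?thesis by (simp add: mult.assoc)
      qed
      moreover have "x * y = (\<Sum>b\<in>Bs. j (co x b) * b) * (\<Sum>b\<in>Bs. j (co y b) * b)"
        by (simp flip: co_expand)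
      ultimately show ?thesis by (simp only: sum_product)
    qed
    also have "bn \<dots> \<le> C * bn x * bn y"
    proof (intro bn_sum)
      fix b b' assume b: "b \<in> Bs" "b' \<in> Bs"
      have "nrm (co x b) * nrm (co y b') * bn (b * b') \<le> bn x * bn y * C"
        using b by (intro mult_mono nrm_co_le Cb) auto
      then show "bn (j (co x b * co y b') * (b * b')) \<le> C * bn x * bn y"
        by (simp only: bn_scale nrm_mult) (simp add: mult_ac)
    qed (auto simp: C)
    finally show ?thesis .
  qed
  moreover have "bn (x * y) \<le> (C + 1) * bn x * bn y" for x y
    using order_trans[OF calculation[of x y], of "(C + 1) * bn x * bn y"] by (simp add: distrib_right)
  ultimately show ?thesis using C by (intro exI[of _ "C + 1"]) auto
qed

text \<open>Each coordinate is replaced by a natural number below \<open>p ^ k\<close>, which leaves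
  finitely many centres.\<close>

lemma totally_bounded:
  assumes "0 < e"
  shows "\<exists>T. finite T \<and> (\<forall>t\<in>T. bn t \<le> 1) \<and> (\<forall>x. bn x \<le> 1 \<longrightarrow> (\<exists>t\<in>T. bn (x - t) < e))"
proof -
  obtain k where k: "(1 / real p) ^ k < e"
    using real_arch_pow_inv[OF assms, of "1 / real p"] p_gt_1 by auto
  define T where "T = (\<lambda>n. \<Sum>b\<in>Bs. j (of_nat (n b)) * b) ` (Pi\<^sub>E Bs (\<lambda>_. {..<p ^ k}))"
  have "finite T" unfolding T_def using V.finite_Basis by (intro finite_imageI finite_PiE) auto
  moreover have "bn t \<le> 1" if t: "t \<in> T" for t
  proof -
    obtain n where "t = (\<Sum>b\<in>Bs. j (of_nat (n b)) * b)" using t unfolding T_def by blast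
    then show ?thesis using co_combination[of _ "\<lambda>b. of_nat (n b)"]
      by (simp add: bn_le_iff nrm_nat_le_1 del: j_simps)
  qed
  moreover have "\<exists>t\<in>T. bn (x - t) < e" if x: "bn x \<le> 1" for x
  proof -
    have "\<exists>n<p ^ k. nrm (co x b - of_nat n) \<le> (1 / real p) ^ k" if "b \<in> Bs" for b
      using residue[of "co x b"] x that bn_le_iff by blast
    then obtain n where n: "\<And>b. b \<in> Bs \<Longrightarrow> n b < p ^ k \<and> nrm (co x b - of_nat (n b)) \<le> (1 / real p) ^ k"
      by metis
    define t where "t = (\<Sum>b\<in>Bs. j (of_nat (n b)) * b)"
    have "t = (\<Sum>b\<in>Bs. j (of_nat (restrict n Bs b)) * b)"
      unfolding t_def by (intro sum.cong) auto
    moreover have "restrict n Bs \<in> Pi\<^sub>E Bs (\<lambda>_. {..<p ^ k})" using n by auto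
    ultimately have "t \<in> T" unfolding T_def by blast
    moreover have "co t b = of_nat (n b)" if "b \<in> Bs" for b
      unfolding t_def using co_combination[OF that, of "\<lambda>b. of_nat (n b)"] .
    then have "bn (x - t) < e" using n k by (auto simp: bn_less_iff co_diff intro: le_less_trans)
    ultimately show ?thesis by blast
  qed
  ultimately show ?thesis by blast
qed

lemma Cauchy_converges:
  assumes "\<And>e. 0 < e \<Longrightarrow> \<exists>M. \<forall>m\<ge>M. \<forall>n\<ge>M. bn (X m - X n) < e"
  shows "\<exists>L. (\<lambda>n. bn (X n - L)) \<longlonglongrightarrow> 0"
proof -
  have "\<exists>L. (\<lambda>n. nrm (co (X n) b - L)) \<longlonglongrightarrow> 0" if b: "b \<in> Bs" for b
  proof (rule nrm_complete)
    fix e :: real assume "0 < e"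
    then obtain N where "\<And>m n. N \<le> m \<Longrightarrow> N \<le> n \<Longrightarrow> bn (X m - X n) < e"
      using assms by blast
    then show "\<exists>M. \<forall>m\<ge>M. \<forall>n\<ge>M. nrm (co (X m) b - co (X n) b) < e"
      using b by (auto simp: bn_less_iff co_diff)
  qed
  then obtain L where L: "\<And>b. b \<in> Bs \<Longrightarrow> (\<lambda>n. nrm (co (X n) b - L b)) \<longlonglongrightarrow> 0" by metis
  define l where "l = (\<Sum>b\<in>Bs. j (L b) * b)"
  have col: "co l b = L b" if "b \<in> Bs" for b using co_combination[OF that, of L] by (simp add: l_def)
  have "(\<lambda>n. bn (X n - l)) \<longlonglongrightarrow> 0"
  proof (rule tendsto_sandwich[OF _ _ tendsto_const])
    show "\<forall>\<^sub>F n in sequentially. bn (X n - l) \<le> (\<Sum>b\<in>Bs. nrm (co (X n) b - L b))"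
    proof (rule always_eventually, rule allI)
      fix n
      show "bn (X n - l) \<le> (\<Sum>b\<in>Bs. nrm (co (X n) b - L b))"
        unfolding bn_le_iff co_diff
        using col by (auto intro!: member_le_sum V.finite_Basis)
    qed
    show "(\<lambda>n. \<Sum>b\<in>Bs. nrm (co (X n) b - L b)) \<longlonglongrightarrow> 0"
      using tendsto_sum[of Bs "\<lambda>b n. nrm (co (X n) b - L b)" "\<lambda>_. 0"] L by simp
  qed simp
  then show ?thesis by blast
qed

text \<open>The type of \<open>B\<close> belongs to no metric class, so a metric space is
  interpreted locally to obtain the sequential form of total boundedness.\<close>

lemma bolzano_weierstrass:
  fixes X :: "nat \<Rightarrow> 'b"
  assumes "\<And>n. bn (X n) \<le> 1"
  shows "\<exists>r L. strict_mono r \<and> (\<lambda>n. bn (X (r n) - L)) \<longlonglongrightarrow> 0"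
proof -
  interpret M: Metric_space UNIV "\<lambda>x y. bn (x - y)"
  proof
    show "bn (x - z) \<le> bn (x - y) + bn (y - z)" for x y z
    proof -
      have "bn (x - z) \<le> max (bn (x - y)) (bn (y - z))" using bn_add[of "x - y" "y - z"] by simp
      then show ?thesis using bn_nonneg[of "x - y"] bn_nonneg[of "y - z"] by linarith
    qed
  qed (auto simp: bn_commute)
  have "M.mtotally_bounded {x. bn x \<le> 1}"
    unfolding M.mtotally_bounded_def
  proof (intro allI impI)
    fix e :: real assume "0 < e"
    from totally_bounded[OF this] obtain T where
      "finite T" "\<forall>t\<in>T. bn t \<le> 1" "\<forall>x. bn x \<le> 1 \<longrightarrow> (\<exists>t\<in>T. bn (x - t) < e)" by blast
    then show "\<exists>K. finite K \<and> K \<subseteq> {x. bn x \<le> 1} \<and> {x. bn x \<le> 1} \<subseteq> (\<Union>x\<in>K. M.mball x e)"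
      by (intro exI[of _ T]) (auto simp: M.mball_def bn_commute)
  qed
  then have all: "\<forall>X. range X \<subseteq> {x. bn x \<le> 1} \<longrightarrow> (\<exists>r::nat \<Rightarrow> nat. strict_mono r \<and> M.MCauchy (X \<circ> r))"
    unfolding M.mtotally_bounded_sequentially by blast
  have "range X \<subseteq> {x. bn x \<le> 1}" using assms by auto
  from all[rule_format, OF this] obtain r where r: "strict_mono r" "M.MCauchy (X \<circ> r)" by auto
  have "\<exists>M. \<forall>m\<ge>M. \<forall>n\<ge>M. bn ((X \<circ> r) m - (X \<circ> r) n) < e" if "0 < e" for e
    using conjunct2[OF r(2)[unfolded M.MCauchy_def], rule_format, OF that] by metis
  then have "\<exists>L. (\<lambda>n. bn ((X \<circ> r) n - L)) \<longlonglongrightarrow> 0" by (rule Cauchy_converges)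
  then obtain L where "(\<lambda>n. bn ((X \<circ> r) n - L)) \<longlonglongrightarrow> 0" by auto
  with r(1) show ?thesis by (intro exI[of _ r] exI[of _ L]) simp
qed

text \<open>Here compactness meets division: a failure gives sequences \<open>X\<close> and
  \<open>Y\<close> of norm 1 whose products tend to 0. A limit point \<open>L\<close> of
  \<open>X\<close> is nonzero and makes \<open>L * Y\<close> tend to 0 along a subsequence, although
  \<open>L\<close> is invertible.\<close>

lemma bn_inverse_bounded: "\<exists>C>0. \<forall>x\<noteq>0. bn x * bn (inverse x) \<le> C"
proof (rule ccontr)
  assume "\<not> ?thesis"
  then have "\<exists>x\<noteq>0. real (Suc n) < bn x * bn (inverse x)" for n
    by (metis linorder_not_le of_nat_0_less_iff zero_less_Suc)
  then obtain Z where Z: "\<And>n. Z n \<noteq> 0" "\<And>n. real (Suc n) < bn (Z n) * bn (inverse (Z n))" by metis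
  \<comment> \<open>The maximum is the norm of a coordinate, so a scalar brings the norm to exactly
    1 and not only into a bounded range.\<close>
  have normalise: "\<exists>c. c \<noteq> 0 \<and> bn (j c * x) = 1" if "x \<noteq> 0" for x
  proof -
    obtain b where "bn x = nrm (co x b)" using bn_attained by blast
    moreover have "co x b \<noteq> 0" using calculation bn_pos[OF that] by auto
    ultimately show ?thesis
      using nrm_mult[of "inverse (co x b)" "co x b"] by (intro exI[of _ "inverse (co x b)"]) (simp add: bn_scale)
  qed
  then have "\<exists>c. c \<noteq> 0 \<and> bn (j c * Z n) = 1" for n using Z by blast
  then obtain c where c: "\<And>n. c n \<noteq> 0" "\<And>n. bn (j (c n) * Z n) = 1" by metis
  have "\<exists>c. c \<noteq> 0 \<and> bn (j c * inverse (Z n)) = 1" for n using normalise[of "inverse (Z n)"] Z by simp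
  then obtain d where d: "\<And>n. d n \<noteq> 0" "\<And>n. bn (j (d n) * inverse (Z n)) = 1" by metis
  define X where "X n = j (c n) * Z n" for n
  define Y where "Y n = j (d n) * inverse (Z n)" for n
  have XY: "bn (X n * Y n) \<le> bn 1 / real (Suc n)" for n
  proof -
    have "X n * Y n = j (c n) * (Z n * j (d n)) * inverse (Z n)" by (simp add: X_def Y_def mult.assoc)
    also have "Z n * j (d n) = j (d n) * Z n" by (rule j_central[symmetric])
    also have "j (c n) * (j (d n) * Z n) * inverse (Z n) = j (c n * d n) * 1"
      using Z(1)[of n] by (simp add: mult.assoc)
    finally have "bn (X n * Y n) = nrm (c n) * nrm (d n) * bn 1" by (simp only: bn_scale nrm_mult)
    moreover have "nrm (c n) * nrm (d n) \<le> 1 / real (Suc n)"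
    proof -
      have "(nrm (c n) * nrm (d n)) * (bn (Z n) * bn (inverse (Z n))) = 1"
      proof -
        have "(nrm (c n) * bn (Z n)) * (nrm (d n) * bn (inverse (Z n))) = 1"
          using c(2)[of n] d(2)[of n] by (simp add: bn_scale)
        then show ?thesis by (simp only: mult_ac)
      qed
      moreover have "bn (Z n) * bn (inverse (Z n)) \<noteq> 0" using Z(1)[of n] by simp
      ultimately have "nrm (c n) * nrm (d n) = 1 / (bn (Z n) * bn (inverse (Z n)))"
        by (simp only: eq_divide_eq) simp
      also have "\<dots> \<le> 1 / real (Suc n)" using Z(2)[of n] by (intro divide_left_mono) auto
      finally show ?thesis .
    qed
    ultimately show ?thesis using mult_right_mono[of "nrm (c n) * nrm (d n)" "1 / real (Suc n)" "bn 1"] by simp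
  qed
  obtain r L where r: "strict_mono r" and L: "(\<lambda>n. bn (X (r n) - L)) \<longlonglongrightarrow> 0"
    using bolzano_weierstrass[of X] c by (auto simp: X_def)
  have L0: "L \<noteq> 0"
  proof
    assume "L = 0"
    then have "(\<lambda>n. 1::real) \<longlonglongrightarrow> 0" using L c(2) by (simp add: X_def)
    then show False by (simp add: LIMSEQ_const_iff)
  qed
  obtain C where C: "C > 0" "\<And>x y. bn (x * y) \<le> C * bn x * bn y" using bn_mult_bounded by blast
  have bound: "1 \<le> C * bn (inverse L) * (C * bn (X (r n) - L) + bn 1 / real (Suc (r n)))" for n
  proof -
    have "L * Y (r n) = X (r n) * Y (r n) - (X (r n) - L) * Y (r n)" by (simp add: algebra_simps)
    then have "bn (L * Y (r n)) \<le> max (bn (X (r n) * Y (r n))) (bn ((X (r n) - L) * Y (r n)))"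
      using bn_diff by metis
    also have "\<dots> \<le> bn (X (r n) * Y (r n)) + bn ((X (r n) - L) * Y (r n))"
      using bn_nonneg[of "X (r n) * Y (r n)"] bn_nonneg[of "(X (r n) - L) * Y (r n)"] by linarith
    also have "\<dots> \<le> bn 1 / real (Suc (r n)) + C * bn (X (r n) - L)"
      using C(2)[of "X (r n) - L" "Y (r n)"] d(2)[of "r n"] XY[of "r n"] by (simp add: Y_def)
    finally have le: "bn (L * Y (r n)) \<le> C * bn (X (r n) - L) + bn 1 / real (Suc (r n))" by simp
    have "1 = bn (inverse L * (L * Y (r n)))"
      using d(2)[of "r n"] L0 by (simp add: Y_def flip: mult.assoc)
    also have "\<dots> \<le> C * bn (inverse L) * bn (L * Y (r n))" by (rule C(2))
    also have "\<dots> \<le> C * bn (inverse L) * (C * bn (X (r n) - L) + bn 1 / real (Suc (r n)))"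
      using le C(1) by (intro mult_left_mono) auto
    finally show ?thesis .
  qed
  have "(\<lambda>n. C * bn (inverse L) * (C * bn (X (r n) - L) + bn 1 / real (Suc (r n)))) \<longlonglongrightarrow> C * bn (inverse L) * (C * 0 + 0)"
  proof (intro tendsto_intros L)
    have "(\<lambda>n. bn 1 / real (Suc n)) \<longlonglongrightarrow> 0"
      by (rule LIMSEQ_Suc) (rule lim_const_over_n)
    then show "(\<lambda>n. bn 1 / real (Suc (r n))) \<longlonglongrightarrow> 0"
      using LIMSEQ_subseq_LIMSEQ[OF _ r] by (fastforce simp: o_def)
  qed
  then have "1 \<le> C * bn (inverse L) * (C * 0 + 0)"
    by (rule LIMSEQ_le_const) (use bound in blast)
  then show False by simp
qed

section \<open>The spectral norm\<close>

definition Cm :: real where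
  "Cm = (SOME C. 1 \<le> C \<and> (\<forall>x y. bn (x * y) \<le> C * bn x * bn y) \<and> (\<forall>x y. bn x * bn y \<le> C * bn (x * y)))"

lemma Cm: "1 \<le> Cm" "bn (x * y) \<le> Cm * bn x * bn y" "bn x * bn y \<le> Cm * bn (x * y)"
proof -
  obtain C where C: "C > 0" "\<And>x y. bn (x * y) \<le> C * bn x * bn y" using bn_mult_bounded by blast
  obtain C' where C': "C' > 0" "\<And>x. x \<noteq> 0 \<Longrightarrow> bn x * bn (inverse x) \<le> C'" using bn_inverse_bounded by blast
  define A where "A = max 1 (max C (C * C'))"
  have A: "1 \<le> A" "C \<le> A" "C * C' \<le> A" by (auto simp: A_def)
  have 1: "bn (x * y) \<le> A * bn x * bn y" for x y
  proof -
    have "C * bn x * bn y \<le> A * bn x * bn y" using A by (intro mult_right_mono) auto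
    then show ?thesis using C(2)[of x y] by linarith
  qed
  have 2: "bn x * bn y \<le> A * bn (x * y)" for x y
  proof (cases "x = 0")
    case False
    have "bn y = bn (inverse x * (x * y))" using False by (simp flip: mult.assoc)
    also have "\<dots> \<le> C * bn (inverse x) * bn (x * y)" by (rule C(2))
    finally have "bn x * bn y \<le> bn x * (C * bn (inverse x) * bn (x * y))" by (intro mult_left_mono) auto
    also have "\<dots> = C * (bn x * bn (inverse x)) * bn (x * y)" by simp
    also have "\<dots> \<le> C * C' * bn (x * y)"
      using C C'(2)[OF False] by (intro mult_right_mono mult_left_mono) auto
    also have "\<dots> \<le> A * bn (x * y)" using A by (intro mult_right_mono) auto
    finally show ?thesis .
  qed simp
  have "1 \<le> Cm \<and> (\<forall>x y. bn (x * y) \<le> Cm * bn x * bn y) \<and> (\<forall>x y. bn x * bn y \<le> Cm * bn (x * y))"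
    unfolding Cm_def by (rule someI[of _ A]) (use 1 2 A in blast)
  then show "1 \<le> Cm" "bn (x * y) \<le> Cm * bn x * bn y" "bn x * bn y \<le> Cm * bn (x * y)" by auto
qed

lemma ln_bn_mult:
  assumes "x \<noteq> 0" "y \<noteq> 0"
  shows "\<bar>ln (bn (x * y)) - (ln (bn x) + ln (bn y))\<bar> \<le> ln Cm"
proof -
  have pos: "0 < bn x" "0 < bn y" by (intro bn_pos assms)+
  have pos': "0 < bn (x * y)" by (intro bn_pos no_zero_divisors assms)
  have Cm0: "0 < Cm" using Cm(1) by linarith
  have "ln (bn (x * y)) \<le> ln (Cm * bn x * bn y)" by (intro ln_mono Cm(2) pos')
  also have "\<dots> = ln Cm + ln (bn x) + ln (bn y)"
    by (simp only: ln_mult_pos pos Cm0 mult_pos_pos)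
  finally have 1: "ln (bn (x * y)) \<le> ln Cm + ln (bn x) + ln (bn y)" .
  have "ln (bn x) + ln (bn y) = ln (bn x * bn y)" by (simp only: ln_mult_pos pos)
  also have "\<dots> \<le> ln (Cm * bn (x * y))" by (intro ln_mono Cm(3) mult_pos_pos pos)
  also have "\<dots> = ln Cm + ln (bn (x * y))" by (simp only: ln_mult_pos pos' Cm0)
  finally show ?thesis using 1 by linarith
qed

text \<open>With the exponents \<open>2 ^ k\<close> alone, consecutive terms differ by a geometric
  amount, which replaces the subadditivity argument for the full sequence of powers.\<close>

definition lg :: "'b \<Rightarrow> nat \<Rightarrow> real" where "lg x k = ln (bn (x ^ (2 ^ k))) / 2 ^ k"

lemma lg_step:
  assumes "x \<noteq> 0"
  shows "\<bar>lg x (Suc k) - lg x k\<bar> \<le> ln Cm * (1 / 2) ^ Suc k"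
proof -
  have "x ^ (2 ^ Suc k) = x ^ (2 ^ k) * x ^ (2 ^ k)" by (simp add: mult_2 power_add)
  then have "\<bar>ln (bn (x ^ (2 ^ Suc k))) - 2 * ln (bn (x ^ (2 ^ k)))\<bar> \<le> ln Cm"
    using ln_bn_mult[of "x ^ (2 ^ k)" "x ^ (2 ^ k)"] assms by simp
  then have "\<bar>ln (bn (x ^ (2 ^ Suc k))) - 2 * ln (bn (x ^ (2 ^ k)))\<bar> / 2 ^ Suc k \<le> ln Cm / 2 ^ Suc k"
    by (intro divide_right_mono) auto
  moreover have "lg x (Suc k) - lg x k = (ln (bn (x ^ (2 ^ Suc k))) - 2 * ln (bn (x ^ (2 ^ k)))) / 2 ^ Suc k"
    by (simp add: lg_def field_simps)
  moreover have "\<bar>A / 2 ^ Suc k\<bar> = \<bar>A\<bar> / 2 ^ Suc k" for A :: real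
    by (simp only: abs_divide power_abs abs_numeral)
  moreover have "ln Cm * (1 / 2) ^ Suc k = ln Cm / 2 ^ Suc k"
    by (simp only: power_one_over times_divide_eq_right mult_1_right)
  ultimately show ?thesis by (simp only:)
qed

lemma lg_tendsto: "x \<noteq> 0 \<Longrightarrow> lg x \<longlonglongrightarrow> lim (lg x)"
proof -
  assume x: "x \<noteq> 0"
  have "summable (\<lambda>k. lg x (Suc k) - lg x k)"
  proof (rule summable_comparison_test')
    show "summable (\<lambda>k. ln Cm * (1 / 2) ^ Suc k)"
      by (intro summable_mult summable_ignore_initial_segment[of _ 1, simplified] summable_geometric) auto
    show "norm (lg x (Suc k) - lg x k) \<le> ln Cm * (1 / 2) ^ Suc k" if "0 \<le> k" for k
      using lg_step[OF x] by simp
  qed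
  then have "convergent (\<lambda>n. lg x n - lg x 0)"
    by (simp add: summable_iff_convergent sum_lessThan_telescope)
  then obtain l where "(\<lambda>n. lg x n - lg x 0) \<longlonglongrightarrow> l" by (auto simp: convergent_def)
  then have "(\<lambda>n. lg x n - lg x 0 + lg x 0) \<longlonglongrightarrow> l + lg x 0" by (intro tendsto_intros)
  then have "convergent (lg x)" by (auto simp: convergent_def)
  then show ?thesis by (simp add: convergent_LIMSEQ_iff)
qed

text \<open>The errors \<open>ln Cm / 2 ^ k\<close> for \<open>k\<close> from 1 on add up to
  \<open>ln Cm\<close>, so the limit stays equivalent to \<open>bn\<close> with the same
  constant.\<close>

lemma lim_lg_close:
  assumes "x \<noteq> 0"
  shows "\<bar>lim (lg x) - ln (bn x)\<bar> \<le> ln Cm"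
proof -
  have close: "\<bar>lg x k - lg x 0\<bar> \<le> ln Cm * (1 - (1 / 2) ^ k)" for k
  proof (induction k)
    case (Suc k)
    have "\<bar>lg x (Suc k) - lg x 0\<bar> \<le> ln Cm * (1 / 2) ^ Suc k + ln Cm * (1 - (1 / 2) ^ k)"
      using lg_step[OF assms, of k] Suc by linarith
    also have "a * (1 / 2 * t) + a * (1 - t) = a * (1 - 1 / 2 * t)" for a t :: real
      by (simp add: field_simps)
    from this[of "ln Cm" "(1 / 2) ^ k"]
    have "ln Cm * (1 / 2) ^ Suc k + ln Cm * (1 - (1 / 2) ^ k) = ln Cm * (1 - (1 / 2) ^ Suc k)"
      unfolding power_Suc .
    finally show ?case .
  qed simp
  have le: "\<bar>lg x k - lg x 0\<bar> \<le> ln Cm" for k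
  proof (rule order_trans[OF close])
    show "ln Cm * (1 - (1 / 2) ^ k) \<le> ln Cm" using Cm(1) by (intro mult_left_le) auto
  qed
  have "(\<lambda>k. \<bar>lg x k - lg x 0\<bar>) \<longlonglongrightarrow> \<bar>lim (lg x) - lg x 0\<bar>"
    by (intro tendsto_intros lg_tendsto assms)
  then have "\<bar>lim (lg x) - lg x 0\<bar> \<le> ln Cm" by (rule LIMSEQ_le_const2) (use le in blast)
  then show ?thesis by (simp add: lg_def)
qed

definition N :: "'b \<Rightarrow> real" where "N x = (if x = 0 then 0 else exp (lim (lg x)))"

lemma N_nonneg [simp]: "0 \<le> N x" by (simp add: N_def)
lemma N_eq_0 [simp]: "N x = 0 \<longleftrightarrow> x = 0" by (simp add: N_def)
lemma N_0 [simp]: "N 0 = 0" by simp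
lemma N_pos: "x \<noteq> 0 \<Longrightarrow> 0 < N x" by (simp add: N_def)

lemma N_le_bn: "N x \<le> Cm * bn x"
proof (cases "x = 0")
  case False
  have pos: "0 < bn x" by (rule bn_pos[OF False])
  have "0 < Cm" using Cm(1) by linarith
  have "exp (lim (lg x)) \<le> exp (ln Cm + ln (bn x))"
    unfolding exp_le_cancel_iff using lim_lg_close[OF False] by linarith
  also have "\<dots> = Cm * bn x" using pos \<open>0 < Cm\<close> by (simp only: exp_add exp_ln)
  finally show ?thesis using False by (simp only: N_def if_False)
qed simp

lemma bn_le_N: "bn x \<le> Cm * N x"
proof (cases "x = 0")
  case False
  have pos: "0 < bn x" by (rule bn_pos[OF False])
  have "0 < Cm" using Cm(1) by linarith
  have "exp (ln (bn x)) \<le> exp (ln Cm + lim (lg x))"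
    unfolding exp_le_cancel_iff using lim_lg_close[OF False] by linarith
  then show ?thesis using pos \<open>0 < Cm\<close> False by (simp only: N_def if_False exp_add exp_ln)
qed simp

lemma lim_lgI: "x \<noteq> 0 \<Longrightarrow> (\<lambda>k. lg x k - f k) \<longlonglongrightarrow> 0 \<Longrightarrow> f \<longlonglongrightarrow> L \<Longrightarrow> lim (lg x) = L"
proof -
  assume "x \<noteq> 0" "(\<lambda>k. lg x k - f k) \<longlonglongrightarrow> 0" "f \<longlonglongrightarrow> L"
  then have "(\<lambda>k. (lg x k - f k) + f k) \<longlonglongrightarrow> 0 + L" by (intro tendsto_add)
  then show ?thesis by (simp add: limI)
qed

lemma bounded_over_pow_tendsto:
  assumes "\<And>k. \<bar>f k\<bar> \<le> C"
  shows "(\<lambda>k. f k / 2 ^ k :: real) \<longlonglongrightarrow> 0"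
proof (rule Lim_null_comparison)
  show "\<forall>\<^sub>F k in sequentially. norm (f k / 2 ^ k) \<le> C * (1 / 2) ^ k"
    using assms by (intro always_eventually allI) (simp add: power_one_over divide_right_mono flip: divide_inverse)
  show "(\<lambda>k. C * (1 / 2) ^ k) \<longlonglongrightarrow> 0"
    using tendsto_mult_right_zero[OF LIMSEQ_realpow_zero[of "1/2"]] by simp
qed

text \<open>Powers of a product of commuting elements split, and the bounded error of
  \<open>ln_bn_mult\<close> disappears after division by \<open>2 ^ k\<close>.\<close>

lemma N_mult_commuting:
  assumes "x * y = y * x"
  shows "N (x * y) = N x * N y"
proof (cases "x = 0 \<or> y = 0")
  case False
  then have nz: "x \<noteq> 0" "y \<noteq> 0" by auto
  have "lim (lg (x * y)) = lim (lg x) + lim (lg y)"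
  proof (rule lim_lgI)
    have pow: "(x * y) ^ n = x ^ n * y ^ n" for n
    proof (induction n)
      case (Suc n)
      have "(x * y) ^ Suc n = x * (y * x ^ n) * y ^ n" by (simp add: Suc mult.assoc)
      also have "y * x ^ n = x ^ n * y" by (rule power_commuting_commutes[symmetric]) (rule assms)
      finally show ?case by (simp add: mult.assoc)
    qed simp
    have "(\<lambda>k. (ln (bn (x ^ 2 ^ k * y ^ 2 ^ k)) - (ln (bn (x ^ 2 ^ k)) + ln (bn (y ^ 2 ^ k)))) / 2 ^ k) \<longlonglongrightarrow> 0"
      by (rule bounded_over_pow_tendsto, rule ln_bn_mult) (use nz in auto)
    then show "(\<lambda>k. lg (x * y) k - (lg x k + lg y k)) \<longlonglongrightarrow> 0"
      by (simp add: lg_def pow diff_divide_distrib add_divide_distrib)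
    show "(\<lambda>k. lg x k + lg y k) \<longlonglongrightarrow> lim (lg x) + lim (lg y)"
      by (intro tendsto_add lg_tendsto nz)
  qed (use nz in simp)
  then show ?thesis using nz by (simp add: N_def exp_add)
qed auto

text \<open>In \<open>conj_power\<close> the factors \<open>z\<close> and \<open>inverse z\<close>
  occur once whatever the exponent, so they contribute a bounded amount that division by
  \<open>2 ^ k\<close> kills.\<close>

lemma N_conj:
  assumes "z \<noteq> 0"
  shows "N (z * x * inverse z) = N x"
proof (cases "x = 0")
  case False
  have nz: "z * x * inverse z \<noteq> 0" using assms False by simp
  have "lim (lg (z * x * inverse z)) = lim (lg x)"
  proof (rule lim_lgI)
    show "(\<lambda>k. lg (z * x * inverse z) k - lg x k) \<longlonglongrightarrow> 0"
    proof -
      have "\<bar>ln (bn ((z * x * inverse z) ^ 2 ^ k)) - ln (bn (x ^ 2 ^ k))\<bar>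
              \<le> 2 * ln Cm + \<bar>ln (bn z)\<bar> + \<bar>ln (bn (inverse z))\<bar>" for k
        unfolding conj_power[OF assms]
        using ln_bn_mult[of "z * x ^ 2 ^ k" "inverse z"] ln_bn_mult[of z "x ^ 2 ^ k"] False assms
        by simp
      from bounded_over_pow_tendsto[OF this] show ?thesis by (simp add: lg_def diff_divide_distrib)
    qed
  qed (use nz lg_tendsto False in auto)
  then show ?thesis using nz False by (simp add: N_def)
qed simp

lemma N_j: "N (j a) = nrm a"
proof (cases "a = 0")
  case False
  have "bn (j a ^ n) = nrm a ^ n * bn 1" for n
    using bn_scale[of "a ^ n" 1] by (simp add: nrm_power)
  moreover have "0 < nrm a" "0 < bn 1" using False bn_pos[of 1] nrm_nonneg[of a] nrm_eq_0[of a] by (auto simp: less_le)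
  ultimately have eq: "lg (j a) k = ln (nrm a) + ln (bn 1) / 2 ^ k" for k
    by (simp add: lg_def ln_mult_pos ln_realpow add_divide_distrib)
  have "lim (lg (j a)) = ln (nrm a)"
  proof (rule lim_lgI)
    show "(\<lambda>k. lg (j a) k - ln (nrm a)) \<longlonglongrightarrow> 0"
      using bounded_over_pow_tendsto[of "\<lambda>_. ln (bn 1)" "\<bar>ln (bn 1)\<bar>"] by (simp add: eq)
  qed (use False in auto)
  then show ?thesis using False \<open>0 < nrm a\<close> by (simp add: N_def)
qed simp

lemma N_1 [simp]: "N 1 = 1" using N_j[of 1] by simp

lemma N_minus [simp]: "N (- x) = N x"
proof -
  have "N (j (-1) * x) = N (j (-1)) * N x" by (rule N_mult_commuting) (rule j_central)
  then show ?thesis by (simp only: N_j) simp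
qed

lemma N_power: "N (x ^ n) = N x ^ n"
proof (induction n)
  case (Suc n)
  have "N (x * x ^ n) = N x * N (x ^ n)" by (rule N_mult_commuting) (simp add: power_commutes)
  then show ?case using Suc by simp
qed simp

text \<open>The ultrametric inequality in normalised form. A common bound for all powers of
  \<open>1 + x\<close> suffices, since a norm above 1 would have unbounded powers.\<close>

lemma N_1_add:
  assumes "N x \<le> 1"
  shows "N (1 + x) \<le> 1"
proof -
  have bound: "N (1 + x) ^ n \<le> Cm * Cm" for n
  proof -
    \<comment> \<open>Carrying the factor \<open>x ^ m\<close> lets the induction peel off
      \<open>1 + x\<close> by the ultrametric inequality for \<open>bn\<close>, with no loss in the
      constant.\<close>
    have "bn (x ^ m * (1 + x) ^ n) \<le> Cm" for m
    proof (induction n arbitrary: m)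
      case 0
      have "bn (x ^ m) \<le> Cm * N x ^ m" using bn_le_N[of "x ^ m"] by (simp add: N_power)
      also have "\<dots> \<le> Cm * 1" using Cm(1) assms by (intro mult_left_mono power_le_one) auto
      finally show ?case by simp
    next
      case (Suc n)
      have "x ^ m * (1 + x) ^ Suc n = x ^ m * (1 + x) ^ n + x ^ Suc m * (1 + x) ^ n"
        by (simp only: power_Suc[of "1 + x"] power_Suc2[of x m] distrib_right distrib_left mult_1_left mult.assoc)
      moreover have "max (bn (x ^ m * (1 + x) ^ n)) (bn (x ^ Suc m * (1 + x) ^ n)) \<le> Cm"
        using Suc[of m] Suc[of "Suc m"] by simp
      ultimately show ?case
        using order_trans[OF bn_add[of "x ^ m * (1 + x) ^ n" "x ^ Suc m * (1 + x) ^ n"]] by (simp only:)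
    qed
    from this[of 0] have "Cm * bn ((1 + x) ^ n) \<le> Cm * Cm" using Cm(1) by (intro mult_left_mono) auto
    then show ?thesis using N_le_bn[of "(1 + x) ^ n"] by (simp add: N_power)
  qed
  show ?thesis
  proof (rule ccontr)
    assume "\<not> N (1 + x) \<le> 1"
    then obtain n where "Cm * Cm < N (1 + x) ^ n" using real_arch_pow[of "N (1 + x)"] by auto
    then show False using bound[of n] by simp
  qed
qed

end

section \<open>Quaternion algebras\<close>

lemma finite_dimensional_tower:
  fixes jF :: "'k::field \<Rightarrow> 'f::field" and jB :: "'f \<Rightarrow> 'b::ring_1"
  assumes hF: "unital_ring_hom jF" and hB: "unital_ring_hom jB"
    and F: "finite_dimensional_vector_space (scale_along jF) BF"
    and B: "finite_dimensional_vector_space (scale_along jB) BB"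
  shows "\<exists>Bs. finite_dimensional_vector_space (scale_along (jB \<circ> jF)) Bs"
proof -
  interpret F: finite_dimensional_vector_space "scale_along jF" BF by (rule F)
  interpret B: finite_dimensional_vector_space "scale_along jB" BB by (rule B)
  note [simp] = unital_ring_hom_facts[OF hB] unital_ring_hom_facts[OF hF]
  have "unital_ring_hom (jB \<circ> jF)"
    by (simp add: unital_ring_hom_def)
  then interpret K: vector_space "scale_along (jB \<circ> jF)" by (rule vector_space_scale_along)
  define T where "T = (\<lambda>(f, b). jB f * b) ` (BF \<times> BB)"
  have finT: "finite T" by (simp add: T_def F.finite_Basis B.finite_Basis)
  have scaled: "jB f * b \<in> K.span T" if b: "b \<in> BB" for f b
  proof -
    have "f \<in> F.span BF" by (simp add: F.span_Basis)
    then show ?thesis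
    proof (induction rule: F.span_induct_alt)
      case base
      show ?case by (simp only: unital_ring_hom_facts(4)[OF hB] mult_zero_left K.span_zero)
    next
      case (step c x y)
      have "jB x * b \<in> K.span T" using step b by (intro K.span_base) (auto simp: T_def)
      from K.span_add[OF K.span_scale[OF this, of c] step(2)]
      have "scale_along (jB \<circ> jF) c (jB x * b) + jB y * b \<in> K.span T" .
      moreover have "jB (scale_along jF c x + y) * b = scale_along (jB \<circ> jF) c (jB x * b) + jB y * b"
        by (simp add: scale_along_def distrib_right mult.assoc)
      ultimately show ?case by (simp only:)
    qed
  qed
  have "x \<in> K.span T" for x
  proof -
    have "x \<in> B.span BB" by (simp add: B.span_Basis)
    then show ?thesis
    proof (induction rule: B.span_induct_alt)
      case base
      show ?case by (rule K.span_zero)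
    next
      case (step c x y)
      from K.span_add[OF scaled[OF step(1), of c] step(2)] show ?case by (simp only: scale_along_def[of jB])
    qed
  qed
  moreover obtain Bs where Bs: "Bs \<subseteq> T" "K.independent Bs" "T \<subseteq> K.span Bs"
    using K.maximal_independent_subset by blast
  ultimately have "K.span Bs = UNIV" using K.span_minimal[OF Bs(3) K.subspace_span] by blast
  then have "finite_dimensional_vector_space (scale_along (jB \<circ> jF)) Bs"
    using finite_subset[OF Bs(1) finT] Bs(2) by unfold_locales
  then show ?thesis by blast
qed

lemma finite_dimensional_of_dim:
  assumes "unital_ring_hom h" "vector_space.dim (scale_along h) UNIV \<noteq> 0"
  shows "\<exists>Bs. finite_dimensional_vector_space (scale_along h) Bs"
proof -
  interpret vector_space "scale_along h" using assms(1) by (rule vector_space_scale_along)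
  obtain Bs where Bs: "Bs \<subseteq> UNIV" "independent Bs" "UNIV \<subseteq> span Bs" "card Bs = dim UNIV"
    by (rule basis_exists)
  have "card Bs \<noteq> 0" unfolding Bs(4) by (rule assms(2))
  then have "finite Bs" by (simp add: card_eq_0_iff)
  moreover have "span Bs = UNIV" using \<open>UNIV \<subseteq> span Bs\<close> by blast
  ultimately have "finite_dimensional_vector_space (scale_along h) Bs"
    using \<open>independent Bs\<close> by unfold_locales
  then show ?thesis by blast
qed

locale quaternion =
  fixes jE :: "'f::field \<Rightarrow> 'e::field" and jB :: "'f \<Rightarrow> 'b::division_ring" and emb :: "'e \<Rightarrow> 'b"
  assumes quat: "quaternion_division_algebra jB"
    and jE_hom: "unital_ring_hom jE"
    and dimE: "vector_space.dim (scale_along jE) (UNIV :: 'e set) = 2"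
    and emb_hom: "unital_ring_hom emb"
    and emb_jE: "emb (jE f) = jB f"
    and two: "(2::'f) \<noteq> 0"
begin

lemma jB_hom: "unital_ring_hom jB" using quat by (simp add: quaternion_division_algebra_def)
lemmas jB_simps [simp] = unital_ring_hom_facts[OF jB_hom]
lemmas emb_simps [simp] = unital_ring_hom_facts[OF emb_hom]
lemmas jE_simps [simp] = unital_ring_hom_facts[OF jE_hom]
lemma jB_eq_0 [simp]: "jB x = 0 \<longleftrightarrow> x = 0" by (rule unital_ring_hom_eq_0[OF jB_hom])
lemma emb_eq_0 [simp]: "emb x = 0 \<longleftrightarrow> x = 0" by (rule unital_ring_hom_eq_0[OF emb_hom])
lemma jB_inverse: "jB (inverse x) = inverse (jB x)" by (rule unital_ring_hom_inverse[OF jB_hom])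
lemma emb_inverse: "emb (inverse x) = inverse (emb x)" by (rule unital_ring_hom_inverse[OF emb_hom])
lemma jB_inj: "jB x = jB y \<longleftrightarrow> x = y" using jB_eq_0[of "x - y"] by simp
lemma emb_inj: "emb x = emb y \<longleftrightarrow> x = y" using emb_eq_0[of "x - y"] by simp

lemma center: "range jB = {z. \<forall>x. z * x = x * z}"
  using quat by (simp add: quaternion_division_algebra_def)

lemma jB_central: "jB f * x = x * jB f"
  using center by blast

lemma two_nonzero: "(2::'b) \<noteq> 0"
proof -
  have "jB 2 = jB (1 + 1)" by (simp only: one_add_one)
  also have "\<dots> = 1 + 1" by (simp only: jB_simps)
  also have "\<dots> = 2" by (rule one_add_one)
  finally show ?thesis using jB_eq_0[of 2] two by metis
qed

lemma dimB: "vector_space.dim (scale_along jB) UNIV = 4"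
  using quat by (simp add: quaternion_division_algebra_def)

lemma B_finite_dimensional: "\<exists>Bs. finite_dimensional_vector_space (scale_along jB) Bs"
  by (rule finite_dimensional_of_dim) (auto simp: jB_hom dimB)

text \<open>Completing the square, possible as 2 is nonzero in \<open>F\<close>, yields a generator
  with square in \<open>F\<close>; conjugation by it is then an involution of
  \<open>B\<close>.\<close>

lemma E_generator: "\<exists>y a. emb y \<notin> range jB \<and> emb y * emb y = jB a \<and> (\<forall>x. \<exists>f g. x = jE f + jE g * y)"
proof -
  obtain Bs where "finite_dimensional_vector_space (scale_along jE) Bs"
    using finite_dimensional_of_dim[OF jE_hom] dimE by auto
  then interpret E: finite_dimensional_vector_space "scale_along jE" Bs .
  have "\<exists>y. y \<notin> range jE"
  proof (rule ccontr)
    assume "\<not> ?thesis"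
    then have "UNIV \<subseteq> E.span {1}"
      by (auto simp: E.span_singleton scale_along_def)
    then have "E.dim UNIV \<le> card {1::'e}" by (intro E.dim_le_card) auto
    then show False using dimE by simp
  qed
  then obtain y0 where y0: "y0 \<notin> range jE" by blast
  have spanned: "\<exists>f g. x = jE f + jE g * y" if y: "y \<notin> range jE" for x y
  proof -
    have "E.independent {y, 1}"
    proof (rule E.independent_insertI)
      show "y \<notin> E.span {1}" using y by (auto simp: E.span_singleton scale_along_def)
      show "E.independent {1}" by simp
    qed
    moreover have "y \<noteq> 1" using y by (metis jE_simps(1) rangeI)
    ultimately have "UNIV \<subseteq> E.span {y, 1}" using dimE by (intro E.card_ge_dim_independent) auto
    then have "x \<in> E.span {y, 1}" by blast
    then obtain g where "x - jE g * y \<in> E.span {1}" by (auto simp: E.span_insert scale_along_def)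
    then obtain f where "x - jE g * y = jE f" by (auto simp: E.span_singleton scale_along_def)
    then have "x = jE f + jE g * y" by (simp add: algebra_simps)
    then show ?thesis by blast
  qed
  obtain a b where ab: "y0 * y0 = jE a + jE b * y0" using spanned[OF y0] by blast
  define y where "y = y0 - jE (b / 2)"
  have y: "y \<notin> range jE"
  proof
    assume "y \<in> range jE"
    then obtain f where "y0 - jE (b / 2) = jE f" unfolding y_def by blast
    then have "y0 = jE (f + b / 2)" by (simp add: algebra_simps)
    then show False using y0 by blast
  qed
  have half: "jE (b / 2) + jE (b / 2) = jE b"
    using two by (simp flip: jE_simps(2))
  have "y * y = y0 * y0 - (jE (b / 2) + jE (b / 2)) * y0 + jE (b / 2) * jE (b / 2)"
    by (simp add: y_def algebra_simps)
  also have "\<dots> = jE (a + b / 2 * (b / 2))" unfolding half ab by (simp only: jE_simps add_diff_cancel_right')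
  finally have yy: "y * y = jE (a + b / 2 * (b / 2))" .
  have "emb y * emb y = jB (a + b / 2 * (b / 2))"
    using yy emb_jE by (metis emb_simps(3))
  moreover have "emb y \<notin> range jB"
  proof
    assume "emb y \<in> range jB"
    then obtain f where "emb y = emb (jE f)" using emb_jE by auto
    then show False using y by (simp add: emb_inj)
  qed
  ultimately show ?thesis using spanned[OF y] by blast
qed

definition i0 :: 'e where
  "i0 = (SOME y. \<exists>a. emb y \<notin> range jB \<and> emb y * emb y = jB a \<and> (\<forall>x. \<exists>f g. x = jE f + jE g * y))"

definition ii :: 'b where "ii = emb i0"

lemma i0: "\<exists>a. emb i0 \<notin> range jB \<and> emb i0 * emb i0 = jB a \<and> (\<forall>x. \<exists>f g. x = jE f + jE g * i0)"
  unfolding i0_def by (rule someI_ex[OF E_generator])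

lemma ii_notin: "ii \<notin> range jB" using i0 by (auto simp: ii_def)
lemma ii_nonzero [simp]: "ii \<noteq> 0" using ii_notin jB_simps(4) by (metis rangeI)
lemma ii_square: "\<exists>a. ii * ii = jB a" using i0 by (auto simp: ii_def)
lemma ii_square_central: "ii * ii * x = x * (ii * ii)"
  using ii_square jB_central by metis
lemma E_expand: "\<exists>f g. emb x = jB f + jB g * ii"
proof -
  obtain f g where "x = jE f + jE g * i0" using i0 by blast
  then have "emb x = jB f + jB g * ii" by (simp add: ii_def emb_jE)
  then show ?thesis by blast
qed

lemma E_memI: "jB f + jB g * ii \<in> range emb"
proof -
  have "jB f + jB g * ii = emb (jE f + jE g * i0)" by (simp add: emb_jE ii_def)
  then show ?thesis by blast
qed

lemma E_commute: "x \<in> range emb \<Longrightarrow> y \<in> range emb \<Longrightarrow> x * y = y * x"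
  by (auto simp flip: emb_simps(3)) (simp add: mult.commute)

text \<open>A commutator of \<open>ii\<close> with any \<open>z\<close> anticommutes with
  \<open>ii\<close> because \<open>ii * ii\<close> is central; as \<open>ii\<close> is not central,
  one of them is nonzero.\<close>

lemma ex_anticommuting: "\<exists>s. s \<noteq> 0 \<and> s * ii = - (ii * s)"
proof -
  obtain z where z: "z * ii \<noteq> ii * z" using ii_notin unfolding center mem_Collect_eq by metis
  have "(z * ii - ii * z) * ii = z * (ii * ii) - ii * z * ii" by (simp add: algebra_simps)
  also have "z * (ii * ii) = ii * ii * z" by (rule ii_square_central[symmetric])
  also have "ii * ii * z - ii * z * ii = - (ii * (z * ii - ii * z))" by (simp add: algebra_simps)
  finally show ?thesis using z by (intro exI[of _ "z * ii - ii * z"]) auto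
qed

definition ss :: 'b where "ss = (SOME s. s \<noteq> 0 \<and> s * ii = - (ii * s))"
lemma ss_nonzero [simp]: "ss \<noteq> 0" and ss_ii: "ss * ii = - (ii * ss)"
  using someI_ex[OF ex_anticommuting] by (auto simp: ss_def)

lemma jB_left_commute: "x * (jB f * y) = jB f * (x * y)"
  by (metis jB_central mult.assoc)

text \<open>Right multiplication by \<open>ss\<close> exchanges the commuting and the anticommuting
  part, so both have the same dimension.\<close>

lemma anticommuting_iff: "x * ii = - (ii * x) \<longleftrightarrow> (\<exists>y. y * ii = ii * y \<and> x = y * ss)"
proof
  assume x: "x * ii = - (ii * x)"
  have si: "inverse ss * ii = - (ii * inverse ss)"
  proof -
    have "inverse ss * ii = inverse ss * (ii * ss) * inverse ss" by (simp add: mult.assoc)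
    also have "ii * ss = - (ss * ii)" using ss_ii by simp
    finally show ?thesis by (simp flip: mult.assoc)
  qed
  have "x * inverse ss * ii = - (x * ii * inverse ss)" by (simp add: si mult.assoc)
  also have "\<dots> = ii * (x * inverse ss)" by (simp add: x mult.assoc)
  finally have "x * inverse ss * ii = ii * (x * inverse ss)" .
  moreover have "x = x * inverse ss * ss" by (simp add: mult.assoc)
  ultimately show "\<exists>y. y * ii = ii * y \<and> x = y * ss" by blast
next
  assume "\<exists>y. y * ii = ii * y \<and> x = y * ss"
  then obtain y where y: "y * ii = ii * y" "x = y * ss" by blast
  have "x * ii = - (y * ii * ss)" by (simp add: y(2) ss_ii mult.assoc)
  then show "x * ii = - (ii * x)" by (simp add: y mult.assoc)
qed

text \<open>The average over conjugation by \<open>ii\<close>, an involution: this is the projection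
  of \<open>B\<close> onto \<open>E\<close> along \<open>E * ss\<close>.\<close>

definition ep :: "'b \<Rightarrow> 'b" where "ep z = jB (inverse 2) * (z + inverse ii * z * ii)"

lemma half_add: "jB (inverse 2) * x + jB (inverse 2) * x = x"
proof -
  have "jB (inverse 2) + jB (inverse 2) = (1 :: 'b)"
    using two by (simp flip: jB_simps(2))
  then show ?thesis by (metis distrib_right mult_1_left)
qed

lemma ep_commutes: "ep z * ii = ii * ep z"
  and ap_anticommutes: "(z - ep z) * ii = - (ii * (z - ep z))"
proof -
  define w where "w = inverse ii * z * ii"
  define h where "h = jB (inverse 2)"
  have wi: "ii * w = z * ii" by (simp add: w_def flip: mult.assoc)
  have iw: "w * ii = ii * z"
  proof -
    have "w * ii = inverse ii * (z * (ii * ii))" by (simp add: w_def mult.assoc)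
    also have "z * (ii * ii) = ii * ii * z" by (rule ii_square_central[symmetric])
    finally show ?thesis by (simp flip: mult.assoc)
  qed
  have c: "h * x * ii = h * (x * ii)" "ii * (h * x) = h * (ii * x)" for x
    by (simp_all only: h_def jB_left_commute mult.assoc)
  have ep: "ep z = h * (z + w)" by (simp add: ep_def h_def w_def)
  show "ep z * ii = ii * ep z" by (simp add: ep c) (simp add: distrib_left distrib_right wi iw add.commute)
  have "z = h * z + h * z" by (simp only: h_def half_add)
  then have "z - ep z = h * (z - w)" unfolding ep distrib_left right_diff_distrib by (simp add: algebra_simps)
  then show "(z - ep z) * ii = - (ii * (z - ep z))"
    by (simp add: c flip: mult_minus_right) (simp add: left_diff_distrib right_diff_distrib wi iw)
qed

text \<open>Each \<open>z\<close> splits into \<open>ep z\<close> and an anticommuting part, and the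
  two parts range over spaces of equal dimension. So the commutant has dimension 4 / 2 = 2 and
  cannot exceed \<open>E\<close>.\<close>

lemma commutant: "x * ii = ii * x \<longleftrightarrow> x \<in> range emb"
proof -
  obtain Bs where "finite_dimensional_vector_space (scale_along jB) Bs"
    using B_finite_dimensional by blast
  then interpret V: finite_dimensional_vector_space "scale_along jB" Bs .
  interpret P: finite_dimensional_vector_space_pair_1 "scale_along jB" Bs "scale_along jB"
    by unfold_locales
  define C where "C = {x. x * ii = ii * x}"
  define A where "A = {x. x * ii = - (ii * x)}"
  have sC: "V.subspace C"
    by (auto simp: V.subspace_def C_def scale_along_def algebra_simps jB_left_commute)
  have sA: "V.subspace A"
    by (auto simp: V.subspace_def A_def scale_along_def algebra_simps jB_left_commute)
  have "A = (\<lambda>x. x * ss) ` C" by (auto simp: A_def C_def anticommuting_iff)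
  moreover have "V.dim ((\<lambda>x. x * ss) ` C) = V.dim C"
  proof (rule P.dim_image_eq)
    show "Vector_Spaces.linear (scale_along jB) (scale_along jB) (\<lambda>x. x * ss)"
      by unfold_locales (auto simp: scale_along_def algebra_simps)
    show "inj_on (\<lambda>x. x * ss) (V.span C)" by (auto simp: inj_on_def)
  qed
  ultimately have dimA: "V.dim A = V.dim C" by simp
  have "{x + y |x y. x \<in> C \<and> y \<in> A} = UNIV"
  proof (intro set_eqI iffI UNIV_I)
    fix z :: 'b
    have "ep z \<in> C" "z - ep z \<in> A" by (auto simp: C_def A_def ep_commutes ap_anticommutes)
    then have "ep z + (z - ep z) \<in> {x + y |x y. x \<in> C \<and> y \<in> A}" by blast
    then show "z \<in> {x + y |x y. x \<in> C \<and> y \<in> A}" by simp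
  qed
  moreover have "C \<inter> A = {0}"
  proof -
    have "x = 0" if "x * ii = ii * x" "x * ii = - (ii * x)" for x
    proof -
      have "ii * x = - (ii * x)" using that by simp
      then have "2 * (ii * x) = 0" by (metis eq_neg_iff_add_eq_0 mult_2)
      then show ?thesis using two_nonzero by simp
    qed
    then show ?thesis by (auto simp: C_def A_def)
  qed
  ultimately have "V.dim C = 2" using V.dim_sums_Int[OF sC sA] dimA dimB by simp
  moreover have "V.dim (V.span {ii, 1}) = 2"
  proof -
    have "V.independent {ii, 1}"
    proof (rule V.independent_insertI)
      show "ii \<notin> V.span {1}" using ii_notin by (auto simp: V.span_singleton scale_along_def)
      show "V.independent {1}" by simp
    qed
    moreover have "ii \<noteq> 1" using ii_notin by (metis jB_simps(1) rangeI)
    ultimately show ?thesis using V.dim_span_eq_card_independent[of "{ii, 1}"] by simp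
  qed
  moreover have "V.span {ii, 1} \<subseteq> C"
    by (rule V.span_minimal[OF _ sC]) (auto simp: C_def)
  ultimately have "V.span {ii, 1} = C" by (intro V.subspace_dim_equal) (auto simp: sC V.subspace_span)
  moreover have "V.span {ii, 1} = range emb"
  proof (intro set_eqI iffI)
    fix x assume "x \<in> V.span {ii, 1}"
    then obtain g where "x - jB g * ii \<in> V.span {1}" by (auto simp: V.span_insert scale_along_def)
    then obtain f where "x - jB g * ii = jB f" by (auto simp: V.span_singleton scale_along_def)
    then have "x = jB f + jB g * ii" by (simp add: algebra_simps)
    then show "x \<in> range emb" using E_memI by simp
  next
    fix x assume "x \<in> range emb"
    then obtain f g where x: "x = jB f + jB g * ii" using E_expand by blast
    have "scale_along jB f 1 + scale_along jB g ii \<in> V.span {ii, 1}"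
      by (intro V.span_add V.span_scale V.span_base) auto
    then show "x \<in> V.span {ii, 1}" by (simp add: x scale_along_def)
  qed
  ultimately show ?thesis by (auto simp: C_def)
qed

text \<open>On \<open>E\<close> this is the nontrivial automorphism over \<open>F\<close>, realised
  by an inner automorphism of \<open>B\<close>.\<close>

definition hat :: "'b \<Rightarrow> 'b" where "hat e = ss * e * inverse ss"

lemma E_obtain:
  assumes "e \<in> range emb"
  obtains f g where "e = jB f + jB g * ii"
  using assms E_expand by blast

lemma hat_expand: "hat (jB f + jB g * ii) = jB f - jB g * ii"
proof -
  have "ss * (jB f + jB g * ii) = (jB f - jB g * ii) * ss"
    by (simp add: distrib_left left_diff_distrib jB_left_commute ss_ii jB_central[of f, symmetric] mult.assoc)
  then show ?thesis by (simp add: hat_def mult.assoc)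
qed

lemma hat_E: "e \<in> range emb \<Longrightarrow> hat e \<in> range emb"
  by (elim E_obtain) (use E_memI[of _ "- _"] in \<open>simp add: hat_expand\<close>)

lemma ss_E: "ss * e = hat e * ss" by (simp add: hat_def mult.assoc)

lemma hat_hat: "e \<in> range emb \<Longrightarrow> hat (hat e) = e"
  by (elim E_obtain) (use hat_expand[of _ "- _"] in \<open>simp add: hat_expand\<close>)

lemma hat_add: "hat (x + y) = hat x + hat y" by (simp add: hat_def distrib_left distrib_right)
lemma hat_mult: "hat (x * y) = hat x * hat y"
proof -
  have "hat x * hat y = ss * x * (inverse ss * ss) * y * inverse ss" by (simp only: hat_def mult.assoc)
  then show ?thesis by (simp only: left_inverse[OF ss_nonzero] mult_1_right mult.assoc hat_def)
qed
lemma hat_jB: "hat (jB f) = jB f" using hat_expand[of f 0] by simp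

lemma hat_fixed:
  assumes "e \<in> range emb" "hat e = e"
  shows "e \<in> range jB"
proof -
  obtain f g where e: "e = jB f + jB g * ii" using assms(1) by (rule E_obtain)
  with assms(2) have "jB g * ii = - (jB g * ii)" by (simp add: hat_expand)
  then have "2 * (jB g * ii) = 0" by (metis eq_neg_iff_add_eq_0 mult_2)
  then have "jB g * ii = 0" using two_nonzero by simp
  then show ?thesis using e by simp
qed

lemma ss_square: "\<exists>b. ss * ss = jB b"
proof -
  have "ss * ss * ii = ii * (ss * ss)" by (simp add: ss_ii mult.assoc) (simp add: ss_ii flip: mult.assoc)
  then have E: "ss * ss \<in> range emb" using commutant by blast
  have "hat (ss * ss) = ss * ss" by (simp add: hat_def mult.assoc)
  with E show ?thesis using hat_fixed by blast
qed

lemma decompose: "\<exists>e\<in>range emb. \<exists>f\<in>range emb. z = e + f * ss"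
proof -
  obtain y where "y * ii = ii * y" "z - ep z = y * ss" using ap_anticommutes anticommuting_iff by blast
  then have "y \<in> range emb" "z = ep z + y * ss" using commutant by (auto simp: algebra_simps)
  moreover have "ep z \<in> range emb" using ep_commutes commutant by blast
  ultimately show ?thesis by blast
qed

lemma ep_decomposed:
  assumes "e \<in> range emb" "f \<in> range emb"
  shows "ep (e + f * ss) = e"
proof -
  have "e * ii = ii * e" "f * ii = ii * f" using assms commutant by auto
  then have "inverse ii * (e + f * ss) * ii = inverse ii * (ii * e) - inverse ii * (ii * f) * ss"
    by (simp add: distrib_left distrib_right mult.assoc ss_ii) (simp flip: mult.assoc)
  also have "\<dots> = e - f * ss" by (simp flip: mult.assoc)
  finally have "ep (e + f * ss) = jB (inverse 2) * (e + e)" by (simp only: ep_def) simp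
  then show ?thesis using half_add[of e] by (simp add: distrib_left)
qed

text \<open>Quaternion conjugation: \<open>e + f * ss\<close> goes to
  \<open>hat e - f * ss\<close>.\<close>

definition cj :: "'b \<Rightarrow> 'b" where "cj z = hat (ep z) - (z - ep z)"

lemma cj_decomposed: "e \<in> range emb \<Longrightarrow> f \<in> range emb \<Longrightarrow> cj (e + f * ss) = hat e - f * ss"
  by (simp add: cj_def ep_decomposed)

lemma cj_E: "e \<in> range emb \<Longrightarrow> cj e = hat e"
  using cj_decomposed[of e 0] emb_simps(4) by (metis add.right_neutral diff_zero mult_zero_left rangeI)

lemma jB_in_E: "jB f \<in> range emb" using emb_jE by (metis rangeI)

lemma cj_jB [simp]: "cj (jB f) = jB f" by (simp add: cj_E jB_in_E hat_jB)
lemma cj_0 [simp]: "cj 0 = 0" using cj_jB[of 0] by simp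
lemma cj_1 [simp]: "cj 1 = 1" using cj_jB[of 1] by simp

lemma range_emb_closed:
  "x \<in> range emb \<Longrightarrow> y \<in> range emb \<Longrightarrow> x + y \<in> range emb"
  "x \<in> range emb \<Longrightarrow> y \<in> range emb \<Longrightarrow> x - y \<in> range emb"
  "x \<in> range emb \<Longrightarrow> y \<in> range emb \<Longrightarrow> x * y \<in> range emb"
  "x \<in> range emb \<Longrightarrow> - x \<in> range emb"
  "x \<in> range emb \<Longrightarrow> inverse x \<in> range emb"
  by (auto simp flip: emb_simps emb_inverse)

lemma ep_add: "ep (x + y) = ep x + ep y" by (simp add: ep_def algebra_simps)

lemma cj_add: "cj (x + y) = cj x + cj y" by (simp add: cj_def ep_add hat_add)

lemma cj_minus: "cj (- x) = - cj x" using cj_add[of x "- x"] by (simp add: eq_neg_iff_add_eq_0 add.commute)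
lemma cj_diff: "cj (x - y) = cj x - cj y" using cj_add[of x "- y"] by (simp add: cj_minus)

lemma cj_cj: "cj (cj x) = x"
proof -
  obtain e f where ef: "e \<in> range emb" "f \<in> range emb" "x = e + f * ss" using decompose by blast
  have "cj x = hat e + (- f) * ss" using ef by (simp add: cj_decomposed)
  then have "cj (cj x) = hat (hat e) - (- f) * ss"
    using cj_decomposed[of "hat e" "- f"] ef hat_E range_emb_closed by simp
  then show ?thesis using ef by (simp add: hat_hat)
qed

text \<open>A computation in the coordinates \<open>e + f * ss\<close>, using
  \<open>ss * v = hat v * ss\<close>, the central square of \<open>ss\<close> and the commutativity
  of \<open>E\<close>.\<close>

lemma cj_mult: "cj (x * y) = cj y * cj x"
proof -
  obtain e f where ef: "e \<in> range emb" "f \<in> range emb" "x = e + f * ss" using decompose by blast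
  obtain g h where gh: "g \<in> range emb" "h \<in> range emb" "y = g + h * ss" using decompose by blast
  obtain b where b: "ss * ss = jB b" using ss_square by blast
  have push: "u * ss * v = u * hat v * ss" for u v by (simp add: ss_E mult.assoc)
  have bb: "u * ss * ss = jB b * u" for u using b jB_central[of b u] by (simp add: mult.assoc)
  have mem: "hat e \<in> range emb" "hat f \<in> range emb" "hat g \<in> range emb" "hat h \<in> range emb"
    using ef gh hat_E by auto
  have 1: "e * g + jB b * (f * hat h) \<in> range emb" "e * h + f * hat g \<in> range emb"
    using ef gh mem by (auto intro!: range_emb_closed jB_in_E)
  have "x * y = (e * g + jB b * (f * hat h)) + (e * h + f * hat g) * ss"
  proof -
    have "x * y = e * g + e * h * ss + f * ss * g + f * ss * h * ss"
      by (simp add: ef gh algebra_simps)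
    also have "f * ss * g = f * hat g * ss" by (rule push)
    also have "f * ss * h * ss = jB b * (f * hat h)" unfolding push[of f h] bb ..
    finally show ?thesis by (simp add: algebra_simps)
  qed
  then have "cj (x * y) = hat (e * g + jB b * (f * hat h)) - (e * h + f * hat g) * ss"
    by (simp only: cj_decomposed[OF 1])
  also have "\<dots> = hat e * hat g + jB b * (hat f * h) - (e * h + f * hat g) * ss"
    by (simp add: hat_add hat_mult hat_jB hat_hat gh)
  also have "\<dots> = hat g * hat e + jB b * (h * hat f) - (h * e + hat g * f) * ss"
    using E_commute[OF mem(1,3)] E_commute[OF mem(2) gh(2)] E_commute[OF ef(1) gh(2)] E_commute[OF ef(2) mem(3)]
    by simp
  also have "\<dots> = (hat g - h * ss) * (hat e - f * ss)"
  proof -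
    have "(hat g - h * ss) * (hat e - f * ss) = hat g * hat e - hat g * f * ss - h * ss * hat e + h * ss * f * ss"
      by (simp add: algebra_simps)
    also have "h * ss * hat e = h * e * ss" by (simp add: push hat_hat ef)
    also have "h * ss * f * ss = jB b * (h * hat f)" unfolding push[of h f] bb ..
    finally show ?thesis by (simp add: algebra_simps)
  qed
  also have "\<dots> = cj y * cj x" using ef gh by (simp add: cj_decomposed)
  finally show ?thesis .
qed

lemma cj_fixed:
  assumes "cj x = x"
  shows "x \<in> range jB"
proof -
  obtain e f where ef: "e \<in> range emb" "f \<in> range emb" "x = e + f * ss" using decompose by blast
  have "cj x = hat e + (- f) * ss" using ef by (simp add: cj_decomposed)
  then have eq: "hat e + (- f) * ss = e + f * ss" using assms ef by simp
  have "hat e = e" using arg_cong[OF eq, of ep] ef hat_E range_emb_closed by (simp add: ep_decomposed del: mult_minus_left)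
  moreover from eq this have "- (f * ss) = f * ss" by simp
  then have "2 * (f * ss) = 0" by (metis eq_neg_iff_add_eq_0 mult_2)
  then have "f = 0" using two_nonzero by simp
  ultimately show ?thesis using hat_fixed[OF ef(1)] ef by simp
qed

lemma trace_in: "x + cj x \<in> range jB"
  by (rule cj_fixed) (simp add: cj_add cj_cj add.commute)

lemma norm_in: "x * cj x \<in> range jB"
  by (rule cj_fixed) (simp add: cj_mult cj_cj)

lemma cj_commute: "x * cj x = cj x * x"
proof -
  obtain t where t: "x + cj x = jB t" using trace_in by blast
  then have "cj x = jB t - x" by (simp add: algebra_simps)
  then show ?thesis by (simp only: right_diff_distrib left_diff_distrib jB_central)
qed

lemma cj_eq_0 [simp]: "cj x = 0 \<longleftrightarrow> x = 0"
  by (metis cj_0 cj_cj)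

lemma cj_inverse: "cj (inverse x) = inverse (cj x)"
proof (cases "x = 0")
  case False
  have "cj x * cj (inverse x) = 1" using False by (simp flip: cj_mult)
  then show ?thesis by (rule inverse_unique[symmetric])
qed simp

lemma quadratic: "x * x = (x + cj x) * x - x * cj x"
  by (simp add: distrib_right cj_commute)

text \<open>The elementary case of the Skolem--Noether theorem: commutators intertwine \<open>y\<close> with its conjugate.\<close>
lemma skolem_noether:
  assumes "y \<notin> range jB"
  shows "\<exists>s. s \<noteq> 0 \<and> s * y = cj y * s"
proof -
  obtain z where z: "z * y \<noteq> y * z" using assms unfolding center mem_Collect_eq by metis
  obtain t where t: "y + cj y = jB t" using trace_in by blast
  obtain n where n: "y * cj y = jB n" using norm_in by blast
  have cy: "cj y = jB t - y" using t by (simp add: algebra_simps)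
  have yy: "y * y = jB t * y - jB n" using quadratic[of y] t n by simp
  define s where "s = z * y - y * z"
  have "s * y + y * s = z * (y * y) - y * y * z" by (simp add: s_def algebra_simps)
  also have "\<dots> = jB t * s"
    by (simp add: yy s_def right_diff_distrib left_diff_distrib jB_left_commute jB_central[of n] mult.assoc)
  finally have "s * y = cj y * s" by (simp add: cy left_diff_distrib algebra_simps)
  then show ?thesis using z by (intro exI[of _ s]) (auto simp: s_def)
qed

lemma standard_involution_cj: "standard_involution jB cj"
proof -
  interpret vector_space "scale_along jB" using jB_hom by (rule vector_space_scale_along)
  have "Vector_Spaces.linear (scale_along jB) (scale_along jB) cj"
    by unfold_locales (auto simp: scale_along_def cj_add cj_mult jB_central)
  then show ?thesis by (auto simp: standard_involution_def cj_cj cj_mult norm_in)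
qed

text \<open>Expanding the norm condition at \<open>x + 1\<close> shows that
  \<open>\<sigma> x\<close> is a scalar minus \<open>x\<close>. So is \<open>cj x\<close>, and two
  different scalars would express \<open>x\<close> itself as a scalar.\<close>

lemma standard_involution_unique:
  assumes "standard_involution jB \<sigma>"
  shows "\<sigma> x = cj x"
proof (cases "x \<in> range jB")
  case True
  then obtain f where f: "x = scale_along jB f 1" by (auto simp: scale_along_def)
  interpret Vector_Spaces.linear "scale_along jB" "scale_along jB" \<sigma>
    using assms by (simp add: standard_involution_def)
  have "\<sigma> x = scale_along jB f 1" using assms unfolding f scale by (simp add: standard_involution_def)
  then show ?thesis by (simp add: f scale_along_def)
next
  case False
  interpret Vector_Spaces.linear "scale_along jB" "scale_along jB" \<sigma>
    using assms by (simp add: standard_involution_def)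
  have \<sigma>: "\<sigma> 1 = 1" "\<And>x. x * \<sigma> x \<in> range jB" using assms by (auto simp: standard_involution_def)
  obtain a b where a: "x * \<sigma> x = jB a" and b: "(x + 1) * \<sigma> (x + 1) = jB b" using \<sigma>(2) by (metis imageE)
  have "jB b = jB a + x + \<sigma> x + 1" using b by (simp add: add \<sigma>(1) algebra_simps a)
  then have s: "\<sigma> x = jB (b - a - 1) - x" by (simp add: algebra_simps)
  obtain t where t: "x + cj x = jB t" using trace_in by blast
  obtain n where n: "x * cj x = jB n" using norm_in by blast
  have cx: "cj x = jB t - x" using t by (simp add: algebra_simps)
  have "jB (b - a - 1) * x - x * x = jB a" using a unfolding s right_diff_distrib jB_central .
  moreover have "jB t * x - x * x = jB n" using n unfolding cx right_diff_distrib jB_central .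
  ultimately have eq: "jB (b - a - 1 - t) * x = jB (a - n)" by (simp add: algebra_simps)
  have "b - a - 1 - t = 0"
  proof (rule ccontr)
    assume nz: "b - a - 1 - t \<noteq> 0"
    have "x = inverse (jB (b - a - 1 - t)) * (jB (b - a - 1 - t) * x)"
      using nz by (simp only: mult.assoc[symmetric] left_inverse jB_eq_0 not_False_eq_True) simp
    also have "\<dots> = jB (inverse (b - a - 1 - t) * (a - n))"
      unfolding eq by (simp only: jB_simps(3) jB_inverse)
    finally show False using False by blast
  qed
  then have "b - a - 1 = t" by simp
  then show ?thesis unfolding s cx by simp
qed

lemma reduced_norm: "jB (reduced_norm jB x) = x * cj x"
proof -
  obtain n where n: "x * cj x = jB n" using norm_in by blast
  have "reduced_norm jB x = n"
    unfolding reduced_norm_def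
  proof (rule the_equality)
    show "\<exists>\<sigma>. standard_involution jB \<sigma> \<and> jB n = x * \<sigma> x" using standard_involution_cj n by auto
    fix m assume "\<exists>\<sigma>. standard_involution jB \<sigma> \<and> jB m = x * \<sigma> x"
    then have "jB m = jB n" using standard_involution_unique n by auto
    then show "m = n" by (simp only: jB_inj)
  qed
  then show ?thesis using n by simp
qed

end

section \<open>Discrete valuations on division rings\<close>

text \<open>Interpreted for \<open>F\<close>, \<open>E\<close> and \<open>B\<close>, this turns the
  ideals, unit groups and topologies of the definitions into norm inequalities once for all
  three.\<close>

locale discrete_valuation =
  fixes v :: "'d::division_ring \<Rightarrow> real" and w :: 'd
  assumes v_nonneg [simp]: "0 \<le> v x"
    and v_eq_0 [simp]: "v x = 0 \<longleftrightarrow> x = 0"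
    and v_mult: "v (x * y) = v x * v y"
    and v_add: "v (x + y) \<le> max (v x) (v y)"
    and w_nonzero [simp]: "w \<noteq> 0"
    and v_w: "v w < 1"
    and v_le_w: "v x < 1 \<Longrightarrow> v x \<le> v w"
begin

abbreviation R :: "'d set" where "R \<equiv> {x. v x \<le> 1}"

lemma v_0 [simp]: "v 0 = 0" by simp

lemma v_1 [simp]: "v 1 = 1"
proof -
  have "v 1 * v 1 = v 1 * 1" using v_mult[of 1 1] by simp
  then show ?thesis by (metis mult_left_cancel v_eq_0 zero_neq_one)
qed

lemma v_minus [simp]: "v (- x) = v x"
proof -
  have "v (-1) * v (-1) = 1" by (simp flip: v_mult)
  then have "v (-1) = 1" using v_nonneg[of "-1"] by (metis abs_of_nonneg power2_eq_1_iff power2_eq_square abs_minus_cancel abs_1)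
  then show ?thesis using v_mult[of "-1" x] by simp
qed

lemma v_diff: "v (x - y) \<le> max (v x) (v y)" using v_add[of x "- y"] by simp

lemma v_pos: "x \<noteq> 0 \<Longrightarrow> 0 < v x" using v_nonneg[of x] v_eq_0[of x] by linarith

lemma v_power: "v (x ^ n) = v x ^ n" by (induction n) (auto simp: v_mult)

lemma v_inverse: "v (inverse x) = inverse (v x)"
proof (cases "x = 0")
  case False
  have "v x * v (inverse x) = 1" using False by (simp flip: v_mult)
  then show ?thesis by (rule inverse_unique[symmetric])
qed simp

lemma v_sum: "0 \<le> M \<Longrightarrow> (\<And>a. a \<in> A \<Longrightarrow> v (f a) \<le> M) \<Longrightarrow> v (sum f A) \<le> M"
proof (induction A rule: infinite_finite_induct)
  case (insert a A)
  then have "max (v (f a)) (v (sum f A)) \<le> M" by simp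
  with v_add[of "f a" "sum f A"] have "v (f a + sum f A) \<le> M" by linarith
  with insert show ?case by simp
qed auto


lemma unit_group_R: "unit_group R = {x. v x = 1}"
proof (intro set_eqI iffI)
  fix x assume "x \<in> unit_group R"
  then obtain y where y: "v x \<le> 1" "v y \<le> 1" "x * y = 1" by (auto simp: unit_group_def)
  then have "v x * v y = 1" by (simp flip: v_mult)
  moreover have "v x * v y \<le> v x * 1" using y by (intro mult_left_mono) auto
  ultimately show "x \<in> {x. v x = 1}" using y by simp
next
  fix x assume "x \<in> {x. v x = 1}"
  then have x: "v x = 1" by simp
  then have "x \<noteq> 0" by auto
  then show "x \<in> unit_group R" using x
    by (auto simp: unit_group_def v_inverse intro!: exI[of _ "inverse x"])
qed

lemma two_sided_ideal_P: "two_sided_ideal R {x. v x < 1}"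
proof -
  have "v (x - y) < 1" if "v x < 1" "v y < 1" for x y
    using v_diff[of x y] that by linarith
  moreover have "v (a * x) < 1 \<and> v (x * a) < 1" if "v a \<le> 1" "v x < 1" for a x
  proof -
    have "v a * v x \<le> 1 * v x" using that by (intro mult_right_mono) auto
    then show ?thesis using that by (simp add: v_mult mult.commute)
  qed
  ultimately show ?thesis by (auto simp: two_sided_ideal_def)
qed

lemma proper_ideal_subset:
  assumes I: "two_sided_ideal R I" "I \<noteq> R"
  shows "I \<subseteq> {x. v x < 1}"
proof
  fix x assume x: "x \<in> I"
  show "x \<in> {x. v x < 1}"
  proof (rule ccontr)
    assume "x \<notin> {x. v x < 1}"
    then have v1: "v x = 1" using x I(1) by (auto simp: two_sided_ideal_def)
    then have "x \<noteq> 0" by auto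
    have "y \<in> I" if "y \<in> R" for y
    proof -
      have "y * inverse x \<in> R" using that v1 by (simp add: v_mult v_inverse)
      then have "y * inverse x * x \<in> I" using I(1) x unfolding two_sided_ideal_def by blast
      then show ?thesis using \<open>x \<noteq> 0\<close> by (simp add: mult.assoc)
    qed
    then show False using I by (auto simp: two_sided_ideal_def)
  qed
qed

lemma P_proper: "{x. v x < 1} \<noteq> R"
proof
  assume eq: "{x. v x < 1} = R"
  have "1 \<in> R" by simp
  then have "1 \<in> {x. v x < 1}" by (simp only: eq)
  then show False by simp
qed

lemma max_ideal_R: "max_ideal R = {x. v x < 1}"
  unfolding max_ideal_def
proof (rule the_equality)
  show "is_maximal_ideal R {x. v x < 1}"
    unfolding is_maximal_ideal_def using two_sided_ideal_P P_proper proper_ideal_subset by blast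
  fix I assume I: "is_maximal_ideal R I"
  then have "I \<subseteq> {x. v x < 1}" using proper_ideal_subset by (auto simp: is_maximal_ideal_def)
  then show "I = {x. v x < 1}"
    using I two_sided_ideal_P P_proper unfolding is_maximal_ideal_def by blast
qed

lemma ideal_power_R: "ideal_power R (max_ideal R) n = {x. v x \<le> v w ^ n}"
proof (induction n)
  case (Suc n)
  show ?case
  proof (intro set_eqI iffI)
    fix x assume "x \<in> ideal_power R (max_ideal R) (Suc n)"
    then obtain m a b where x: "x = (\<Sum>i<m::nat. a i * b i)"
      and ab: "\<And>i. i < m \<Longrightarrow> v (a i) \<le> v w ^ n \<and> v (b i) < 1"
      unfolding ideal_power.simps unfolding Suc unfolding max_ideal_R ideal_times_def by auto
    have "v x \<le> v w ^ Suc n" unfolding x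
    proof (rule v_sum)
      fix i assume "i \<in> {..<m}"
      then have "v (a i) * v (b i) \<le> v w ^ n * v w"
        using ab[of i] v_le_w by (intro mult_mono) auto
      then show "v (a i * b i) \<le> v w ^ Suc n" by (simp add: v_mult mult.commute)
    qed simp
    then show "x \<in> {x. v x \<le> v w ^ Suc n}" by simp
  next
    fix x assume "x \<in> {x. v x \<le> v w ^ Suc n}"
    then have "v x * inverse (v w) \<le> v w ^ Suc n * inverse (v w)" by (intro mult_right_mono) auto
    moreover have "v w ^ Suc n * inverse (v w) = v w ^ n"
      using v_pos[OF w_nonzero] by (simp add: field_simps)
    ultimately have "v (x * inverse w) \<le> v w ^ n" by (simp only: v_mult v_inverse)
    \<comment> \<open>A single product suffices: dividing by \<open>w\<close> lowers the level of
      \<open>x\<close> by one.\<close>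
    moreover have "x = (\<Sum>i<1::nat. (\<lambda>_. x * inverse w) i * (\<lambda>_. w) i)" by (simp add: mult.assoc)
    ultimately have "\<exists>(m::nat) a b. x = (\<Sum>i<m. a i * b i) \<and>
        (\<forall>i<m. a i \<in> {x. v x \<le> v w ^ n} \<and> b i \<in> {x. v x < 1})"
      using v_w by (intro exI[of _ 1] exI[of _ "\<lambda>_. x * inverse w"] exI[of _ "\<lambda>_. w"]) simp
    then show "x \<in> ideal_power R (max_ideal R) (Suc n)"
      unfolding ideal_power.simps unfolding Suc unfolding max_ideal_R ideal_times_def by blast
  qed
qed simp

lemma higher_units_0: "higher_units R 0 = {x. v x = 1}"
  by (simp add: higher_units_def unit_group_R)

lemma higher_units_pos: "0 < n \<Longrightarrow> higher_units R n = {x. v (x - 1) \<le> v w ^ n}"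
  by (auto simp: higher_units_def ideal_power_R intro!: exI[of _ "_ - 1"])

lemma v_power_int: "v (w powi k) = v w powi k"
  by (auto simp: power_int_def v_power v_inverse)

text \<open>With \<open>k\<close> the floor of the quotient of logarithms,
  \<open>x * w powi (- k)\<close> has value above \<open>v w\<close> and at most 1; by
  \<open>v_le_w\<close> the value is 1.\<close>

lemma valuation: "x \<noteq> 0 \<Longrightarrow> \<exists>k::int. v x = v w powi k"
proof -
  assume x: "x \<noteq> 0"
  define q where "q = v w"
  have q: "0 < q" "q < 1" using v_pos[OF w_nonzero] v_w by (auto simp: q_def)
  then have lq: "ln q < 0" by simp
  define k where "k = \<lfloor>ln (v x) / ln q\<rfloor>"
  define y where "y = x * w powi (- k)"
  have vy: "v y = v x * q powi (- k)" by (simp add: y_def v_mult v_power_int q_def)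
  have y0: "y \<noteq> 0" using x by (simp add: y_def)
  have lvy: "ln (v y) = ln (v x) - of_int k * ln q"
    using v_pos[OF x] q by (simp add: vy ln_mult_pos power_int_minus ln_inverse flip: powr_real_of_int')
  have k: "of_int k \<le> ln (v x) / ln q" "ln (v x) / ln q < of_int k + 1" by (auto simp: k_def)
  have "ln (v x) \<le> of_int k * ln q" using k(1) lq by (simp add: neg_le_divide_eq)
  then have "ln (v y) \<le> 0" by (simp add: lvy)
  then have "v y \<le> 1" using v_pos[OF y0] by simp
  moreover have "ln q < ln (v y)"
  proof -
    have "(of_int k + 1) * ln q < ln (v x)" using k(2) lq by (simp add: neg_divide_less_eq)
    then show ?thesis by (simp add: lvy algebra_simps)
  qed
  then have "q < v y" using v_pos[OF y0] q by simp
  ultimately have "v y = 1" using v_le_w[of y] unfolding q_def by linarith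
  then have "v x = q powi k" using q by (simp add: vy power_int_minus field_simps)
  then show ?thesis by (auto simp: q_def)
qed

lemma v_less_le_Suc: "v x < v w ^ n \<Longrightarrow> v x \<le> v w ^ Suc n"
proof -
  assume "v x < v w ^ n"
  moreover have "0 < v w ^ n" using v_pos[OF w_nonzero] by simp
  moreover have eq: "v (x * inverse (w ^ n)) = v x / v w ^ n"
    by (simp only: v_mult v_inverse v_power divide_inverse)
  ultimately have "v (x * inverse (w ^ n)) < 1" by (simp add: divide_less_eq)
  then have "v x / v w ^ n \<le> v w" unfolding eq[symmetric] by (rule v_le_w)
  then show ?thesis using \<open>0 < v w ^ n\<close> by (simp add: divide_le_eq)
qed

lemma ex_w_power_less: "0 < e \<Longrightarrow> \<exists>n. v w ^ n < e"
  using real_arch_pow_inv[of e "v w"] v_w by auto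

text \<open>Every point of an ultrametric ball is its centre, so the translates that generate the
  topology already behave as a basis.\<close>

lemma openin_adicD:
  assumes "openin (adic_topology R) U" "x \<in> U"
  shows "\<exists>n. \<forall>y. v (y - x) \<le> v w ^ n \<longrightarrow> y \<in> U"
proof -
  have "generate_topology_on {(\<lambda>y. x + y) ` ideal_power R (max_ideal R) n | x n. True} U"
    using assms(1) unfolding adic_topology_def openin_topology_generated_by_iff .
  then show ?thesis using assms(2)
  proof (induction arbitrary: x rule: generate_topology_on.induct)
    case (Int a b)
    then obtain m n where m: "\<And>y. v (y - x) \<le> v w ^ m \<Longrightarrow> y \<in> a" and n: "\<And>y. v (y - x) \<le> v w ^ n \<Longrightarrow> y \<in> b"
      by (meson IntD1 IntD2)
    have "v w ^ max m n \<le> v w ^ m" "v w ^ max m n \<le> v w ^ n"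
      using v_w by (auto intro!: power_decreasing)
    then show ?case using m n by (intro exI[of _ "max m n"]) (meson IntI order_trans)
  next
    case (UN K)
    then show ?case by (meson UnionE UnionI)
  next
    case (Basis s)
    then obtain z n where s: "s = (\<lambda>y. z + y) ` {x. v x \<le> v w ^ n}" by (auto simp: ideal_power_R)
    then have xz: "v (x - z) \<le> v w ^ n" using Basis by auto
    show ?case
    proof (intro exI allI impI)
      fix y assume "v (y - x) \<le> v w ^ n"
      then have "v (y - z) \<le> v w ^ n" using v_add[of "y - x" "x - z"] xz by simp
      then show "y \<in> s" unfolding s by (intro image_eqI[of _ _ "y - z"]) auto
    qed
  qed simp
qed

lemma openin_adicI:
  assumes "\<And>x. x \<in> U \<Longrightarrow> \<exists>n. \<forall>y. v (y - x) \<le> v w ^ n \<longrightarrow> y \<in> U"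
  shows "openin (adic_topology R) U"
proof -
  define T where "T = {(\<lambda>y. x + y) ` ideal_power R (max_ideal R) n | x n. (\<lambda>y. x + y) ` ideal_power R (max_ideal R) n \<subseteq> U}"
  have "U = \<Union>T"
  proof (intro set_eqI iffI)
    fix x assume "x \<in> U"
    then obtain n where n: "\<forall>y. v (y - x) \<le> v w ^ n \<longrightarrow> y \<in> U" using assms by blast
    then have "(\<lambda>y. x + y) ` ideal_power R (max_ideal R) n \<subseteq> U" by (auto simp: ideal_power_R)
    moreover have "x \<in> (\<lambda>y. x + y) ` ideal_power R (max_ideal R) n"
      by (rule image_eqI[of _ _ 0]) (auto simp: ideal_power_R)
    ultimately show "x \<in> \<Union>T" unfolding T_def by blast
  qed (auto simp: T_def)
  moreover have "openin (adic_topology R) (\<Union>T)"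
    unfolding adic_topology_def
    by (rule openin_Union) (auto simp: T_def intro!: topology_generated_by_Basis)
  ultimately show ?thesis by simp
qed

lemma topspace_adic: "topspace (adic_topology R) = UNIV"
  using openin_subset[OF openin_adicI[of UNIV]] by auto

end

section \<open>The valuation of the quaternion algebra\<close>

lemma poly_map_poly_sum:
  fixes h :: "'a::comm_ring_1 \<Rightarrow> 'c::comm_ring_1"
  assumes "h 0 = 0"
  shows "poly (map_poly h f) y = (\<Sum>i\<le>degree f. h (coeff f i) * y ^ i)"
proof -
  have "poly (map_poly h f) y = (\<Sum>i\<le>degree (map_poly h f). h (coeff f i) * y ^ i)"
    by (simp add: poly_altdef coeff_map_poly assms)
  also have "\<dots> = (\<Sum>i\<le>degree f. h (coeff f i) * y ^ i)"
  proof (rule sum.mono_neutral_left)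
    show "{..degree (map_poly h f)} \<subseteq> {..degree f}" using map_poly_degree_leq[of h f] by simp
    show "\<forall>i\<in>{..degree f} - {..degree (map_poly h f)}. h (coeff f i) * y ^ i = 0"
    proof
      fix i assume "i \<in> {..degree f} - {..degree (map_poly h f)}"
      then have "coeff (map_poly h f) i = 0" by (intro coeff_eq_0) auto
      then show "h (coeff f i) * y ^ i = 0" by (simp add: coeff_map_poly assms)
    qed
  qed simp
  finally show ?thesis .
qed

locale padic_quaternion = padic_division_algebra p nrm j Bs + quaternion jE jB emb
  for p :: nat and nrm :: "'k::field_char_0 \<Rightarrow> real" and j :: "'k \<Rightarrow> 'b::division_ring" and Bs
    and jE :: "'f::field \<Rightarrow> 'e::field" and jB :: "'f \<Rightarrow> 'b" and emb :: "'e \<Rightarrow> 'b" +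
  fixes jF :: "'k \<Rightarrow> 'f"
  assumes jF_hom: "unital_ring_hom jF" and j_eq: "j a = jB (jF a)"
begin

text \<open>By the Skolem--Noether argument \<open>cj x\<close> is an inner conjugate of
  \<open>x\<close>, unless \<open>x\<close> lies in \<open>F\<close> and is fixed.\<close>

lemma N_cj: "N (cj x) = N x"
proof (cases "x \<in> range jB")
  case False
  then obtain s where s: "s \<noteq> 0" "s * x = cj x * s" using skolem_noether by blast
  then have "cj x = s * x * inverse s" by (simp add: mult.assoc)
  then show ?thesis using N_conj[OF s(1)] by simp
qed auto

text \<open>Squaring reduces the claim to \<open>x * cj x\<close> and \<open>y * cj y\<close>, which
  are central and so covered by \<open>N_mult_commuting\<close>.\<close>

lemma N_mult: "N (x * y) = N x * N y"
proof -
  have sq: "N x * N x = N (x * cj x)" for x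
    using N_mult_commuting[OF cj_commute] by (simp add: N_cj)
  obtain a where a: "y * cj y = jB a" using norm_in by blast
  have "x * y * cj (x * y) = x * (y * cj y) * cj x" by (simp add: cj_mult mult.assoc)
  also have "\<dots> = jB a * (x * cj x)" by (simp add: a jB_left_commute mult.assoc flip: jB_central)
  finally have "N (x * y) * N (x * y) = N (jB a * (x * cj x))" by (simp add: sq)
  also have "\<dots> = N (jB a) * N (x * cj x)" by (rule N_mult_commuting) (rule jB_central)
  also have "\<dots> = (N x * N y) * (N x * N y)" by (simp add: sq flip: a) (simp flip: sq)
  finally have "(N (x * y))\<^sup>2 = (N x * N y)\<^sup>2" by (simp add: power2_eq_square)
  then show ?thesis by (simp add: power2_eq_iff_nonneg)
qed

lemma N_add: "N (x + y) \<le> max (N x) (N y)"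
proof -
  have le: "N (x + y) \<le> N x" if "N y \<le> N x" "x \<noteq> 0" for x y
  proof -
    have "N (inverse x * y) * N x = N y"
      using that(2) by (simp add: mult.commute[of _ "N x"] flip: N_mult mult.assoc)
    then have "N (inverse x * y) * N x \<le> 1 * N x" using that by simp
    then have "N (inverse x * y) \<le> 1" using N_pos[OF that(2)] by (rule mult_right_le_imp_le)
    then have "N x * N (1 + inverse x * y) \<le> N x * 1" by (intro mult_left_mono N_1_add) auto
    moreover have "x * (1 + inverse x * y) = x + y" using that(2) by (simp add: distrib_left flip: mult.assoc)
    ultimately show ?thesis by (simp flip: N_mult)
  qed
  show ?thesis
  proof (cases "x = 0 \<or> y = 0")
    case False
    then show ?thesis using le[of y x] le[of x y] by (cases "N y \<le> N x") (auto simp: add.commute max_def)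
  qed auto
qed

lemma N_diff: "N (x - y) \<le> max (N x) (N y)" using N_add[of x "- y"] by simp

lemma N_commute: "N (x - y) = N (y - x)" by (metis minus_diff_eq N_minus)

lemma Cm_pos: "0 < Cm" using Cm(1) by linarith

section \<open>Compactness and closed subspaces in terms of \<open>N\<close>\<close>

lemma ex_scaling: "\<exists>c. c \<noteq> 0 \<and> nrm c * M \<le> 1"
proof -
  obtain k where k: "(1 / real p) ^ k < 1 / (1 + \<bar>M\<bar>)"
    using real_arch_pow_inv[of "1 / (1 + \<bar>M\<bar>)" "1 / real p"] p_gt_1 by (auto simp: add_pos_nonneg)
  have "nrm (of_nat p ^ k) * M \<le> (1 / real p) ^ k * (1 + \<bar>M\<bar>)"
    unfolding nrm_power nrm_p by (intro mult_left_mono) auto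
  also have "\<dots> \<le> 1" using k by (simp add: field_simps)
  finally show ?thesis using p_gt_1 by (intro exI[of _ "of_nat p ^ k"]) auto
qed

lemma ex_scaling_unit_ball: "\<exists>c. 0 < nrm c \<and> (\<forall>x. N x \<le> 1 \<longrightarrow> bn (j c * x) \<le> 1)"
proof -
  obtain c where c: "c \<noteq> 0" "nrm c * Cm \<le> 1" using ex_scaling by blast
  have "bn (j c * x) \<le> 1" if "N x \<le> 1" for x
  proof -
    have "bn x \<le> Cm * 1" using bn_le_N[of x] mult_left_mono[OF that less_imp_le[OF Cm_pos]] by linarith
    then have "nrm c * bn x \<le> nrm c * (Cm * 1)" by (intro mult_left_mono) auto
    then show ?thesis using c(2) by (simp add: bn_scale)
  qed
  moreover have "0 < nrm c" using c(1) nrm_nonneg[of c] nrm_eq_0[of c] by linarith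
  ultimately show ?thesis by blast
qed

text \<open>A finite net of the unit ball pins down \<open>x\<close> up to \<open>e\<close>. This
  takes the place of compactness for residue fields, values of the norm and images of unit
  groups.\<close>

lemma finite_image_of_locally_constant:
  assumes e: "0 < e" and A: "\<And>x. x \<in> A \<Longrightarrow> N x \<le> 1"
    and const: "\<And>x y. x \<in> A \<Longrightarrow> y \<in> A \<Longrightarrow> N (x - y) < e \<Longrightarrow> f x = f y"
  shows "finite (f ` A)"
proof -
  obtain c where c: "0 < nrm c" "\<And>x. N x \<le> 1 \<Longrightarrow> bn (j c * x) \<le> 1" using ex_scaling_unit_ball by blast
  have bn: "bn (j c * x) \<le> 1" if "x \<in> A" for x by (rule c(2)[OF A[OF that]])
  have "0 < e * nrm c / Cm" using e c Cm_pos by simp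
  from totally_bounded[OF this] obtain T where T: "finite T"
    "\<And>x. bn x \<le> 1 \<Longrightarrow> \<exists>t\<in>T. bn (x - t) < e * nrm c / Cm" by blast
  define g where "g x = (SOME t. t \<in> T \<and> bn (j c * x - t) < e * nrm c / Cm)" for x
  have g: "g x \<in> T" "bn (j c * x - g x) < e * nrm c / Cm" if "x \<in> A" for x
    using someI_ex[of "\<lambda>t. t \<in> T \<and> bn (j c * x - t) < e * nrm c / Cm"] T(2)[OF bn[OF that]]
    by (auto simp: g_def)
  have same: "f x = f y" if "x \<in> A" "y \<in> A" "g x = g y" for x y
  proof -
    have "j c * (x - y) = (j c * x - g x) - (j c * y - g y)" using that by (simp add: right_diff_distrib)
    then have "bn (j c * (x - y)) \<le> max (bn (j c * x - g x)) (bn (j c * y - g y))"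
      using bn_diff by metis
    then have "bn (j c * (x - y)) < e * nrm c / Cm" using g(2)[OF that(1)] g(2)[OF that(2)] by linarith
    then have "nrm c * bn (x - y) < nrm c * (e / Cm)" by (simp only: bn_scale) (simp add: mult.commute)
    then have "bn (x - y) < e / Cm" using c(1) by (simp only: mult_less_cancel_left_pos)
    then have "Cm * bn (x - y) < e" using Cm_pos by (simp add: field_simps)
    then have "N (x - y) < e" using N_le_bn[of "x - y"] by linarith
    then show ?thesis using const that by blast
  qed
  define h where "h t = (SOME z. \<exists>x\<in>A. g x = t \<and> z = f x)" for t
  have "f x = h (g x)" if "x \<in> A" for x
  proof -
    have "\<exists>x'\<in>A. g x' = g x \<and> h (g x) = f x'"
      unfolding h_def by (rule someI[of _ "f x"]) (use that in blast)
    then show ?thesis using same that by metis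
  qed
  then have "f ` A \<subseteq> h ` T" using g(1) by auto
  then show ?thesis using T(1) finite_surj by blast
qed

lemma convergent_subsequence:
  fixes X :: "nat \<Rightarrow> 'b"
  assumes X: "\<And>n. N (X n) \<le> 1"
  shows "\<exists>r L. strict_mono r \<and> (\<lambda>n. N (X (r n) - L)) \<longlonglongrightarrow> 0"
proof -
  obtain c where c: "0 < nrm c" "\<And>x. N x \<le> 1 \<Longrightarrow> bn (j c * x) \<le> 1" using ex_scaling_unit_ball by blast
  have "bn (j c * X n) \<le> 1" for n by (rule c(2)[OF X])
  from bolzano_weierstrass[of "\<lambda>n. j c * X n", OF this] obtain r L where r: "strict_mono r"
    and L: "(\<lambda>n. bn (j c * X (r n) - L)) \<longlonglongrightarrow> 0" by blast
  have "c \<noteq> 0" using c(1) nrm_0 less_irrefl by metis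
  then have jc: "j c \<noteq> 0" by simp
  have "(\<lambda>n. N (X (r n) - inverse (j c) * L)) \<longlonglongrightarrow> 0"
  proof (rule tendsto_sandwich[OF _ _ tendsto_const])
    show "\<forall>\<^sub>F n in sequentially. N (X (r n) - inverse (j c) * L) \<le> N (inverse (j c)) * (Cm * bn (j c * X (r n) - L))"
    proof (rule always_eventually, rule allI)
      fix n
      have "X (r n) - inverse (j c) * L = inverse (j c) * (j c * X (r n) - L)"
        using jc by (simp add: right_diff_distrib flip: mult.assoc)
      then have "N (X (r n) - inverse (j c) * L) = N (inverse (j c)) * N (j c * X (r n) - L)"
        by (simp only: N_mult)
      also have "\<dots> \<le> N (inverse (j c)) * (Cm * bn (j c * X (r n) - L))"
        by (intro mult_left_mono N_le_bn) simp
      finally show "N (X (r n) - inverse (j c) * L) \<le> N (inverse (j c)) * (Cm * bn (j c * X (r n) - L))" .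
    qed
    show "(\<lambda>n. N (inverse (j c)) * (Cm * bn (j c * X (r n) - L))) \<longlonglongrightarrow> 0"
      using tendsto_mult_right_zero[OF tendsto_mult_right_zero[OF L]] by blast
  qed simp
  then show ?thesis using r by blast
qed

lemma functional_bounded_N:
  assumes add: "\<And>x y. l (x + y) = l x + l y" and scale: "\<And>a x. l (j a * x) = a * l x"
  shows "\<exists>C>0. \<forall>x. nrm (l x) \<le> C * N x"
proof -
  obtain C where C: "C > 0" "\<And>x. nrm (l x) \<le> C * bn x" using functional_bounded[OF assms] by blast
  have "nrm (l x) \<le> C * Cm * N x" for x
  proof -
    have "C * bn x \<le> C * (Cm * N x)" using C by (intro mult_left_mono bn_le_N) auto
    then show ?thesis using C(2)[of x] by (simp add: mult.assoc)
  qed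
  then show ?thesis using C Cm_pos by (intro exI[of _ "C * Cm"]) auto
qed

lemma coordinate:
  assumes "V.independent I" "b \<in> I"
  shows "\<exists>l. (\<forall>x y. l (x + y) = l x + l y) \<and> (\<forall>a x. l (j a * x) = a * l x) \<and>
     (\<forall>c\<in>I. l c = (if c = b then 1 else 0))"
proof -
  define X where "X = V.extend_basis I"
  have X: "I \<subseteq> X" "V.independent X" "V.span X = UNIV"
    using V.extend_basis_superset[OF assms(1)] V.independent_extend_basis[OF assms(1)] V.span_extend_basis[OF assms(1)]
    by (auto simp: X_def)
  show ?thesis
  proof (intro exI[of _ "\<lambda>x. V.representation X x b"] conjI allI ballI)
    show "V.representation X (x + y) b = V.representation X x b + V.representation X y b" for x y
      by (subst V.representation_add) (auto simp: X)
    show "V.representation X (j a * x) b = a * V.representation X x b" for a x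
      using V.representation_scale[of X x a] by (auto simp: X scale_along_def)
    show "V.representation X c b = (if c = b then 1 else 0)" if "c \<in> I" for c
      using V.representation_basis[of X c] that X by auto
  qed
qed

text \<open>A linear functional would separate \<open>x\<close> from \<open>S\<close>; being
  bounded, it cannot be 1 at \<open>x\<close> and 0 at points arbitrarily near.\<close>

lemma subspace_closed:
  assumes S: "V.subspace S" and approx: "\<And>e. 0 < e \<Longrightarrow> \<exists>y\<in>S. N (x - y) < e"
  shows "x \<in> S"
proof (rule ccontr)
  assume x: "x \<notin> S"
  obtain I where I: "I \<subseteq> S" "V.independent I" "S \<subseteq> V.span I"
    by (rule V.maximal_independent_subset)
  have "V.span I = S" using I S V.span_minimal by blast
  then have ind: "V.independent (insert x I)" using I x by (simp add: V.independent_insertI)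
  obtain l where l: "\<And>x y. l (x + y) = l x + l y" "\<And>a x. l (j a * x) = a * l x"
    "\<And>c. c \<in> insert x I \<Longrightarrow> l c = (if c = x then 1 else 0)"
    using coordinate[OF ind insertI1] by blast
  obtain C where C: "C > 0" "\<And>x. nrm (l x) \<le> C * N x" using functional_bounded_N[OF l(1,2)] by blast
  have l0: "l y = 0" if "y \<in> S" for y
  proof -
    have "y \<in> V.span I" using that I by blast
    then show ?thesis
    proof (induction rule: V.span_induct_alt)
      case base
      then show ?case using l(2)[of 0 0] by simp
    next
      case (step c a y)
      have "a \<noteq> x" using step(1) I x by blast
      then show ?case using step l(3)[of a] by (simp add: l scale_along_def)
    qed
  qed
  obtain y where y: "y \<in> S" "N (x - y) < 1 / C" using approx[of "1 / C"] C by auto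
  have "l x = l (x - y) + l y" using l(1)[of "x - y" y] by simp
  then have "l (x - y) = 1" using l0[OF y(1)] l(3)[of x] by simp
  then have "1 \<le> C * N (x - y)" using C(2)[of "x - y"] by simp
  then show False using y(2) C(1) by (simp add: field_simps)
qed

lemma range_jB_closed: "(\<And>e. 0 < e \<Longrightarrow> \<exists>f. N (x - jB f) < e) \<Longrightarrow> x \<in> range jB"
proof (rule subspace_closed)
  show "V.subspace (range jB)"
  proof (rule V.subspaceI)
    show "0 \<in> range jB" using jB_simps(4) by (metis rangeI)
    show "x + y \<in> range jB" if "x \<in> range jB" "y \<in> range jB" for x y
      using that by (auto simp flip: jB_simps(2))
    show "scale_along j c x \<in> range jB" if "x \<in> range jB" for c x
      using that by (auto simp: scale_along_def j_eq simp flip: jB_simps(3))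
  qed
qed auto

lemma N_of_p: "N (j (of_nat p)) = 1 / real p" unfolding N_j by (rule nrm_p)

text \<open>On the shell between the norm of \<open>p\<close> and 1 the norm is locally constant, so
  it takes finitely many values there, and the largest belongs to a uniformizer. \<open>S\<close>
  will be \<open>F\<close> and \<open>E\<close>.\<close>

lemma discrete:
  assumes "j (of_nat p) \<in> S"
  shows "\<exists>w\<in>S. w \<noteq> 0 \<and> N w < 1 \<and> (\<forall>x\<in>S. N x < 1 \<longrightarrow> N x \<le> N w)"
proof -
  define A where "A = {x \<in> S. 1 / real p \<le> N x \<and> N x < 1}"
  have p0: "0 < 1 / real p" using p_gt_1 by simp
  have "finite (N ` A)"
  proof (rule finite_image_of_locally_constant[OF p0])
    fix x y assume xy: "x \<in> A" "y \<in> A" "N (x - y) < 1 / real p"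
    then have "N (x - y) < N x" "N (x - y) < N y" by (auto simp: A_def)
    then show "N x = N y" using N_add[of "x - y" y] N_diff[of x "x - y"] by (simp add: max_def split: if_splits)
  qed (auto simp: A_def)
  moreover have pA: "j (of_nat p) \<in> A" unfolding A_def mem_Collect_eq N_of_p using assms p_gt_1 by simp
  ultimately have fin: "finite (N ` A)" "N ` A \<noteq> {}" by auto
  obtain w where w: "w \<in> A" "N w = Max (N ` A)" using Max_in[OF fin] by auto
  have "N x \<le> N w" if "x \<in> S" "N x < 1" for x
  proof (cases "x \<in> A")
    case True
    then show ?thesis unfolding w(2) using fin by (intro Max_ge) auto
  next
    case False
    then have "N x < 1 / real p" using that by (auto simp: A_def)
    then show ?thesis using w(1) by (auto simp: A_def)
  qed
  moreover have "w \<noteq> 0" using w(1) p0 by (auto simp: A_def)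
  ultimately show ?thesis using w(1) by (auto simp: A_def)
qed

lemma N_sum: "0 \<le> M \<Longrightarrow> (\<And>a. a \<in> A \<Longrightarrow> N (f a) \<le> M) \<Longrightarrow> N (sum f A) \<le> M"
proof (induction A rule: infinite_finite_induct)
  case (insert a A)
  then have "max (N (f a)) (N (sum f A)) \<le> M" by simp
  with N_add[of "f a" "sum f A"] have "N (f a + sum f A) \<le> M" by linarith
  with insert show ?case by simp
qed auto

lemma close_powers:
  assumes "N x \<le> 1" "0 < e"
  shows "\<exists>m n. M < m \<and> m < n \<and> N (x ^ n - x ^ m) < e"
proof -
  have "N (x ^ n) \<le> 1" for n using assms by (simp add: N_power power_le_one)
  from convergent_subsequence[of "\<lambda>n. x ^ n", OF this] obtain r L
    where r: "strict_mono r" and L: "(\<lambda>n. N (x ^ r n - L)) \<longlonglongrightarrow> 0" by blast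
  from order_tendstoD(2)[OF L assms(2)] obtain n0 where n0: "\<And>n. n0 \<le> n \<Longrightarrow> N (x ^ r n - L) < e"
    by (auto simp: eventually_sequentially)
  define a where "a = max n0 (Suc M)"
  have "M < r a" using seq_suble[OF r, of a] by (simp add: a_def)
  moreover have "r a < r (Suc a)" using r by (simp add: strict_mono_def)
  moreover have "N (x ^ r (Suc a) - x ^ r a) < e"
  proof -
    have "N (x ^ r (Suc a) - x ^ r a) \<le> max (N (x ^ r (Suc a) - L)) (N (x ^ r a - L))"
      using N_diff[of "x ^ r (Suc a) - L" "x ^ r a - L"] by simp
    moreover have "n0 \<le> a" by (simp add: a_def)
    ultimately show ?thesis using n0[of a] n0[of "Suc a"] by linarith
  qed
  ultimately show ?thesis by blast
qed

text \<open>Coordinate functionals are bounded, so a sufficiently small element has integral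
  coefficients.\<close>

lemma small_combination:
  assumes I: "finite I" "V.independent I"
  shows "\<exists>d>0. \<forall>z\<in>V.span I. N z < d \<longrightarrow> (\<exists>u. (\<forall>b\<in>I. nrm (u b) \<le> 1) \<and> z = (\<Sum>b\<in>I. j (u b) * b))"
proof -
  have "\<exists>C>0. \<forall>z u. z = (\<Sum>b\<in>I. j (u b) * b) \<longrightarrow> nrm (u b) \<le> C * N z" if b: "b \<in> I" for b
  proof -
    obtain l where l: "\<And>x y. l (x + y) = l x + l y" "\<And>a x. l (j a * x) = a * l x"
      "\<And>c. c \<in> I \<Longrightarrow> l c = (if c = b then 1 else 0)"
      using coordinate[OF I(2) b] by blast
    obtain C where C: "C > 0" "\<And>x. nrm (l x) \<le> C * N x" using functional_bounded_N[OF l(1,2)] by blast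
    have l0: "l 0 = 0" using l(2)[of 0 0] by simp
    have "l (\<Sum>b\<in>I. j (u b) * b) = u b" for u
    proof -
      have lsum: "l (sum f A) = (\<Sum>a\<in>A. l (f a))" for f and A :: "'b set"
        by (induction A rule: infinite_finite_induct) (auto simp: l(1) l0)
      have "l (\<Sum>b\<in>I. j (u b) * b) = (\<Sum>c\<in>I. if c = b then u c else 0)"
        unfolding lsum l(2) by (intro sum.cong refl) (simp add: l(3))
      then show ?thesis using b I(1) by simp
    qed
    then have "nrm (u b) \<le> C * N z" if "z = (\<Sum>b\<in>I. j (u b) * b)" for z u
      using C(2)[of z] that by (simp only:)
    then show ?thesis using C(1) by blast
  qed
  then have "\<forall>b\<in>I. \<exists>C. C > 0 \<and> (\<forall>z u. z = (\<Sum>b\<in>I. j (u b) * b) \<longrightarrow> nrm (u b) \<le> C * N z)" by simp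
  from bchoice[OF this] obtain C where "\<forall>b\<in>I. C b > 0 \<and> (\<forall>z u. z = (\<Sum>b\<in>I. j (u b) * b) \<longrightarrow> nrm (u b) \<le> C b * N z)"
    by (rule exE)
  then have C: "\<And>b. b \<in> I \<Longrightarrow> C b > 0"
    "\<And>b z u. b \<in> I \<Longrightarrow> z = (\<Sum>b\<in>I. j (u b) * b) \<Longrightarrow> nrm (u b) \<le> C b * N z" by simp_all
  define D where "D = 1 + sum C I"
  have CD: "C b \<le> D" if "b \<in> I" for b
  proof -
    have "C b \<le> sum C I" using that I(1) C(1) by (intro member_le_sum) (auto simp: less_imp_le)
    then show ?thesis by (simp add: D_def)
  qed
  have D: "0 < D" using C(1) by (simp add: D_def add_pos_nonneg sum_nonneg less_imp_le)
  show ?thesis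
  proof (intro exI[of _ "1 / D"] conjI ballI impI)
    fix z assume z: "z \<in> V.span I" "N z < 1 / D"
    then obtain u where u: "z = (\<Sum>b\<in>I. j (u b) * b)"
      using V.span_finite[OF I(1)] by (auto simp: scale_along_def)
    have "nrm (u b) \<le> 1" if b: "b \<in> I" for b
    proof -
      have "nrm (u b) \<le> C b * N z" by (rule C(2)[OF b u])
      also have "\<dots> \<le> D * N z" using CD[OF b] by (intro mult_right_mono) auto
      also have "\<dots> \<le> 1" using z(2) D by (simp add: field_simps)
      finally show ?thesis .
    qed
    then show "\<exists>u. (\<forall>b\<in>I. nrm (u b) \<le> 1) \<and> z = (\<Sum>b\<in>I. j (u b) * b)" using u by blast
  qed (use D in simp)
qed

text \<open>
  By compactness two distinct high powers of \<open>x\<close> are so close that their difference is an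
  integral combination of lower powers, which is an equation of integral dependence.
\<close>
lemma integral_equation:
  assumes "N x \<le> 1"
  shows "\<exists>f. lead_coeff f = 1 \<and> (\<forall>i. nrm (coeff f i) \<le> 1) \<and> (\<Sum>i\<le>degree f. j (coeff f i) * x ^ i) = 0"
proof -
  obtain I where I: "I \<subseteq> range (\<lambda>i. x ^ i)" "V.independent I" "range (\<lambda>i. x ^ i) \<subseteq> V.span I"
    by (rule V.maximal_independent_subset)
  have finI: "finite I" by (rule V.finiteI_independent[OF I(2)])
  obtain C where C: "inj_on (\<lambda>i. x ^ i) C" "I = (\<lambda>i. x ^ i) ` C"
    using I(1) unfolding subset_image_inj by blast
  have finC: "finite C" using finI C by (simp add: finite_image_iff)
  obtain M where M: "\<And>i. i \<in> C \<Longrightarrow> i \<le> M" using finC by (auto simp: finite_nat_set_iff_bounded_le)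
  obtain d where d: "d > 0" "\<And>z. z \<in> V.span I \<Longrightarrow> N z < d \<Longrightarrow> \<exists>u. (\<forall>b\<in>I. nrm (u b) \<le> 1) \<and> z = (\<Sum>b\<in>I. j (u b) * b)"
    using small_combination[OF finI I(2)] by blast
  obtain m n where mn: "M < m" "m < n" "N (x ^ n - x ^ m) < d" using close_powers[OF assms d(1)] by blast
  have "x ^ n - x ^ m \<in> V.span I" using I(3) by (intro V.span_diff) auto
  from d(2)[OF this mn(3)] obtain u where u: "\<And>b. b \<in> I \<Longrightarrow> nrm (u b) \<le> 1" "x ^ n - x ^ m = (\<Sum>b\<in>I. j (u b) * b)"
    by blast
  define a where "a i = u (x ^ i)" for i
  have a: "\<And>i. i \<in> C \<Longrightarrow> nrm (a i) \<le> 1" "x ^ n - x ^ m = (\<Sum>i\<in>C. j (a i) * x ^ i)"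
    using u by (auto simp: a_def C sum.reindex)
  define f where "f = monom 1 n - monom 1 m - (\<Sum>i\<in>C. monom (a i) i)"
  have cf: "coeff f k = (if k = n then 1 else 0) - (if k = m then 1 else 0) - (if k \<in> C then a k else 0)" for k
    using finC by (auto simp: f_def coeff_sum)
  have nC: "n \<notin> C" "m \<notin> C" using M mn by (auto simp: not_le dest!: M)
  have "coeff f n = 1" using nC mn by (simp add: cf)
  moreover have "degree f = n"
  proof (rule antisym)
    show "degree f \<le> n" using M mn by (intro degree_le) (fastforce simp: cf)
    show "n \<le> degree f" using \<open>coeff f n = 1\<close> by (intro le_degree) simp
  qed
  ultimately have lead: "lead_coeff f = 1" by simp
  moreover have "nrm (coeff f k) \<le> 1" for k
    using nC mn(2) a(1)[of k] by (auto simp: cf)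
  moreover have "(\<Sum>i\<le>degree f. j (coeff f i) * x ^ i) = 0"
  proof -
    have "(\<Sum>i\<le>n. j (coeff f i) * x ^ i)
        = (\<Sum>i\<le>n. (if i = n then x ^ i else 0) - (if i = m then x ^ i else 0) - (if i \<in> C then j (a i) * x ^ i else 0))"
      by (intro sum.cong refl) (auto simp: cf left_diff_distrib)
    also have "\<dots> = x ^ n - x ^ m - (\<Sum>i\<in>{..n} \<inter> C. j (a i) * x ^ i)"
      using mn(2) by (simp add: sum_subtractf sum.If_cases)
    also have "{..n} \<inter> C = C" using M mn by fastforce
    finally show ?thesis using a(2) \<open>degree f = n\<close> by simp
  qed
  ultimately show ?thesis by blast
qed

text \<open>In a monic equation with integral coefficients the leading power of an element of norm
  above 1 would dominate all other terms; the converse is \<open>integral_equation\<close>. The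
  embedding \<open>e\<close> is left open so that \<open>F\<close> and \<open>E\<close> are both
  covered.\<close>

lemma integer_ring_eq:
  fixes e :: "'x::field \<Rightarrow> 'b" and h :: "'k \<Rightarrow> 'x"
  assumes e: "unital_ring_hom e" and h: "unital_ring_hom h" and eh: "\<And>a. e (h a) = j a"
  shows "integer_ring nrm h = {y. N (e y) \<le> 1}"
proof -
  note [simp] = unital_ring_hom_facts[OF e]
  have eval: "e (poly (map_poly h f) y) = (\<Sum>i\<le>degree f. j (coeff f i) * e y ^ i)" for f y
    by (simp add: poly_map_poly_sum unital_ring_hom_facts[OF h] eh)
  show ?thesis
  proof (intro set_eqI iffI)
    fix y assume "y \<in> integer_ring nrm h"
    then obtain f where f: "lead_coeff f = 1" "\<And>i. nrm (coeff f i) \<le> 1" "poly (map_poly h f) y = 0"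
      by (auto simp: integer_ring_def)
    define x where "x = e y"
    define n where "n = degree f"
    have 0: "(\<Sum>i\<le>n. j (coeff f i) * x ^ i) = 0" using eval[of f y] f(3) by (simp add: n_def x_def)
    have split: "(\<Sum>i\<le>n. j (coeff f i) * x ^ i) = (\<Sum>i<n. j (coeff f i) * x ^ i) + x ^ n"
      using f(1) by (simp add: n_def flip: lessThan_Suc_atMost)
    have eq: "x ^ n = - (\<Sum>i<n. j (coeff f i) * x ^ i)" using 0 split by (simp add: eq_neg_iff_add_eq_0 add.commute)
    have "N x \<le> 1"
    proof (rule ccontr)
      assume "\<not> N x \<le> 1"
      then have x1: "1 < N x" by simp
      have "n \<noteq> 0"
      proof
        assume "n = 0"
        then show False using eq by simp
      qed
      have "N (x ^ n) \<le> N x ^ (n - 1)"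
        unfolding eq N_minus
      proof (rule N_sum)
        fix i assume "i \<in> {..<n}"
        then have "N x ^ i \<le> N x ^ (n - 1)" using x1 by (intro power_increasing) auto
        moreover have "N (j (coeff f i) * x ^ i) \<le> 1 * N x ^ i"
          unfolding N_mult N_j N_power using f(2) by (intro mult_right_mono) auto
        ultimately show "N (j (coeff f i) * x ^ i) \<le> N x ^ (n - 1)" by simp
      qed simp
      also have "\<dots> < N x ^ n" using x1 \<open>n \<noteq> 0\<close> by (intro power_strict_increasing) auto
      finally show False by (simp add: N_power)
    qed
    then show "y \<in> {y. N (e y) \<le> 1}" by (simp add: x_def)
  next
    fix y assume "y \<in> {y. N (e y) \<le> 1}"
    then obtain f where f: "lead_coeff f = 1" "\<forall>i. nrm (coeff f i) \<le> 1"
      "(\<Sum>i\<le>degree f. j (coeff f i) * e y ^ i) = 0" using integral_equation by blast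
    then have "e (poly (map_poly h f) y) = 0" by (simp only: eval)
    then have "poly (map_poly h f) y = 0" by (simp add: unital_ring_hom_eq_0[OF e])
    then show "y \<in> integer_ring nrm h" using f by (auto simp: integer_ring_def)
  qed
qed

text \<open>Being closer than \<open>e\<close> is an equivalence relation, and one point is chosen
  from each of its finitely many classes in the unit ball.\<close>

lemma finite_net:
  assumes "0 < e"
  shows "\<exists>T. finite T \<and> T \<subseteq> {x. N x \<le> 1} \<and> (\<forall>x. N x \<le> 1 \<longrightarrow> (\<exists>t\<in>T. N (x - t) < e))"
proof -
  define A where "A = {x. N x \<le> 1}"
  define cl where "cl x = {y \<in> A. N (x - y) < e}" for x
  have "finite (cl ` A)"
  proof (rule finite_image_of_locally_constant[OF assms])
    fix x y assume "N (x - y) < e"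
    have "N (y - z) < e" if "N (x - z) < e" "N (x - y) < e" for x y z
      using N_diff[of "x - z" "x - y"] that by simp
    from this[OF _ \<open>N (x - y) < e\<close>] this[of y _ x] show "cl x = cl y"
      using \<open>N (x - y) < e\<close> N_commute[of x y] by (auto simp: cl_def)
  qed (simp add: A_def)
  moreover have some: "(SOME t. t \<in> cl x) \<in> cl x" if "x \<in> A" for x
    by (rule someI[of _ x]) (use that assms in \<open>simp add: cl_def\<close>)
  define T where "T = (\<lambda>c. SOME t. t \<in> c) ` cl ` A"
  have "finite T" using calculation by (simp add: T_def)
  moreover have "T \<subseteq> {x. N x \<le> 1}" using some by (auto simp: T_def cl_def A_def)
  moreover have "\<exists>t\<in>T. N (x - t) < e" if "N x \<le> 1" for x
  proof
    have "x \<in> A" using that by (simp add: A_def)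
    then show "(SOME t. t \<in> cl x) \<in> T" by (simp add: T_def)
    show "N (x - (SOME t. t \<in> cl x)) < e" using some[OF \<open>x \<in> A\<close>] by (simp add: cl_def)
  qed
  ultimately show ?thesis by blast
qed

definition oF :: "'f set" where "oF = {f. N (jB f) \<le> 1}"
definition OB :: "'b set" where "OB = {x. N x \<le> 1}"

text \<open>An order is finitely generated over \<open>oF\<close>, hence bounded, and contains all
  powers of its elements, so none of them can have norm above 1.\<close>

lemma order_subset:
  assumes "is_order oF jB R"
  shows "R \<subseteq> OB"
proof
  note order = assms[unfolded is_order_def]
  have "\<exists>S. finite S \<and> R = {\<Sum>s\<in>S. jB (c s) * s | c. \<forall>s\<in>S. c s \<in> oF}"
    by (rule conjunct1[OF conjunct2[OF conjunct2[OF order]]])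
  then obtain S where S: "finite S" "R = {\<Sum>s\<in>S. jB (c s) * s | c. \<forall>s\<in>S. c s \<in> oF}"
    by - (erule exE, elim conjE, rule that)
  have R: "1 \<in> R" "\<And>x y. x \<in> R \<Longrightarrow> y \<in> R \<Longrightarrow> x * y \<in> R"
    using conjunct1[OF order] conjunct1[OF conjunct2[OF order]] by auto
  define M where "M = sum N S"
  have NM: "N x \<le> M" if x: "x \<in> R" for x
  proof -
    obtain c where c: "x = (\<Sum>s\<in>S. jB (c s) * s)" "\<And>s. s \<in> S \<Longrightarrow> N (jB (c s)) \<le> 1"
      using x S(2) by (auto simp: oF_def)
    show ?thesis unfolding c(1)
    proof (rule N_sum)
      fix s assume s: "s \<in> S"
      have "N (jB (c s)) * N s \<le> 1 * N s" using c(2)[OF s] by (intro mult_right_mono) auto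
      also have "1 * N s \<le> M" unfolding M_def using member_le_sum[OF s, of N] S(1) by simp
      finally show "N (jB (c s) * s) \<le> M" by (simp add: N_mult)
    qed (simp add: M_def sum_nonneg)
  qed
  fix x assume x: "x \<in> R"
  have "x ^ n \<in> R" for n by (induction n) (auto simp: R x)
  then have bound: "N x ^ n \<le> M" for n using NM by (simp flip: N_power)
  show "x \<in> OB"
  proof (rule ccontr)
    assume "x \<notin> OB"
    then obtain n where "M < N x ^ n" using real_arch_pow[of "N x" M] by (auto simp: OB_def)
    then show False using bound[of n] by simp
  qed
qed

lemma order_OB: "is_order oF jB OB"
proof -
  interpret B: vector_space "scale_along jB" by (rule vector_space_scale_along[OF jB_hom])
  have "x - y \<in> OB \<and> x * y \<in> OB" if "x \<in> OB" "y \<in> OB" for x y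
  proof -
    have "N x \<le> 1" "N y \<le> 1" using that by (auto simp: OB_def)
    then show ?thesis using N_diff[of x y] mult_le_one[of "N x" "N y"] by (simp add: OB_def N_mult)
  qed
  moreover have "B.span OB = UNIV"
  proof (intro set_eqI iffI UNIV_I)
    fix x
    obtain c where c: "c \<noteq> 0" "nrm c * N x \<le> 1" using ex_scaling by blast
    have "scale_along jB (inverse (jF c)) (j c * x) \<in> B.span OB"
      using c(2) by (intro B.span_scale B.span_base) (simp add: OB_def N_mult N_j)
    moreover have "jF c \<noteq> 0" using c(1) by (simp add: unital_ring_hom_eq_0[OF jF_hom])
    ultimately show "x \<in> B.span OB"
      by (simp add: scale_along_def j_eq flip: mult.assoc jB_simps(3))
  qed
  moreover have "\<exists>S. finite S \<and> OB = {\<Sum>s\<in>S. jB (c s) * s | c. \<forall>s\<in>S. c s \<in> oF}"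
  proof -
    \<comment> \<open>\<open>c0\<close> makes all \<open>c0 * b\<close> integral. The radius
      \<open>nrm c0 / Cm\<close> of the net \<open>T\<close> is then such that \<open>x - t\<close>
      has coordinates divisible by \<open>c0\<close>, so \<open>T\<close> and the
      \<open>c0 * b\<close> generate.\<close>
    obtain c0 where c0: "c0 \<noteq> 0" "nrm c0 * sum N Bs \<le> 1" using ex_scaling by blast
    have nc0: "0 < nrm c0" using c0(1) nrm_nonneg[of c0] nrm_eq_0[of c0] by linarith
    have small: "N (j c0 * b) \<le> 1" if "b \<in> Bs" for b
    proof -
      have "N b \<le> sum N Bs" using member_le_sum[OF that, of N] V.finite_Basis by simp
      then have "nrm c0 * N b \<le> nrm c0 * sum N Bs" by (intro mult_left_mono) auto
      then show ?thesis using c0 by (simp add: N_mult N_j)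
    qed
    obtain T where T: "finite T" "T \<subseteq> {x. N x \<le> 1}" "\<And>x. N x \<le> 1 \<Longrightarrow> \<exists>t\<in>T. N (x - t) < nrm c0 / Cm"
      using finite_net[of "nrm c0 / Cm"] nc0 Cm_pos by auto
    define S where "S = T \<union> (\<lambda>b. j c0 * b) ` Bs"
    have finS: "finite S" using T V.finite_Basis by (simp add: S_def)
    have S1: "N s \<le> 1" if "s \<in> S" for s using that T small by (auto simp: S_def)
    define Q where "Q = {\<Sum>s\<in>S. jB (c s) * s | c. \<forall>s\<in>S. c s \<in> oF}"
    have Q_add: "x + y \<in> Q" if xy: "x \<in> Q" "y \<in> Q" for x y
    proof -
      obtain c d where c: "x = (\<Sum>s\<in>S. jB (c s) * s)" "\<And>s. s \<in> S \<Longrightarrow> c s \<in> oF"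
        and d: "y = (\<Sum>s\<in>S. jB (d s) * s)" "\<And>s. s \<in> S \<Longrightarrow> d s \<in> oF" using xy unfolding Q_def by blast
      have "x + y = (\<Sum>s\<in>S. jB (c s + d s) * s)" by (simp add: c d distrib_right sum.distrib)
      moreover have "c s + d s \<in> oF" if "s \<in> S" for s
        using c(2)[OF that] d(2)[OF that] N_add[of "jB (c s)" "jB (d s)"] by (simp add: oF_def)
      ultimately show ?thesis unfolding Q_def
        by (intro CollectI exI[of _ "\<lambda>s. c s + d s"]) simp
    qed
    have Q_base: "jB c * s \<in> Q" if "s \<in> S" "c \<in> oF" for c s
    proof -
      have "jB c * s = (\<Sum>s'\<in>S. jB (if s' = s then c else 0) * s')"
        using that(1) finS by (simp add: if_distrib[of jB] if_distrib[of "\<lambda>u. u * _"] cong: if_cong)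
      moreover have "\<forall>s'\<in>S. (if s' = s then c else 0) \<in> oF" using that(2) by (simp add: oF_def)
      ultimately show ?thesis unfolding Q_def
        by (intro CollectI exI[of _ "\<lambda>s'. if s' = s then c else 0"]) simp
    qed
    have Q_0: "0 \<in> Q" unfolding Q_def by (auto intro!: exI[of _ "\<lambda>_. 0"] simp: oF_def)
    have Q_sum: "sum f A \<in> Q" if "\<And>a. a \<in> A \<Longrightarrow> f a \<in> Q" for f and A :: "'b set"
      using that by (induction A rule: infinite_finite_induct) (auto simp: Q_0 Q_add)
    have "OB = Q"
    proof (intro set_eqI iffI)
      fix x assume "x \<in> OB"
      then obtain t where t: "t \<in> T" "N (x - t) < nrm c0 / Cm" using T(3) by (auto simp: OB_def)
      have co: "nrm (co (x - t) b) \<le> nrm c0" if "b \<in> Bs" for b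
      proof -
        have "nrm (co (x - t) b) \<le> bn (x - t)" by (rule nrm_co_le[OF that])
        also have "\<dots> \<le> Cm * N (x - t)" by (rule bn_le_N)
        also have "\<dots> \<le> nrm c0" using t(2) Cm_pos by (simp add: field_simps)
        finally show ?thesis .
      qed
      have "x - t = (\<Sum>b\<in>Bs. j (co (x - t) b) * b)" by (rule co_expand)
      also have "\<dots> = (\<Sum>b\<in>Bs. jB (jF (co (x - t) b / c0)) * (j c0 * b))"
        using c0(1) by (intro sum.cong refl) (simp flip: mult.assoc j_simps(3) j_eq)
      also have "\<dots> \<in> Q"
      proof (intro Q_sum Q_base)
        fix b assume b: "b \<in> Bs"
        then show "j c0 * b \<in> S" unfolding S_def by (intro UnI2 imageI)
        have "nrm (co (x - t) b / c0) * nrm c0 \<le> 1 * nrm c0" using co[OF b] c0(1) by (simp flip: nrm_mult)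
        then have "nrm (co (x - t) b / c0) \<le> 1" using nc0 by (rule mult_right_le_imp_le)
        then show "jF (co (x - t) b / c0) \<in> oF" by (simp only: oF_def mem_Collect_eq j_eq[symmetric] N_j)
      qed
      finally have "x - t \<in> Q" .
      moreover have "jB 1 * t \<in> Q" using t(1) by (intro Q_base) (auto simp: S_def oF_def)
      ultimately show "x \<in> Q" using Q_add by fastforce
    next
      fix x assume "x \<in> Q"
      then obtain c where c: "x = (\<Sum>s\<in>S. jB (c s) * s)" "\<And>s. s \<in> S \<Longrightarrow> c s \<in> oF" unfolding Q_def by blast
      have "N x \<le> 1" unfolding c(1)
      proof (rule N_sum)
        fix s assume "s \<in> S"
        then show "N (jB (c s) * s) \<le> 1"
          using c(2)[of s] S1[of s] mult_le_one[of "N (jB (c s))" "N s"] by (simp add: N_mult oF_def)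
      qed simp
      then show "x \<in> OB" by (simp add: OB_def)
    qed
    then show ?thesis using finS unfolding Q_def by blast
  qed
  ultimately show ?thesis unfolding is_order_def by (auto simp: OB_def)
qed

lemma maximal_order_eq: "maximal_order oF jB = OB"
  unfolding maximal_order_def
proof (rule the_equality)
  show "is_order oF jB OB \<and> (\<forall>R'. is_order oF jB R' \<and> OB \<subseteq> R' \<longrightarrow> R' = OB)"
    using order_OB order_subset by blast
  fix R assume "is_order oF jB R \<and> (\<forall>R'. is_order oF jB R' \<and> R \<subseteq> R' \<longrightarrow> R' = R)"
  then show "R = OB" using order_OB order_subset by blast
qed

end

section \<open>The arithmetic of the quaternion algebra over the unramified extension\<close>

lemma card_equal_fibers:
  assumes "finite S" "\<And>x. x \<in> S \<Longrightarrow> card {y \<in> S. g y = g x} = k"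
  shows "card S = card (g ` S) * k"
proof -
  have "card S = (\<Sum>y\<in>g ` S. \<Sum>x\<in>{x \<in> S. g x = y}. 1)"
    using assms(1) by (subst sum.group) auto
  also have "\<dots> = (\<Sum>y\<in>g ` S. k)" by (rule sum.cong) (auto simp: assms(2))
  finally show ?thesis by simp
qed

lemma char_conductor_le: "(\<And>x. x \<in> higher_units R m \<Longrightarrow> \<theta> x = 1) \<Longrightarrow> char_conductor R \<theta> \<le> m"
  unfolding char_conductor_def by (intro Least_le) blast

text \<open>A \<open>LEAST\<close> level has the property only if some level has it, which the first
  assumption supplies.\<close>

lemma char_conductor_trivial:
  assumes "\<And>x. x \<in> higher_units R m \<Longrightarrow> \<theta> x = 1" and "x \<in> higher_units R (char_conductor R \<theta>)"
  shows "\<theta> x = 1"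
proof -
  have "\<exists>n. \<forall>x\<in>higher_units R n. \<theta> x = 1" using assms(1) by blast
  then have "\<forall>x\<in>higher_units R (char_conductor R \<theta>). \<theta> x = 1"
    unfolding char_conductor_def by (rule LeastI_ex)
  then show ?thesis using assms(2) by blast
qed

locale local_quaternion = padic_quaternion p nrm j Bs jE jB emb jF
  for p :: nat and nrm :: "'k::field_char_0 \<Rightarrow> real" and j :: "'k \<Rightarrow> 'b::division_ring" and Bs
    and jE :: "'f::field \<Rightarrow> 'e::field" and jB :: "'f \<Rightarrow> 'b" and emb :: "'e \<Rightarrow> 'b" and jF :: "'k \<Rightarrow> 'f" +
  assumes unram: "ideal_times {y. N (emb y) \<le> 1} (jE ` max_ideal oF) = max_ideal {y. N (emb y) \<le> 1}"
begin

abbreviation Fs where "Fs \<equiv> range jB"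
abbreviation Es where "Es \<equiv> range emb"

section \<open>Uniformizers of \<open>F\<close> and \<open>E\<close>\<close>

definition pF :: 'f where
  "pF = (SOME w. w \<noteq> 0 \<and> N (jB w) < 1 \<and> (\<forall>x. N (jB x) < 1 \<longrightarrow> N (jB x) \<le> N (jB w)))"

lemma pF: "pF \<noteq> 0 \<and> N (jB pF) < 1 \<and> (\<forall>x. N (jB x) < 1 \<longrightarrow> N (jB x) \<le> N (jB pF))"
proof -
  have "j (of_nat p) \<in> Fs" unfolding j_eq by (rule rangeI)
  from discrete[OF this] obtain f where "jB f \<noteq> 0" "N (jB f) < 1" "\<forall>x\<in>Fs. N x < 1 \<longrightarrow> N x \<le> N (jB f)"
    by (elim bexE rangeE conjE) simp
  then have "f \<noteq> 0 \<and> N (jB f) < 1 \<and> (\<forall>x. N (jB x) < 1 \<longrightarrow> N (jB x) \<le> N (jB f))" by simp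
  then show ?thesis unfolding pF_def by (rule someI)
qed

sublocale OF: discrete_valuation "\<lambda>f. N (jB f)" pF
  using pF N_add by unfold_locales (auto simp: N_mult)

lemma ex_pE: "\<exists>w. w \<noteq> 0 \<and> N (emb w) < 1 \<and> (\<forall>x. N (emb x) < 1 \<longrightarrow> N (emb x) \<le> N (emb w))"
proof -
  have "j (of_nat p) \<in> Es" unfolding j_eq by (rule jB_in_E)
  from discrete[OF this] obtain f where "emb f \<noteq> 0" "N (emb f) < 1" "\<forall>x\<in>Es. N x < 1 \<longrightarrow> N x \<le> N (emb f)"
    by (elim bexE rangeE conjE) simp
  then have "f \<noteq> 0 \<and> N (emb f) < 1 \<and> (\<forall>x. N (emb x) < 1 \<longrightarrow> N (emb x) \<le> N (emb f))" by simp
  then show ?thesis by (rule exI)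
qed

text \<open>Here \<open>unram\<close> enters: a uniformizer of \<open>E\<close> is a sum of integral
  multiples of nonunits of \<open>F\<close>, so its norm is at most that of
  \<open>pF\<close>.\<close>

lemma jE_pF: "discrete_valuation (\<lambda>x. N (emb x)) (jE pF)"
proof -
  obtain w where w: "w \<noteq> 0" "N (emb w) < 1" "\<And>x. N (emb x) < 1 \<Longrightarrow> N (emb x) \<le> N (emb w)"
    using ex_pE by blast
  then interpret OE: discrete_valuation "\<lambda>x. N (emb x)" w
    using N_add by unfold_locales (auto simp: N_mult)
  have "w \<in> max_ideal {y. N (emb y) \<le> 1}" using w by (simp add: OE.max_ideal_R)
  then have "w \<in> ideal_times {y. N (emb y) \<le> 1} (jE ` {f. N (jB f) < 1})"
    using OF.max_ideal_R by (simp add: oF_def flip: unram)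
  then obtain m a b where m: "w = (\<Sum>i<m::nat. a i * b i)"
    and ab: "\<forall>i<m. a i \<in> {y. N (emb y) \<le> 1} \<and> b i \<in> jE ` {f. N (jB f) < 1}"
    by (auto simp: ideal_times_def)
  have "N (emb w) \<le> N (jB pF)" unfolding m emb_simps(9)
  proof (rule N_sum)
    fix i assume "i \<in> {..<m}"
    then obtain f where f: "b i = jE f" "N (jB f) < 1" "N (emb (a i)) \<le> 1" using ab by auto
    have "N (emb (a i)) * N (jB f) \<le> 1 * N (jB pF)"
      using f OF.v_le_w by (intro mult_mono) auto
    then show "N (emb (a i * b i)) \<le> N (jB pF)" by (simp add: f N_mult emb_jE)
  qed simp
  then show ?thesis
    using w pF N_add by unfold_locales (auto simp: N_mult emb_jE unital_ring_hom_eq_0[OF jE_hom] intro: order_trans)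
qed

sublocale OE: discrete_valuation "\<lambda>x. N (emb x)" "jE pF" by (rule jE_pF)

definition rho :: real where "rho = N (jB pF)"
lemma rho: "0 < rho" "rho < 1" using OF.v_pos[OF OF.w_nonzero] OF.v_w by (auto simp: rho_def)
lemma N_emb_jE_pF: "N (emb (jE pF)) = rho" by (simp add: emb_jE rho_def)

definition vp :: 'b where "vp = jB pF"
lemma N_vp: "N vp = rho" by (simp add: vp_def rho_def)
lemma vp_nonzero [simp]: "vp \<noteq> 0" by (simp add: vp_def)
lemma vp_F: "vp \<in> Fs" by (simp add: vp_def)

lemma Fs_central: "f \<in> Fs \<Longrightarrow> f * x = x * f" using jB_central by auto
lemma Fs_E: "f \<in> Fs \<Longrightarrow> f \<in> Es" using jB_in_E by auto
lemma Fs_cj: "f \<in> Fs \<Longrightarrow> cj f = f" by auto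
lemma Fs_closed:
  "x \<in> Fs \<Longrightarrow> y \<in> Fs \<Longrightarrow> x + y \<in> Fs" "x \<in> Fs \<Longrightarrow> y \<in> Fs \<Longrightarrow> x - y \<in> Fs"
  "x \<in> Fs \<Longrightarrow> y \<in> Fs \<Longrightarrow> x * y \<in> Fs" "x \<in> Fs \<Longrightarrow> - x \<in> Fs" "x \<in> Fs \<Longrightarrow> inverse x \<in> Fs"
  "x \<in> Fs \<Longrightarrow> x ^ n \<in> Fs" "x \<in> Fs \<Longrightarrow> x powi k \<in> Fs"
proof -
  show p: "x \<in> Fs \<Longrightarrow> x ^ n \<in> Fs" for x n by (auto simp flip: jB_simps)
  show i: "x \<in> Fs \<Longrightarrow> inverse x \<in> Fs" for x by (auto simp flip: jB_inverse)
  show "x \<in> Fs \<Longrightarrow> x powi k \<in> Fs" using p[of x] p[OF i, of x] by (simp add: power_int_def)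
qed (auto simp flip: jB_simps)
lemma Es_closed:
  "x \<in> Es \<Longrightarrow> y \<in> Es \<Longrightarrow> x + y \<in> Es" "x \<in> Es \<Longrightarrow> y \<in> Es \<Longrightarrow> x - y \<in> Es"
  "x \<in> Es \<Longrightarrow> y \<in> Es \<Longrightarrow> x * y \<in> Es" "x \<in> Es \<Longrightarrow> - x \<in> Es" "x \<in> Es \<Longrightarrow> inverse x \<in> Es"
  "x \<in> Es \<Longrightarrow> x ^ n \<in> Es" "x \<in> Es \<Longrightarrow> cj x \<in> Es"
  using range_emb_closed by (auto simp: cj_E hat_E simp flip: emb_simps)
lemma one_F: "1 \<in> Fs" "0 \<in> Fs" using jB_simps by (metis rangeI)+
lemma one_E: "1 \<in> Es" "0 \<in> Es" using one_F Fs_E by auto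

lemma N_inverse: "N (inverse x) = inverse (N x)"
proof (cases "x = 0")
  case False
  have "N x * N (inverse x) = 1" using False by (simp flip: N_mult)
  then show ?thesis by (rule inverse_unique[symmetric])
qed simp

lemma N_power_int: "N (x powi k) = N x powi k"
  by (auto simp: power_int_def N_power N_inverse)

lemma E_valuation: "x \<in> Es \<Longrightarrow> x \<noteq> 0 \<Longrightarrow> \<exists>k. N x = rho powi k"
  using OE.valuation by (auto simp: N_emb_jE_pF)

lemma E_less_le_Suc: "x \<in> Es \<Longrightarrow> N x < rho ^ n \<Longrightarrow> N x \<le> rho ^ Suc n"
  using OE.v_less_le_Suc by (auto simp: N_emb_jE_pF)

lemma E_less_1: "x \<in> Es \<Longrightarrow> N x < 1 \<Longrightarrow> N x \<le> rho"
  using E_less_le_Suc[of x 0] by simp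

lemma E_scale: "x \<in> Es \<Longrightarrow> x \<noteq> 0 \<Longrightarrow> \<exists>f\<in>Fs. f \<noteq> 0 \<and> N (f * x) = 1"
proof -
  assume "x \<in> Es" "x \<noteq> 0"
  then obtain k where k: "N x = rho powi k" using E_valuation by blast
  have "N (vp powi (- k) * x) = 1"
    using rho by (simp add: N_mult N_power_int N_vp k flip: power_int_add)
  then show ?thesis using Fs_closed(7)[OF vp_F] by (intro bexI[of _ "vp powi (- k)"]) auto
qed

lemma N_add_le: "N x \<le> M \<Longrightarrow> N y \<le> M \<Longrightarrow> N (x + y) \<le> M" using N_add[of x y] by simp
lemma N_diff_le: "N x \<le> M \<Longrightarrow> N y \<le> M \<Longrightarrow> N (x - y) \<le> M" using N_diff[of x y] by simp
lemma N_add_less: "N x < M \<Longrightarrow> N y < M \<Longrightarrow> N (x + y) < M" using N_add[of x y] by simp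
lemma N_diff_less: "N x < M \<Longrightarrow> N y < M \<Longrightarrow> N (x - y) < M" using N_diff[of x y] by simp
lemma N_close: "N (x - y) < N x \<Longrightarrow> N y = N x"
  using N_add[of "x - y" y] N_diff[of x "x - y"] by (simp add: max_def split: if_splits)
lemma N_trans_less: "N (x - y) < M \<Longrightarrow> N (y - z) < M \<Longrightarrow> N (x - z) < M"
  using N_add_less[of "x - y" M "y - z"] by simp

lemma N_power_diff_less:
  assumes "N x \<le> 1" "N y \<le> 1" "N (x - y) < 1"
  shows "N (x ^ n - y ^ n) < 1"
proof (induction n)
  case (Suc n)
  have "x ^ Suc n - y ^ Suc n = (x - y) * x ^ n + y * (x ^ n - y ^ n)" by (simp add: algebra_simps)
  moreover have "N ((x - y) * x ^ n) < 1"
  proof -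
    have "N (x - y) * N x ^ n \<le> N (x - y) * 1" using assms by (intro mult_left_mono power_le_one) auto
    then show ?thesis using assms(3) by (simp add: N_mult N_power)
  qed
  moreover have "N (y * (x ^ n - y ^ n)) < 1"
  proof -
    have "N y * N (x ^ n - y ^ n) \<le> 1 * N (x ^ n - y ^ n)" using assms by (intro mult_right_mono) auto
    then show ?thesis using Suc by (simp add: N_mult)
  qed
  ultimately show ?case by (simp only: N_add_less)
qed simp

text \<open>If every integer of \<open>E\<close> were congruent to one of \<open>F\<close>, the
  common uniformizer would allow successive approximation, and \<open>E\<close> would lie in the
  closed set \<open>F\<close>.\<close>

lemma residue_degree: "\<exists>u\<in>Es. N u \<le> 1 \<and> (\<forall>f\<in>Fs. N f \<le> 1 \<longrightarrow> 1 \<le> N (u - f))"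
proof (rule ccontr)
  assume neg: "\<not> ?thesis"
  have step: "\<exists>f\<in>Fs. N (x - f) < 1" if "x \<in> Es" "N x \<le> 1" for x
  proof -
    have "\<not> (\<forall>f\<in>Fs. N f \<le> 1 \<longrightarrow> 1 \<le> N (x - f))" using neg that by blast
    then show ?thesis by (metis not_le)
  qed
  have approx: "\<exists>f\<in>Fs. N (x - f) \<le> rho ^ n" if "x \<in> Es" "N x \<le> 1" for x n
  proof (induction n)
    case 0
    then show ?case using that one_F by (intro bexI[of _ 0]) auto
  next
    case (Suc n)
    then obtain f where f: "f \<in> Fs" "N (x - f) \<le> rho ^ n" by blast
    define y where "y = inverse (vp ^ n) * (x - f)"
    have "y \<in> Es" unfolding y_def
      by (intro Es_closed Fs_E Fs_closed vp_F f that)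
    moreover have "N y \<le> 1"
    proof -
      have "N y = inverse (rho ^ n) * N (x - f)" by (simp only: y_def N_mult N_inverse N_power N_vp)
      also have "\<dots> \<le> inverse (rho ^ n) * rho ^ n" using f(2) rho by (intro mult_left_mono) auto
      finally show ?thesis using rho by simp
    qed
    ultimately obtain g where g: "g \<in> Fs" "N (y - g) < 1" using step by blast
    have "N (y - g) \<le> rho" 
      by (rule E_less_1[OF Es_closed(2)[OF \<open>y \<in> Es\<close> Fs_E[OF g(1)]] g(2)])
    moreover have "x - (f + vp ^ n * g) = vp ^ n * (y - g)"
      by (simp add: y_def right_diff_distrib flip: mult.assoc)
    ultimately have "N (x - (f + vp ^ n * g)) \<le> rho ^ Suc n"
      using rho by (simp add: N_mult N_power N_vp)
    moreover have "f + vp ^ n * g \<in> Fs" by (intro Fs_closed vp_F f g)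
    ultimately show ?case by blast
  qed
  have "ii \<in> Es" by (simp add: ii_def)
  then obtain f where f: "f \<in> Fs" "f \<noteq> 0" "N (f * ii) = 1"
    using E_scale[OF \<open>ii \<in> Es\<close> ii_nonzero] by blast
  have "f * ii \<in> Es" by (rule Es_closed(3)[OF Fs_E[OF f(1)] \<open>ii \<in> Es\<close>])
  have "f * ii \<in> Fs"
  proof (rule range_jB_closed)
    fix e :: real assume "0 < e"
    then obtain n where "rho ^ n < e" using real_arch_pow_inv[of e rho] rho by auto
    then show "\<exists>g. N (f * ii - jB g) < e"
      using approx[OF \<open>f * ii \<in> Es\<close>, of n] f(3) by auto (meson le_less_trans)
  qed
  then have "inverse f * (f * ii) \<in> Fs" by (rule Fs_closed(3)[OF Fs_closed(5)[OF f(1)]])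
  then show False using f(2) ii_notin by (simp flip: mult.assoc)
qed

lemma half_F: "inverse 2 \<in> Fs"
proof -
  have "(2::'b) = 1 + 1" by simp
  also have "\<dots> \<in> Fs" by (intro Fs_closed one_F)
  finally show ?thesis by (rule Fs_closed)
qed

lemma N_2: "N 2 \<le> 1" using N_add_le[of 1 1 1] by simp

text \<open>The residue extension is separable. If 2 is a unit, a \<open>u\<close> with
  \<open>u - cj u\<close> small is close to half its trace. Otherwise the trace of \<open>u\<close>
  is small, so \<open>u * u\<close> is congruent to the scalar \<open>n\<close>, and taking square
  roots in a finite field of characteristic 2 brings \<open>u\<close> itself close to
  \<open>F\<close>.\<close>

lemma residue_separable: "\<exists>u\<in>Es. N u = 1 \<and> N (u - cj u) = 1"
proof -
  obtain u where u: "u \<in> Es" "N u \<le> 1" and far: "\<And>f. f \<in> Fs \<Longrightarrow> N f \<le> 1 \<Longrightarrow> 1 \<le> N (u - f)"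
    using residue_degree by blast
  have Nu: "N u = 1" using u(2) far[of 0] one_F by simp
  have le: "N (u - cj u) \<le> 1" using u(2) by (intro N_diff_le) (auto simp: N_cj)
  have "\<not> N (u - cj u) < 1"
  proof
    assume less: "N (u - cj u) < 1"
    define t where "t = u + cj u"
    have tF: "t \<in> Fs" unfolding t_def by (rule trace_in)
    have t2: "2 * u - t = u - cj u" by (simp add: t_def mult_2)
    show False
    proof (cases "N 2 = 1")
      case True
      have "inverse 2 * (2 * u - t) = (inverse 2 * 2) * u - inverse 2 * t"
        by (simp only: right_diff_distrib mult.assoc)
      also have "inverse 2 * 2 = (1::'b)" using two_nonzero by (rule left_inverse)
      finally have "u - inverse 2 * t = inverse 2 * (u - cj u)" unfolding t2 by (simp only: mult_1_left)
      then have "N (u - inverse 2 * t) = N (inverse 2) * N (u - cj u)" by (simp only: N_mult)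
      then have "N (u - inverse 2 * t) < 1" using True less by (simp only: N_inverse) simp
      moreover have "N t \<le> 1" unfolding t_def using u(2) by (intro N_add_le) (auto simp: N_cj)
      then have "N (inverse 2 * t) \<le> 1" unfolding N_mult N_inverse True by simp
      moreover have "inverse 2 * t \<in> Fs" by (intro Fs_closed tF half_F)
      ultimately show False using far[of "inverse 2 * t"] by simp
    next
      case False
      then have N2: "N 2 < 1" using N_2 by simp
      have Nt: "N t < 1"
      proof -
        have "t = 2 * u - (u - cj u)" by (simp flip: t2)
        moreover have "N (2 * u) < 1" using N2 Nu by (simp add: N_mult)
        ultimately show ?thesis using less N_diff_less by metis
      qed
      define n where "n = - (u * cj u)"
      have nF: "n \<in> Fs" unfolding n_def by (intro Fs_closed norm_in)
      have Nn: "N n = 1" by (simp add: n_def N_mult N_cj Nu)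
      have un: "N (u * u - n) < 1"
      proof -
        have "u * u - n = t * u" using quadratic[of u] by (simp add: n_def t_def)
        then show ?thesis using Nt Nu by (simp add: N_mult)
      qed
      \<comment> \<open>Modulo the maximal ideal squaring is injective, since
        \<open>(x - y) * (x - y)\<close> and \<open>x ^ 2 - y ^ 2\<close> differ by a multiple of
        2.\<close>
      have root: "N (x - y) < 1" if xy: "x * y = y * x" "N x \<le> 1" "N y \<le> 1" "N (x ^ 2 - y ^ 2) < 1" for x y
      proof -
        have "(x - y) * (x - y) = (x ^ 2 - y ^ 2) - 2 * (x * y - y * y)"
          using xy(1) by (simp add: algebra_simps power2_eq_square mult_2 mult_2_right)
        moreover have "N (2 * (x * y - y * y)) < 1"
        proof -
          have "N (x * y - y * y) \<le> 1" using xy by (intro N_diff_le) (auto simp: N_mult mult_le_one)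
          then have "N 2 * N (x * y - y * y) \<le> N 2 * 1" by (intro mult_left_mono) auto
          then show ?thesis using N2 by (subst N_mult) linarith
        qed
        ultimately have "N ((x - y) * (x - y)) < 1" using xy(4) N_diff_less by metis
        then have "N (x - y) ^ 2 < 1" by (simp add: N_mult power2_eq_square)
        then show ?thesis by (simp add: power_less_one_iff)
      qed
      have "N (u ^ 2 ^ k) \<le> 1" for k by (simp add: N_power Nu)
      from convergent_subsequence[of "\<lambda>k. u ^ 2 ^ k", OF this] obtain r L
        where r: "strict_mono r" and L: "(\<lambda>n. N (u ^ 2 ^ r n - L)) \<longlonglongrightarrow> 0" by blast
      from order_tendstoD(2)[OF L zero_less_one] obtain n0 where n0: "\<And>n. n0 \<le> n \<Longrightarrow> N (u ^ 2 ^ r n - L) < 1"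
        by (auto simp: eventually_sequentially)
      have "r n0 < r (Suc n0)" using r by (simp add: strict_mono_def)
      then obtain d where d: "r (Suc n0) = Suc d + r n0" by (metis add_Suc less_iff_Suc_add add.commute)
      \<comment> \<open>By compactness two iterated squares of \<open>u\<close> agree modulo the
        maximal ideal; undoing the common squarings shows that some iterated square of
        \<open>u\<close> is congruent to \<open>u\<close>.\<close>
      have top: "N (u ^ 2 ^ (Suc d + r n0) - u ^ 2 ^ r n0) < 1"
        using N_diff_less[OF n0[of "Suc n0"] n0[of n0]] d by simp
      have "N (u ^ 2 ^ (Suc d + k) - u ^ 2 ^ k) < 1" if "k \<le> r n0" for k
        using that
      proof (induction rule: inc_induct)
        case base
        show ?case by (rule top)
      next
        case (step k)
        have "u ^ 2 ^ (Suc d + Suc k) = (u ^ 2 ^ (Suc d + k)) ^ 2" "u ^ 2 ^ Suc k = (u ^ 2 ^ k) ^ 2"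
          by (simp_all add: mult.commute flip: power_mult)
        then have "N ((u ^ 2 ^ (Suc d + k)) ^ 2 - (u ^ 2 ^ k) ^ 2) < 1" using step(3) by (simp only:)
        moreover have "u ^ 2 ^ (Suc d + k) * u ^ 2 ^ k = u ^ 2 ^ k * u ^ 2 ^ (Suc d + k)"
          by (simp only: power_add[symmetric] add.commute)
        ultimately show ?case by - (rule root, simp_all only: N_power Nu power_one order_refl)
      qed
      from this[of 0] have "N (u ^ 2 ^ Suc d - u) < 1" by simp
      moreover have "u ^ 2 ^ Suc d = (u * u) ^ 2 ^ d" by (simp add: power_mult power2_eq_square)
      moreover have "N ((u * u) ^ 2 ^ d - n ^ 2 ^ d) < 1"
        using un Nn Nu by (intro N_power_diff_less) (auto simp: N_mult)
      ultimately have "N (u - u ^ 2 ^ Suc d) < 1" "N (u ^ 2 ^ Suc d - n ^ 2 ^ d) < 1"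
        by (simp_all only: N_commute[of u])
      then have "N (u - n ^ 2 ^ d) < 1" by (rule N_trans_less)
      moreover have "n ^ 2 ^ d \<in> Fs" by (intro Fs_closed nF)
      moreover have "N (n ^ 2 ^ d) \<le> 1" by (simp add: N_power Nn)
      ultimately show False using far[of "n ^ 2 ^ d"] by simp
    qed
  qed
  then show ?thesis using u Nu le by auto
qed

definition uu :: 'b where "uu = (SOME u. u \<in> Es \<and> N u = 1 \<and> N (u - cj u) = 1)"
lemma uu: "uu \<in> Es" "N uu = 1" "N (uu - cj uu) = 1"
  using someI_ex[of "\<lambda>u. u \<in> Es \<and> N u = 1 \<and> N (u - cj u) = 1"] residue_separable
  by (auto simp: uu_def)

text \<open>A square root of the discriminant of the basis \<open>1\<close>, \<open>uu\<close> of
  \<open>E\<close>; as it is a unit, this basis is an integral one.\<close>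

definition dd :: 'b where "dd = uu - cj uu"
lemma dd: "dd \<in> Es" "N dd = 1" "cj dd = - dd"
  using uu by (auto simp: dd_def cj_diff cj_cj intro!: Es_closed)
lemma dd_nonzero [simp]: "dd \<noteq> 0" using dd(2) by auto

text \<open>Cramer's rule with determinant \<open>dd\<close>. The coefficient \<open>b\<close> has
  norm \<open>N (x - cj x)\<close>, which thus measures the distance from \<open>x\<close> to
  \<open>F\<close>.\<close>

lemma E_split:
  assumes x: "x \<in> Es"
  shows "\<exists>a\<in>Fs. \<exists>b\<in>Fs. x = a + b * uu \<and> N b = N (x - cj x) \<and> N a \<le> N x"
proof -
  define b where "b = (x - cj x) * inverse dd"
  have bE: "b \<in> Es" unfolding b_def using x dd(1) by (intro Es_closed)
  have "cj b = b" unfolding b_def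
    using E_commute[of "inverse dd" "x - cj x"] x dd(1)
    by (simp add: cj_mult cj_inverse cj_diff cj_cj dd(3) Es_closed) (metis minus_diff_eq mult_minus_right)
  then have bF: "b \<in> Fs" by (rule cj_fixed)
  define a where "a = x - b * uu"
  have bd: "b * dd = x - cj x" by (simp add: b_def mult.assoc)
  have "cj a = cj x - b * cj uu" by (simp add: a_def cj_diff cj_mult \<open>cj b = b\<close> Fs_central[OF bF])
  also have "\<dots> = a"
    using bd unfolding a_def dd_def by (simp add: algebra_simps)
  finally have aF: "a \<in> Fs" by (rule cj_fixed)
  have Nb: "N b = N (x - cj x)" by (simp add: b_def N_mult N_inverse dd)
  also have "\<dots> \<le> N x" by (intro N_diff_le) (auto simp: N_cj)
  finally have "N b \<le> N x" .
  then have "N a \<le> N x" unfolding a_def using uu(2) by (intro N_diff_le) (auto simp: N_mult)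
  then show ?thesis using aF bF Nb by (intro bexI[of _ a] bexI[of _ b]) (auto simp: a_def)
qed

section \<open>The residue field of \<open>E\<close>, and the units of \<open>F\<close> as
  norms\<close>

definition U :: "'b set" where "U = {x \<in> Es. N x = 1}"

lemma U_closed:
  "x \<in> U \<Longrightarrow> y \<in> U \<Longrightarrow> x * y \<in> U" "x \<in> U \<Longrightarrow> inverse x \<in> U" "x \<in> U \<Longrightarrow> cj x \<in> U" "1 \<in> U"
  by (auto simp: U_def N_mult N_inverse N_cj one_E intro: Es_closed)

lemma U_E: "x \<in> U \<Longrightarrow> x \<in> Es" by (simp add: U_def)
lemma U_N: "x \<in> U \<Longrightarrow> N x = 1" by (simp add: U_def)
lemma U_nonzero: "x \<in> U \<Longrightarrow> x \<noteq> 0" by (auto simp: U_def)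
lemma U_commute: "x \<in> U \<Longrightarrow> y \<in> U \<Longrightarrow> x * y = y * x" by (auto simp: U_def intro: E_commute)

definition eqv :: "'b \<Rightarrow> 'b \<Rightarrow> bool" where "eqv x y \<longleftrightarrow> N (x - y) < 1"

lemma eqv_refl [simp]: "eqv x x" by (simp add: eqv_def)
lemma eqv_sym: "eqv x y \<Longrightarrow> eqv y x" by (simp add: eqv_def N_commute)
lemma eqv_trans: "eqv x y \<Longrightarrow> eqv y z \<Longrightarrow> eqv x z" unfolding eqv_def by (rule N_trans_less)
lemma eqv_mult:
  assumes "eqv x x'" "eqv y y'" "N x \<le> 1" "N y' \<le> 1"
  shows "eqv (x * y) (x' * y')"
proof -
  have "x * y - x' * y' = x * (y - y') + (x - x') * y'" by (simp add: algebra_simps)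
  moreover have "N (x * (y - y')) < 1"
    using assms mult_right_mono[of "N x" 1 "N (y - y')"] by (simp add: N_mult eqv_def)
  moreover have "N ((x - x') * y') < 1"
    using assms mult_left_mono[of "N y'" 1 "N (x - x')"] by (simp add: N_mult eqv_def)
  ultimately show ?thesis by (simp only: eqv_def N_add_less)
qed

text \<open>\<open>SOME\<close> picks from the set of all units congruent to \<open>x\<close>, so
  congruent units get the same representative. The set \<open>Rep\<close> of representatives is the
  multiplicative group of the residue field without a quotient type.\<close>

definition rep :: "'b \<Rightarrow> 'b" where "rep x = (SOME y. y \<in> {y \<in> U. eqv x y})"

lemma rep: "x \<in> U \<Longrightarrow> rep x \<in> U" "x \<in> U \<Longrightarrow> eqv x (rep x)"
  using someI[of "\<lambda>y. y \<in> {y \<in> U. eqv x y}" x] by (auto simp: rep_def)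

lemma rep_eq: "x \<in> U \<Longrightarrow> y \<in> U \<Longrightarrow> rep x = rep y \<longleftrightarrow> eqv x y"
proof
  assume "x \<in> U" "y \<in> U" "rep x = rep y"
  then show "eqv x y" using rep eqv_sym eqv_trans by metis
next
  assume "eqv x y"
  then have "{z \<in> U. eqv x z} = {z \<in> U. eqv y z}" using eqv_trans eqv_sym by blast
  then show "rep x = rep y" by (simp only: rep_def)
qed

lemma rep_eqI: "x \<in> U \<Longrightarrow> y \<in> U \<Longrightarrow> eqv x y \<Longrightarrow> rep x = rep y"
  by (simp add: rep_eq)

lemma rep_rep: "x \<in> U \<Longrightarrow> rep (rep x) = rep x"
  using rep rep_eq eqv_sym by metis

definition Rep :: "'b set" where "Rep = rep ` U"

lemma finite_Rep: "finite Rep"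
  unfolding Rep_def
  by (rule finite_image_of_locally_constant[of 1]) (auto simp: U_N rep_eq eqv_def)

lemma Rep_U: "r \<in> Rep \<Longrightarrow> r \<in> U" using rep by (auto simp: Rep_def)
lemma Rep_rep: "r \<in> Rep \<Longrightarrow> rep r = r" using rep_rep by (auto simp: Rep_def)

text \<open>The order of a finite group is that of an image times that of the kernel, here for the
  endomorphism of the residue group induced by \<open>g\<close>. Translation by \<open>r\<close>
  identifies each fibre with the kernel.\<close>

lemma card_kernel_image:
  assumes g: "\<And>x. x \<in> U \<Longrightarrow> g x \<in> U" "\<And>x y. x \<in> U \<Longrightarrow> y \<in> U \<Longrightarrow> g (x * y) = g x * g y"
    "\<And>x y. x \<in> U \<Longrightarrow> y \<in> U \<Longrightarrow> eqv x y \<Longrightarrow> eqv (g x) (g y)"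
  shows "card Rep = card ((\<lambda>r. rep (g r)) ` Rep) * card {r \<in> Rep. rep (g r) = rep 1}"
proof (rule card_equal_fibers[OF finite_Rep])
  have g1: "g 1 = 1" using g(2)[of 1 1] U_nonzero[OF g(1)[of 1]] U_closed(4) by simp
  have grep: "eqv (g (rep x)) (g x)" if "x \<in> U" for x
    using that by (intro g(3) rep eqv_sym[OF rep(2)])
  fix r assume "r \<in> Rep"
  then have r: "r \<in> U" by (rule Rep_U)
  have ginv: "g (inverse r) * g r = 1" using g(2)[of "inverse r" r] r g1 U_closed U_nonzero by simp
  let ?K = "{s \<in> Rep. rep (g s) = rep 1}" and ?L = "{s \<in> Rep. rep (g s) = rep (g r)}"
  have "bij_betw (\<lambda>s. rep (s * r)) ?K ?L"
  proof (rule bij_betw_byWitness[where f' = "\<lambda>s. rep (s * inverse r)"])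
    have inv: "rep (rep (s * r) * t) = s" if s: "s \<in> Rep" and rt: "r \<in> U" "t \<in> U" "r * t = 1" for s r t
    proof -
      have sU: "s \<in> U" using s by (rule Rep_U)
      have "eqv (rep (s * r) * t) (s * r * t)"
        using sU rt by (intro eqv_mult eqv_sym[OF rep(2)]) (simp_all add: U_N rep(1) U_closed)
      moreover have "s * r * t = s" using rt(3) by (simp add: mult.assoc)
      ultimately have "rep (rep (s * r) * t) = rep s"
        using sU rt by (intro rep_eqI) (simp_all add: U_closed rep(1))
      then show ?thesis using Rep_rep[OF s] by simp
    qed
    show "\<forall>s\<in>?K. rep (rep (s * r) * inverse r) = s"
      using inv[of _ r "inverse r"] r U_closed U_nonzero by auto
    show "\<forall>s\<in>?L. rep (rep (s * inverse r) * r) = s"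
      using inv[of _ "inverse r" r] r U_closed U_nonzero by auto
    have mem: "rep (s * t) \<in> Rep" if "s \<in> Rep" "t \<in> U" for s t
      unfolding Rep_def by (intro imageI U_closed(1) Rep_U that)
    have val: "rep (g (rep (s * t))) = rep (a * g t)" if "s \<in> Rep" "t \<in> U" "rep (g s) = rep a" "a \<in> U" for s t a
    proof -
      have sU: "s \<in> U" using that by (intro Rep_U)
      have 1: "eqv (g (rep (s * t))) (g (s * t))" using sU that by (intro grep U_closed)
      have "eqv (g s) a" using that sU g(1) rep_eq by auto
      then have "eqv (g s * g t) (a * g t)"
        using sU that g(1) by (intro eqv_mult) (simp_all add: U_N)
      moreover have "g (s * t) = g s * g t" by (rule g(2)[OF sU that(2)])
      ultimately have "eqv (g (rep (s * t))) (a * g t)" using eqv_trans[OF 1, of "a * g t"] by simp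
      then show ?thesis using sU that g(1) by (intro rep_eqI) (simp_all add: U_closed rep(1))
    qed
    show "(\<lambda>s. rep (s * r)) ` ?K \<subseteq> ?L"
    proof
      fix x assume "x \<in> (\<lambda>s. rep (s * r)) ` ?K"
      then obtain s where s: "s \<in> Rep" "rep (g s) = rep 1" "x = rep (s * r)" by blast
      then show "x \<in> ?L" using mem[OF s(1) r] val[OF s(1) r s(2) U_closed(4)] by simp
    qed
    show "(\<lambda>s. rep (s * inverse r)) ` ?L \<subseteq> ?K"
    proof
      fix x assume "x \<in> (\<lambda>s. rep (s * inverse r)) ` ?L"
      then obtain s where s: "s \<in> Rep" "rep (g s) = rep (g r)" "x = rep (s * inverse r)" by blast
      have r': "inverse r \<in> U" by (rule U_closed(2)[OF r])
      have "g r * g (inverse r) = 1" using ginv U_commute[OF g(1)[OF r] g(1)[OF r']] by simp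
      then show "x \<in> ?K" using mem[OF s(1) r'] val[OF s(1) r' s(2) g(1)[OF r]] s(3) by simp
    qed
  qed
  then show "card ?L = card ?K" by (simp add: bij_betw_same_card)
qed

lemma eqv_cj: "eqv x y \<Longrightarrow> eqv (cj x) (cj y)"
  using N_cj[of "x - y"] by (simp add: eqv_def cj_diff)

text \<open>\<open>y = 1 + x\<close> works, because \<open>x * cj y\<close> is then congruent to
  \<open>y\<close>. If \<open>1 + x\<close> is not a unit, \<open>x\<close> is congruent to -1 and
  the trace-zero unit \<open>dd\<close> takes its place.\<close>

lemma residue_hilbert_90:
  assumes x: "x \<in> U" "eqv (x * cj x) 1"
  shows "\<exists>y\<in>U. eqv (y * inverse (cj y)) x"
proof (cases "eqv x (- 1)")
  case True
  have "dd \<in> U" using dd by (simp add: U_def)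
  moreover have "dd * inverse (cj dd) = - 1" by (simp add: dd inverse_minus_eq)
  ultimately show ?thesis using eqv_sym[OF True] by (intro bexI[of _ dd]) auto
next
  case False
  define y where "y = 1 + x"
  have "N y \<le> 1" unfolding y_def using x by (intro N_add_le) (auto simp: U_N)
  moreover have "\<not> N y < 1" using False by (simp add: y_def eqv_def add.commute)
  moreover have "y \<in> Es" unfolding y_def by (rule Es_closed(1)[OF one_E(1) U_E[OF x(1)]])
  ultimately have y: "y \<in> U" by (simp add: U_def)
  have "eqv (y * inverse (cj y)) (x * cj y * inverse (cj y))"
  proof (rule eqv_mult)
    have "x * cj y = x + x * cj x" by (simp add: y_def cj_add distrib_left)
    then have "y - x * cj y = - (x * cj x - 1)" by (simp add: y_def)
    then show "eqv y (x * cj y)" using x(2) by (simp only: eqv_def N_minus)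
  qed (use y in \<open>auto simp: U_N U_closed\<close>)
  moreover have "x * cj y * inverse (cj y) = x" using U_nonzero[OF y] by (simp add: mult.assoc)
  ultimately show ?thesis using y by auto
qed

text \<open>Counting. Let \<open>g\<close> be the norm and \<open>h\<close> the quotient by the
  conjugate. Hilbert 90 places the kernel of \<open>g\<close> in the image of \<open>h\<close>, so
  the image of \<open>g\<close> is at least as large as the kernel of \<open>h\<close>. That kernel
  contains all unit residues of \<open>F\<close>, among which the image of \<open>g\<close> lies, so
  these residues are all norms.\<close>

lemma residue_norm_surjective:
  assumes n: "n \<in> Fs" "N n = 1"
  shows "\<exists>e\<in>U. eqv (e * cj e) n"
proof -
  define g h where "g x = x * cj x" and "h x = x * inverse (cj x)" for x
  define A where "A = (\<lambda>r. rep (g r)) ` Rep"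
  define K where "K = {r \<in> Rep. rep (h r) = rep 1}"
  have UF: "f \<in> U" if "f \<in> Fs" "N f = 1" for f using that Fs_E by (simp add: U_def)
  have h_U: "h x \<in> U" if "x \<in> U" for x using that by (simp add: h_def U_closed)
  have g_U: "g x \<in> U" if "x \<in> U" for x using that by (simp add: g_def U_closed)
  have h_eqv: "eqv (h x) (h y)" if xy: "x \<in> U" "y \<in> U" "eqv x y" for x y
  proof -
    have "inverse (cj x) - inverse (cj y) = inverse (cj x) * (cj y - cj x) * inverse (cj y)"
      using xy U_nonzero by (simp add: algebra_simps)
    then have "eqv (inverse (cj x)) (inverse (cj y))"
      using eqv_cj[OF xy(3)] xy by (simp add: eqv_def N_mult N_inverse N_cj U_N N_commute)
    then show ?thesis unfolding h_def using xy by (intro eqv_mult) (auto simp: U_N U_closed)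
  qed
  have "card Rep = card A * card {r \<in> Rep. rep (g r) = rep 1}"
    unfolding A_def
  proof (rule card_kernel_image[OF g_U])
    show "g (x * y) = g x * g y" if "x \<in> U" "y \<in> U" for x y
    proof -
      have "y * (cj y * cj x) = cj x * (y * cj y)"
        using U_commute[of "y * cj y" "cj x"] that by (simp add: U_closed mult.assoc)
      then show ?thesis by (simp add: g_def cj_mult mult.assoc)
    qed
    show "eqv (g x) (g y)" if "x \<in> U" "y \<in> U" "eqv x y" for x y
      unfolding g_def using that by (intro eqv_mult eqv_cj) (auto simp: U_N U_closed)
  qed
  moreover have "card Rep = card ((\<lambda>r. rep (h r)) ` Rep) * card K"
    unfolding K_def
  proof (rule card_kernel_image[OF h_U])
    show "h (x * y) = h x * h y" if xy: "x \<in> U" "y \<in> U" for x y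
    proof -
      have "h (x * y) = x * (y * (inverse (cj x) * inverse (cj y)))"
        using xy U_nonzero by (simp add: h_def cj_mult nonzero_inverse_mult_distrib mult.assoc)
      also have "y * (inverse (cj x) * inverse (cj y)) = inverse (cj x) * (y * inverse (cj y))"
        using U_commute[of y "inverse (cj x)"] xy by (simp add: U_closed flip: mult.assoc)
      finally show ?thesis by (simp add: h_def mult.assoc)
    qed
  qed (assumption | erule (2) h_eqv)+
  moreover have "{r \<in> Rep. rep (g r) = rep 1} \<subseteq> (\<lambda>r. rep (h r)) ` Rep"
  proof
    fix r assume "r \<in> {r \<in> Rep. rep (g r) = rep 1}"
    then have r: "r \<in> Rep" "r \<in> U" "eqv (r * cj r) 1"
      using Rep_U rep_eq[OF g_U U_closed(4)] by (auto simp: g_def)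
    obtain y where y: "y \<in> U" "eqv (y * inverse (cj y)) r" using residue_hilbert_90[OF r(2,3)] by blast
    have "eqv (h (rep y)) (h y)"
      by (rule h_eqv[OF rep(1)[OF y(1)] y(1) eqv_sym[OF rep(2)[OF y(1)]]])
    then have "eqv (h (rep y)) r" using y(2) eqv_trans by (auto simp: h_def)
    then have "rep (h (rep y)) = rep r" using y r by (subst rep_eq) (auto intro: h_U rep)
    then have "r = rep (h (rep y))" using Rep_rep[OF r(1)] by simp
    moreover have "rep y \<in> Rep" using y by (auto simp: Rep_def)
    ultimately show "r \<in> (\<lambda>r. rep (h r)) ` Rep" by blast
  qed
  then have "card {r \<in> Rep. rep (g r) = rep 1} \<le> card ((\<lambda>r. rep (h r)) ` Rep)"
    using finite_Rep by (intro card_mono) auto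
  moreover have "0 < card {r \<in> Rep. rep (g r) = rep 1}"
  proof -
    have "rep 1 \<in> {r \<in> Rep. rep (g r) = rep 1}"
    proof -
      have "eqv (rep 1 * cj (rep 1)) (1 * cj 1)"
        using U_closed(4) by (intro eqv_mult eqv_cj eqv_sym[OF rep(2)]) (auto simp: U_N rep)
      then have "rep (g (rep 1)) = rep 1"
        using U_closed(4) rep(1)[OF U_closed(4)] g_U by (subst rep_eq) (auto simp: g_def)
      then show ?thesis using U_closed(4) by (auto simp: Rep_def)
    qed
    then show ?thesis using finite_Rep by (auto simp: card_gt_0_iff)
  qed
  moreover have "b \<le> a" if "r = a * k" "r = h * b" "k \<le> h" "0 < k" for a b h k r :: nat
  proof -
    have "k * b \<le> h * b" using that(3) by (rule mult_le_mono1)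
    also have "\<dots> = k * a" using that(1,2) by (simp add: mult.commute)
    finally show ?thesis using that(4) by simp
  qed
  ultimately have "card K \<le> card A" by blast
  moreover define RF where "RF = rep ` {f \<in> Fs. N f = 1}"
  have RFK: "RF \<subseteq> K"
  proof
    fix r assume "r \<in> RF"
    then obtain f where f: "f \<in> Fs" "N f = 1" "r = rep f" by (auto simp: RF_def)
    have fU: "f \<in> U" using UF f by blast
    have rU: "rep f \<in> U" by (rule rep[OF fU])
    have "eqv (cj (rep f)) (rep f)"
      using eqv_cj[OF rep(2)[OF fU]] rep(2)[OF fU] f(1) Fs_cj eqv_sym eqv_trans by metis
    then have "eqv (rep f * inverse (cj (rep f))) (cj (rep f) * inverse (cj (rep f)))"
      using rU by (intro eqv_mult eqv_sym[OF \<open>eqv (cj (rep f)) (rep f)\<close>]) (auto simp: U_N U_closed)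
    then have "eqv (h (rep f)) 1" using U_nonzero[OF rU] by (simp add: h_def)
    then have "rep (h r) = rep 1" using rU f(3) h_U U_closed(4) by (subst rep_eq) auto
    moreover have "r \<in> Rep" using fU f(3) by (auto simp: Rep_def)
    ultimately show "r \<in> K" by (simp add: K_def)
  qed
  moreover have finK: "finite K" using finite_Rep by (simp add: K_def)
  ultimately have "card RF \<le> card A" using card_mono[OF finK RFK] by simp
  moreover have "A \<subseteq> RF"
  proof
    fix a assume "a \<in> A"
    then obtain r where r: "r \<in> Rep" "a = rep (g r)" by (auto simp: A_def)
    have "g r \<in> Fs" "N (g r) = 1" using Rep_U[OF r(1)] g_U norm_in by (auto simp: g_def U_N)
    then show "a \<in> RF" using r(2) by (auto simp: RF_def)
  qed
  moreover have "finite RF" using RFK finK by (rule finite_subset)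
  ultimately have "A = RF" by (intro card_seteq) auto
  then have "rep n \<in> A" using n by (auto simp: RF_def)
  then obtain r where r: "r \<in> Rep" "rep n = rep (g r)" by (auto simp: A_def)
  then show ?thesis using rep_eq[OF UF[OF n] g_U[OF Rep_U[OF r(1)]]] Rep_U[OF r(1)] eqv_sym by (auto simp: g_def)
qed

text \<open>Residue characteristic 2 is the case to watch. If the trace of \<open>uu\<close> is a
  unit, one divides by it; otherwise \<open>2 * uu\<close> is \<open>dd\<close> up to a small error,
  so 2 is a unit and one half serves.\<close>

lemma trace_1: "\<exists>w\<in>Es. N w \<le> 1 \<and> w + cj w = 1"
proof (cases "N (uu + cj uu) = 1")
  case True
  obtain t where t: "uu + cj uu = t" "t \<in> Fs" using trace_in by blast
  have "inverse t * uu + cj (inverse t * uu) = inverse t * (uu + cj uu)"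
    using t(2) by (simp add: cj_mult cj_inverse Fs_cj distrib_left Fs_central[OF Fs_closed(5)])
  also have "\<dots> = 1" using t True by (metis N_0 left_inverse zero_neq_one)
  finally have "inverse t * uu + cj (inverse t * uu) = 1" .
  moreover have "inverse t * uu \<in> Es" by (rule Es_closed(3)[OF Fs_E[OF Fs_closed(5)[OF t(2)]] uu(1)])
  moreover have "N (inverse t * uu) = 1" using True t(1) uu(2) by (simp add: N_mult N_inverse)
  ultimately show ?thesis by (intro bexI[of _ "inverse t * uu"]) simp_all
next
  case False
  have "N (uu + cj uu) \<le> 1" using uu by (intro N_add_le) (auto simp: N_cj)
  then have less: "N (uu + cj uu) < 1" using False by simp
  have "2 * uu = (uu - cj uu) + (uu + cj uu)" by (simp add: mult_2)
  then have "N 2 * N uu = N ((uu - cj uu) + (uu + cj uu))" by (simp only: N_mult[symmetric])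
  moreover have "N ((uu - cj uu) + (uu + cj uu)) = 1"
  proof -
    have "N (a + b) = 1" if "N a = 1" "N b < 1" for a b using N_close[of a "a + b"] that by simp
    from this[OF uu(3) less] show ?thesis .
  qed
  ultimately have N2: "N 2 = 1" using uu by simp
  have "inverse 2 + cj (inverse 2) = inverse 2 * (2::'b)" using half_F by (simp only: Fs_cj mult_2_right)
  also have "\<dots> = 1" using two_nonzero by (rule left_inverse)
  finally show ?thesis using half_F Fs_E N2 N_inverse[of 2]
    by (intro bexI[of _ "inverse 2"]) (simp_all only: inverse_1 order_refl simp_thms)
qed

lemma Es_closed_limit: "(\<And>e. 0 < e \<Longrightarrow> \<exists>y\<in>Es. N (x - y) < e) \<Longrightarrow> x \<in> Es"
proof (rule subspace_closed)
  show "V.subspace Es"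
  proof (rule V.subspaceI)
    show "scale_along j c x \<in> Es" if "x \<in> Es" for c x
      unfolding scale_along_def j_eq by (rule Es_closed(3)[OF jB_in_E that])
  qed (auto intro: one_E Es_closed)
qed auto

text \<open>Hensel's argument for the norm: approximate solutions are improved step by step, and compactness yields a solution.\<close>
lemma norm_lift:
  assumes n: "n \<in> Fs" "N n = 1" and e0: "e0 \<in> U" "N (n - e0 * cj e0) \<le> rho ^ k" and k: "1 \<le> k"
  shows "\<exists>e\<in>U. N (e - e0) \<le> rho ^ k \<and> e * cj e = n"
proof -
  obtain w where w: "w \<in> Es" "N w \<le> 1" "w + cj w = 1" using trace_1 by blast
  have approx: "\<exists>e\<in>U. N (e - e0) \<le> rho ^ k \<and> N (n - e * cj e) \<le> rho ^ (k + m)" for m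
  proof (induction m)
    case 0
    then show ?case using e0 rho by (intro bexI[of _ e0]) auto
  next
    case (Suc m)
    then obtain e where e: "e \<in> U" "N (e - e0) \<le> rho ^ k" "N (n - e * cj e) \<le> rho ^ (k + m)" by blast
    define E where "E = e * cj e"
    have EF: "E \<in> Fs" unfolding E_def by (rule norm_in)
    have NE: "N E = 1" using e by (simp add: E_def N_mult N_cj U_N)
    have E0: "E \<noteq> 0" using NE by auto
    define c where "c = (n - E) * inverse E"
    have cF: "c \<in> Fs" unfolding c_def by (intro Fs_closed(2,3,5) n(1) EF)
    have Nc: "N c \<le> rho ^ (k + m)" using e(3) NE by (simp add: c_def N_mult N_inverse E_def)
    have rle: "rho ^ (k + m) \<le> rho ^ k" "rho ^ k < 1"
      using rho k by (auto intro: power_decreasing) (metis One_nat_def Suc_le_eq power_Suc_less_one power_0 power_strict_decreasing)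
    \<comment> \<open>\<open>c\<close> is the relative error of the norm. As \<open>w\<close> has
      trace 1, the factor \<open>1 + y\<close> has norm \<open>1 + c\<close> up to the quadratic
      term \<open>y * cj y\<close>, so at least one level is gained.\<close>
    define y where "y = c * w"
    have yE: "y \<in> Es" unfolding y_def by (rule Es_closed(3)[OF Fs_E[OF cF] w(1)])
    have Ny: "N y \<le> rho ^ (k + m)" using mult_mono[OF Nc w(2)] rho by (simp add: y_def N_mult)
    have cjy: "cj y = c * cj w" using cF by (simp add: y_def cj_mult Fs_cj Fs_central[OF cF])
    have tr: "y + cj y = c" unfolding cjy unfolding y_def distrib_left[symmetric] w(3) by simp
    define e' where "e' = e * (1 + y)"
    have N1y: "N (1 + y) = 1"
      using N_close[of 1 "1 + y"] Ny rle rho by simp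
    have "1 + y \<in> U" using Es_closed(1)[OF one_E(1) yE] N1y by (simp add: U_def)
    then have "e' \<in> U" unfolding e'_def by (rule U_closed(1)[OF e(1)])
    moreover have "N (e' - e0) \<le> rho ^ k"
    proof -
      have "e' - e0 = (e - e0) + e * y" by (simp add: e'_def algebra_simps)
      moreover have "N (e * y) \<le> rho ^ k" using e(1) Ny rle by (simp add: N_mult U_N)
      ultimately show ?thesis using N_add_le[OF e(2), of "e * y"] by (simp only:)
    qed
    moreover have "N (n - e' * cj e') \<le> rho ^ (k + Suc m)"
    proof -
      have "e' * cj e' = e * ((1 + y) * cj (1 + y)) * cj e" by (simp add: e'_def cj_mult mult.assoc)
      also have "\<dots> = ((1 + y) * cj (1 + y)) * E"
        unfolding Fs_central[OF norm_in[of "1 + y"], of e, symmetric] E_def by (simp only: mult.assoc)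
      also have "(1 + y) * cj (1 + y) = 1 + c + y * cj y"
        by (simp add: cj_add algebra_simps flip: tr)
      also have "(1 + c + y * cj y) * E = n + y * cj y * E"
        using E0 by (simp add: c_def distrib_right mult.assoc)
      finally have "n - e' * cj e' = - (y * cj y * E)" by simp
      then have "N (n - e' * cj e') = N y * N y" by (simp add: N_mult N_cj NE)
      also have "\<dots> \<le> rho ^ (k + m) * rho ^ (k + m)" using Ny rho by (intro mult_mono) auto
      also have "\<dots> = rho ^ ((k + m) + (k + m))" by (simp only: power_add)
      also have "\<dots> \<le> rho ^ (k + Suc m)" using rho k by (intro power_decreasing) auto
      finally show ?thesis .
    qed
    ultimately show ?case by blast
  qed
  then obtain X where X: "\<And>m. X m \<in> U" "\<And>m. N (X m - e0) \<le> rho ^ k" "\<And>m. N (n - X m * cj (X m)) \<le> rho ^ (k + m)"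
    by metis
  obtain r L where r: "strict_mono r" and L: "(\<lambda>m. N (X (r m) - L)) \<longlonglongrightarrow> 0"
    using convergent_subsequence[of X] U_N[OF X(1)] by (metis order_refl)
  have small: "\<exists>m. N (X (r m) - L) < e \<and> m0 \<le> m" if e: "0 < e" for e m0
  proof -
    obtain m1 where "\<And>m. m1 \<le> m \<Longrightarrow> N (X (r m) - L) < e"
      using order_tendstoD(2)[OF L e] by (auto simp: eventually_sequentially)
    then show ?thesis by (intro exI[of _ "max m0 m1"]) auto
  qed
  have LE: "L \<in> Es"
  proof (rule Es_closed_limit)
    fix e :: real assume "0 < e"
    then obtain m where "N (X (r m) - L) < e" using small by blast
    then show "\<exists>y\<in>Es. N (L - y) < e" using U_E[OF X(1)] by (intro bexI[of _ "X (r m)"]) (simp_all only: N_commute[of L])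
  qed
  obtain m where m: "N (X (r m) - L) < rho ^ k" using small[of "rho ^ k"] rho by auto
  have rk: "rho ^ k < 1" using rho k by (simp add: power_less_one_iff)
  have "N L = N (X (r m))" using N_close[of "X (r m)" L] m rk U_N[OF X(1)] by simp
  then have NL: "N L = 1" using U_N[OF X(1)] by simp
  have "N (L - e0) \<le> rho ^ k"
  proof -
    have "L - e0 = (X (r m) - e0) - (X (r m) - L)" by simp
    then show ?thesis using N_diff_le[OF X(2)[of "r m"], of "X (r m) - L"] m by simp
  qed
  moreover have "L * cj L = n"
  proof -
    have "N (n - L * cj L) \<le> e" if e: "0 < e" for e
    proof -
      obtain m0 where m0: "rho ^ m0 < e" using real_arch_pow_inv[of e rho] e rho by auto
      obtain m where m: "N (X (r m) - L) < e" "m0 \<le> m" using small[OF e] by blast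
      have "n - L * cj L = (n - X (r m) * cj (X (r m))) + (X (r m) * cj (X (r m) - L) + (X (r m) - L) * cj L)"
        by (simp add: cj_diff algebra_simps)
      moreover have "N (n - X (r m) * cj (X (r m))) \<le> e"
      proof -
        have "m0 \<le> k + r m" using m(2) seq_suble[OF r, of m] by simp
        then have "rho ^ (k + r m) \<le> rho ^ m0" using rho by (intro power_decreasing) auto
        then show ?thesis using X(3)[of "r m"] m0 by linarith
      qed
      moreover have "N (X (r m) * cj (X (r m) - L)) \<le> e" "N ((X (r m) - L) * cj L) \<le> e"
        using m(1) NL U_N[OF X(1)] by (simp_all add: N_mult N_cj del: cj_diff)
      ultimately show ?thesis by (simp only: N_add_le)
    qed
    then have "N (n - L * cj L) \<le> 0" using field_le_epsilon[of "N (n - L * cj L)" 0] by simp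
    then have "N (n - L * cj L) = 0" using N_nonneg by (rule antisym)
    then show ?thesis by simp
  qed
  ultimately show ?thesis using LE NL by (intro bexI[of _ L]) (simp_all add: U_def)
qed

lemma rho_powi_add: "rho powi (k + l) = rho powi k * rho powi l"
  by (rule power_int_add) (use rho in simp)

lemma norm_unit_surjective:
  assumes "n \<in> Fs" "N n = 1"
  shows "\<exists>e\<in>U. e * cj e = n"
proof -
  obtain e0 where e0: "e0 \<in> U" "eqv (e0 * cj e0) n" using residue_norm_surjective[OF assms] by blast
  have "n - e0 * cj e0 \<in> Es" by (rule Fs_E[OF Fs_closed(2)[OF assms(1) norm_in]])
  then have "N (n - e0 * cj e0) \<le> rho ^ 1"
    using E_less_1[of "n - e0 * cj e0"] e0(2) by (simp add: eqv_def N_commute)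
  then show ?thesis using norm_lift[OF assms e0(1), of 1] by auto
qed

section \<open>The uniformizer of \<open>B\<close>\<close>

lemma ss_E_cj: "x \<in> Es \<Longrightarrow> ss * x = cj x * ss"
  using ss_E[of x] cj_E[of x] by simp

lemma cj_ss: "cj ss = - ss"
  using cj_decomposed[of 0 1] one_E by (simp add: hat_def)

text \<open>Otherwise \<open>ss\<close> could be scaled to a unit \<open>s\<close> with
  \<open>s * s\<close> in \<open>F\<close>. That square is a norm \<open>e * cj e\<close> from
  \<open>E\<close>, so \<open>inverse e * s\<close> squares to 1, and without zero divisors
  \<open>s\<close> is \<open>e\<close> or \<open>- e\<close>; but \<open>ss\<close> anticommutes
  with \<open>ii\<close>.\<close>

lemma N_ss_even: "N ss \<noteq> rho powi k"
proof
  assume Nss: "N ss = rho powi k"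
  define f where "f = vp powi (- k)"
  have fF: "f \<in> Fs" unfolding f_def by (rule Fs_closed(7)[OF vp_F])
  define s where "s = f * ss"
  have Ns: "N s = 1" using rho by (simp add: s_def f_def N_mult N_power_int N_vp Nss flip: power_int_add)
  have s0: "s \<noteq> 0" using Ns by auto
  have f0: "f \<noteq> 0" using s0 by (auto simp: s_def)
  have sE: "s * x = cj x * s" if "x \<in> Es" for x
    using ss_E_cj[OF that] Fs_central[OF fF, of "cj x"] by (simp add: s_def mult.assoc) (simp flip: mult.assoc)
  have "cj s = - s" using fF by (simp add: s_def cj_mult cj_ss Fs_cj Fs_central[OF fF])
  then have ssF: "s * s \<in> Fs" using Fs_closed(4)[OF norm_in[of s]] by simp
  obtain e where e: "e \<in> U" "e * cj e = s * s" using norm_unit_surjective[OF ssF] Ns by (auto simp: N_mult)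
  define x where "x = inverse e * s"
  have "x * x = inverse e * (s * inverse e) * s" by (simp add: x_def mult.assoc)
  also have "s * inverse e = inverse (cj e) * s"
    using sE[OF Es_closed(5)[OF U_E[OF e(1)]]] by (simp add: cj_inverse)
  also have "inverse e * (inverse (cj e) * s) * s = inverse (cj e * e) * (s * s)"
    using U_nonzero[OF e(1)] by (simp add: nonzero_inverse_mult_distrib mult.assoc)
  also have "\<dots> = 1" using e(2) s0 by (simp add: cj_commute[symmetric])
  finally have "(x - 1) * (x + 1) = 0" by (simp add: algebra_simps)
  then have "x = 1 \<or> x = - 1" by (auto simp: eq_neg_iff_add_eq_0)
  moreover have "s = e * x" using U_nonzero[OF e(1)] by (simp add: x_def flip: mult.assoc)
  ultimately have "s = e \<or> s = - e" by auto
  then have "s \<in> Es" using U_E[OF e(1)] Es_closed(4)[of e] by auto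
  then have "inverse f * s \<in> Es" by (rule Es_closed(3)[OF Fs_E[OF Fs_closed(5)[OF fF]]])
  then have "ss \<in> Es" using f0 by (simp add: s_def flip: mult.assoc)
  then have "ss * ii = ii * ss" using commutant by blast
  then have "ii * ss = - (ii * ss)" using ss_ii by simp
  then have "2 * (ii * ss) = 0" by (metis eq_neg_iff_add_eq_0 mult_2)
  then show False using two_nonzero by simp
qed

text \<open>The square of \<open>N ss\<close> is a power of \<open>rho\<close>, with odd exponent by
  \<open>N_ss_even\<close>; a power of \<open>vp\<close> reduces the exponent to 1.\<close>

lemma ex_uniformizer: "\<exists>f\<in>Fs. f \<noteq> 0 \<and> N (f * ss) ^ 2 = rho"
proof -
  have "ss * cj ss \<in> Es" "ss * cj ss \<noteq> 0" using Fs_E[OF norm_in] by auto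
  then obtain k where k: "N (ss * cj ss) = rho powi k" using E_valuation by blast
  then have Nss: "N ss * N ss = rho powi k" by (simp add: N_mult N_cj)
  have "odd k"
  proof
    assume "even k"
    then obtain l where l: "k = l + l" by (metis evenE mult_2)
    have "(N ss)\<^sup>2 = (rho powi l)\<^sup>2" using Nss unfolding power2_eq_square l rho_powi_add .
    then have "N ss = rho powi l" using rho by (simp add: power2_eq_iff_nonneg)
    then show False using N_ss_even by blast
  qed
  then obtain l where l: "k = l + l + 1" by (metis oddE mult_2)
  have "N (vp powi (- l) * ss) ^ 2 = rho powi (- l) * rho powi (- l) * (N ss * N ss)"
    by (simp add: N_mult N_power_int N_vp power2_eq_square)
  also have "\<dots> = rho powi (- l + - l + k)" unfolding Nss rho_powi_add ..
  also have "\<dots> = rho" by (simp add: l)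
  finally show ?thesis using Fs_closed(7)[OF vp_F] by (intro bexI[of _ "vp powi (- l)"]) auto
qed

definition ff :: 'b where "ff = (SOME f. f \<in> Fs \<and> f \<noteq> 0 \<and> N (f * ss) ^ 2 = rho)"
text \<open>Being an \<open>F\<close>-multiple of \<open>ss\<close>, this uniformizer still acts on
  \<open>E\<close> as the Galois conjugation; its norm is the square root of
  \<open>rho\<close>.\<close>

definition wB :: 'b where "wB = ff * ss"

lemma ff: "ff \<in> Fs" "ff \<noteq> 0" "N wB ^ 2 = rho"
  using someI_ex[of "\<lambda>f. f \<in> Fs \<and> f \<noteq> 0 \<and> N (f * ss) ^ 2 = rho"] ex_uniformizer
  by (auto simp: ff_def wB_def)

lemma wB_nonzero [simp]: "wB \<noteq> 0" by (simp add: wB_def ff)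
lemma N_wB: "0 < N wB" "N wB < 1" "N wB * N wB = rho" "rho < N wB"
proof -
  show 1: "0 < N wB" by (rule N_pos) simp
  show 3: "N wB * N wB = rho" using ff(3) by (simp add: power2_eq_square)
  show 2: "N wB < 1"
  proof (rule ccontr)
    assume "\<not> N wB < 1"
    then have "1 * 1 \<le> N wB * N wB" by (intro mult_mono) auto
    then show False using 3 rho by simp
  qed
  show "rho < N wB" using mult_strict_left_mono[OF 2 1] 3 by simp
qed

lemma cj_wB: "cj wB = - wB"
  using ff(1) by (simp add: wB_def cj_mult cj_ss Fs_cj Fs_central[OF ff(1)])

lemma wB_E: "x \<in> Es \<Longrightarrow> wB * x = cj x * wB"
  using ss_E_cj[of x] Fs_central[OF ff(1), of "cj x"] by (simp add: wB_def mult.assoc) (simp flip: mult.assoc)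

lemma N_wB_even: "N wB powi (2 * k) = rho powi k"
  using N_wB by (simp add: power_int_mult ff(3))

lemma wB_decompose: "\<exists>a\<in>Es. \<exists>b\<in>Es. x = a + b * wB"
proof -
  obtain e f where ef: "e \<in> Es" "f \<in> Es" "x = e + f * ss" using decompose by blast
  have "x = e + (f * inverse ff) * wB" using ef(3) ff(2) by (simp add: wB_def mult.assoc) (simp flip: mult.assoc)
  moreover have "f * inverse ff \<in> Es" by (rule Es_closed(3)[OF ef(2) Fs_E[OF Fs_closed(5)[OF ff(1)]]])
  ultimately show ?thesis using ef(1) by blast
qed

lemma rho_powi_inj: "rho powi k = rho powi l \<longleftrightarrow> k = l"
proof
  assume "rho powi k = rho powi l"
  then show "k = l"
    using rho power_int_strict_decreasing[of k l rho] power_int_strict_decreasing[of l k rho] by linarith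
qed simp

text \<open>Nonzero elements of \<open>E\<close> have norms \<open>rho powi k\<close>, those of
  \<open>E * wB\<close> half-integral exponents, so the two terms never have equal norm and cannot
  cancel.\<close>

lemma N_decomposed:
  assumes a: "a \<in> Es" and b: "b \<in> Es"
  shows "N (a + b * wB) = max (N a) (N b * N wB)"
proof (cases "a = 0 \<or> b = 0")
  case False
  then obtain k l where k: "N a = rho powi k" and l: "N b = rho powi l" using E_valuation a b by metis
  have "N a \<noteq> N b * N wB"
  proof
    assume "N a = N b * N wB"
    then have "rho powi k * rho powi k = rho powi l * rho powi l * rho"
      unfolding k l using N_wB(3) by simp
    then have "rho powi (k + k) = rho powi (l + l + 1)" by (simp only: rho_powi_add power_int_1_right)
    then have "k + k = l + l + 1" by (simp only: rho_powi_inj)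
    then show False by presburger
  qed
  then consider "N a < N (b * wB)" | "N (b * wB) < N a" by (fastforce simp: N_mult)
  then show ?thesis
  proof cases
    case 1
    then have "N (b * wB) = N (a + b * wB)" using N_close[of "b * wB" "a + b * wB"] by simp
    then show ?thesis using 1 by (simp add: N_mult)
  next
    case 2
    then have "N a = N (a + b * wB)" using N_close[of "a" "a + b * wB"] by simp
    then show ?thesis using 2 by (simp add: N_mult)
  qed
qed (auto simp: N_mult)

lemma rho_even: "N wB ^ (2 * n) = rho ^ n" by (simp add: power_mult ff(3))

lemma E_half_step:
  assumes "x \<in> Es" "N x \<le> N wB ^ (2 * n + 1)"
  shows "N x \<le> rho ^ Suc n"
proof (rule E_less_le_Suc[OF assms(1)])
  have "N wB ^ (2 * n + 1) = rho ^ n * N wB" by (simp add: rho_even)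
  also have "\<dots> < rho ^ n * 1" using N_wB rho by (intro mult_strict_left_mono) auto
  finally show "N x < rho ^ n" using assms(2) by simp
qed

text \<open>Even layers of the filtration are represented by \<open>E\<close>: a multiple
  \<open>b * wB\<close> of norm at most \<open>rho ^ n\<close> automatically lies one level deeper.
  \<open>odd_level\<close> is the counterpart for \<open>E * wB\<close>.\<close>

lemma even_level:
  assumes "N x \<le> N wB ^ (2 * n)"
  shows "\<exists>a\<in>Es. N a \<le> rho ^ n \<and> N (x - a) \<le> N wB ^ (2 * n + 1)"
proof -
  obtain a b where ab: "a \<in> Es" "b \<in> Es" "x = a + b * wB" using wB_decompose by blast
  then have N: "N a \<le> rho ^ n" "N b * N wB \<le> rho ^ n" using assms by (auto simp: N_decomposed rho_even)
  have "N b \<le> rho ^ n"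
  proof (rule ccontr)
    assume "\<not> N b \<le> rho ^ n"
    then have nb: "rho ^ n < N b" by simp
    show False
    proof -
      define y where "y = b * inverse (vp ^ n)"
      have yE: "y \<in> Es" unfolding y_def
        by (rule Es_closed(3)[OF ab(2) Fs_E[OF Fs_closed(5)[OF Fs_closed(6)[OF vp_F]]]])
      have Ny: "N y = N b / rho ^ n" by (simp add: y_def N_mult N_inverse N_power N_vp divide_inverse)
      have Nb: "0 < N b" using less_trans[OF zero_less_power[OF rho(1)] nb] .
      have "N (inverse y) < 1" unfolding N_inverse Ny inverse_divide using nb Nb by (simp add: divide_less_eq)
      then have "N (inverse y) \<le> rho" by (rule E_less_1[OF Es_closed(5)[OF yE]])
      moreover have "N wB \<le> N (inverse y)"
        unfolding N_inverse Ny inverse_divide using N(2) Nb by (simp add: le_divide_eq mult.commute)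
      ultimately show False using N_wB(4) by simp
    qed
  qed
  then have "N (b * wB) \<le> N wB ^ (2 * n + 1)"
  proof -
    have eq: "N wB ^ (2 * n + 1) = rho ^ n * N wB" by (simp add: rho_even)
    show ?thesis unfolding N_mult eq by (rule mult_right_mono) (use \<open>N b \<le> rho ^ n\<close> in simp_all)
  qed
  then show ?thesis using ab N(1) by (intro bexI[of _ a]) auto
qed

lemma odd_level:
  assumes "N x \<le> N wB ^ (2 * n + 1)"
  shows "\<exists>b\<in>Es. N b \<le> rho ^ n \<and> N (x - b * wB) \<le> N wB ^ (2 * n + 2)"
proof -
  obtain a b where ab: "a \<in> Es" "b \<in> Es" "x = a + b * wB" using wB_decompose by blast
  then have N: "N a \<le> N wB ^ (2 * n + 1)" "N b * N wB \<le> N wB ^ (2 * n + 1)" using assms by (auto simp: N_decomposed)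
  have "N a \<le> rho ^ Suc n" by (rule E_half_step[OF ab(1) N(1)])
  then have "N a \<le> N wB ^ (2 * n + 2)" using rho_even[of "Suc n"] by simp
  moreover have "N b \<le> rho ^ n" using N(2) N_wB by (simp add: rho_even)
  ultimately show ?thesis using ab by (intro bexI[of _ b]) auto
qed

lemma uniformizer:
  assumes "N x < 1"
  shows "N x \<le> N wB"
proof -
  obtain a where a: "a \<in> Es" "N a \<le> 1" "N (x - a) \<le> N wB" using even_level[of x 0] assms by auto
  have "N a < 1"
  proof -
    have "a = x - (x - a)" by simp
    then show ?thesis using N_diff_less[of x 1 "x - a"] assms a(3) N_wB by simp
  qed
  then have "N a \<le> rho" by (rule E_less_1[OF a(1)])
  then have "N a \<le> N wB" using N_wB by simp
  then show ?thesis using N_add_le[of a "N wB" "x - a"] a(3) by simp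
qed

sublocale OBv: discrete_valuation N wB
  using N_wB uniformizer N_add by unfold_locales (auto simp: N_mult)

definition oE :: "'e set" where "oE = {y. N (emb y) \<le> 1}"

text \<open>Stating membership in \<open>U\<close> separately makes one formula serve level 0 as
  well, where the inequality holds for every unit.\<close>

lemma oF_units: "higher_units oF m = {f. jB f \<in> U \<and> N (jB f - 1) \<le> rho ^ m}"
proof (cases "m = 0")
  case True
  have "N (jB f - 1) \<le> 1" if "N (jB f) = 1" for f using that by (intro N_diff_le) auto
  then show ?thesis using True OF.higher_units_0 by (auto simp: oF_def U_def jB_in_E)
next
  case False
  have "N (jB f) = 1" if "N (jB f - 1) \<le> rho ^ m" for f
    using N_close[of 1 "jB f"] that rho False power_less_one_iff[of rho m] by (simp add: N_commute)
  then show ?thesis using False OF.higher_units_pos[of m] by (auto simp: oF_def U_def jB_in_E rho_def)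
qed

lemma oE_units: "higher_units oE m = {y. emb y \<in> U \<and> N (emb y - 1) \<le> rho ^ m}"
proof (cases "m = 0")
  case True
  have "N (emb f - 1) \<le> 1" if "N (emb f) = 1" for f using that by (intro N_diff_le) auto
  then show ?thesis using True OE.higher_units_0 by (auto simp: oE_def U_def)
next
  case False
  have "N (emb f) = 1" if "N (emb f - 1) \<le> rho ^ m" for f
    using N_close[of 1 "emb f"] that rho False power_less_one_iff[of rho m] by (simp add: N_commute)
  then show ?thesis using False OE.higher_units_pos[of m] by (auto simp: oE_def U_def N_emb_jE_pF)
qed

lemma rho_power_le: "m \<le> n \<Longrightarrow> rho ^ n \<le> rho ^ m" using rho by (intro power_decreasing) auto

lemma oF_units_mono: "m \<le> n \<Longrightarrow> higher_units oF n \<subseteq> higher_units oF m"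
  using rho_power_le by (fastforce simp: oF_units)

lemma oE_units_mono: "m \<le> n \<Longrightarrow> higher_units oE n \<subseteq> higher_units oE m"
  using rho_power_le by (fastforce simp: oE_units)

text \<open>By Hilbert 90, \<open>x = y * (cj y)\<^sup>-\<^sup>1\<close>, and \<open>cj y\<close> is a conjugate of \<open>y\<close> by the Skolem--Noether theorem.\<close>
lemma norm_1_commutator:
  assumes "x * cj x = 1"
  shows "x = 1 \<or> (\<exists>y s. y \<noteq> 0 \<and> s \<noteq> 0 \<and> x = y * s * inverse y * inverse s)"
proof -
  have "\<exists>y. y \<noteq> 0 \<and> x * cj y = y"
  proof (cases "x = - 1")
    case True
    then show ?thesis using dd by (intro exI[of _ dd]) auto
  next
    case False
    then have "1 + x \<noteq> 0" by (simp add: add_eq_0_iff)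
    moreover have "x * cj (1 + x) = 1 + x" using assms by (simp add: cj_add distrib_left add.commute)
    ultimately show ?thesis by blast
  qed
  then obtain y where y: "y \<noteq> 0" "x * cj y = y" by blast
  show ?thesis
  proof (cases "y \<in> range jB")
    case True
    then have "x * y = 1 * y" using y(2) by (simp add: Fs_cj)
    then show ?thesis using y(1) by (simp only: mult_cancel_right) simp
  next
    case False
    then obtain s where s: "s \<noteq> 0" "s * y = cj y * s" using skolem_noether by blast
    then have cy: "cj y = s * y * inverse s" by (simp add: mult.assoc)
    have "inverse (cj y) = s * inverse y * inverse s"
      using s(1) y(1) by (simp add: cy nonzero_inverse_mult_distrib mult.assoc)
    moreover have "x = y * inverse (cj y)"
    proof -
      have "x = x * cj y * inverse (cj y)" using y(1) by (simp add: mult.assoc)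
      then show ?thesis using y(2) by simp
    qed
    ultimately have "x = y * s * inverse y * inverse s" by (simp add: mult.assoc)
    then show ?thesis using y(1) s(1) by blast
  qed
qed

lemma norm_mult: "x * y * cj (x * y) = (x * cj x) * (y * cj y)"
proof -
  have "x * y * cj (x * y) = x * (y * cj y) * cj x" by (simp add: cj_mult mult.assoc)
  also have "x * (y * cj y) = (y * cj y) * x" by (rule Fs_central[OF norm_in, symmetric])
  also have "(y * cj y) * x * cj x = (x * cj x) * (y * cj y)"
    using Fs_central[OF norm_in[of y], of "x * cj x"] by (simp add: mult.assoc)
  finally show ?thesis .
qed

text \<open>\<open>wB\<close> has reduced norm of absolute value \<open>rho\<close>, so powers of
  \<open>vp\<close> and one factor \<open>wB\<close> reach every value; what remains is a unit,
  which is a norm from \<open>E\<close>.\<close>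

lemma norm_surjective:
  assumes f: "f \<in> Fs" "f \<noteq> 0"
  shows "\<exists>x. x \<noteq> 0 \<and> x * cj x = f"
proof -
  obtain k where k: "N f = rho powi k" using E_valuation[OF Fs_E[OF f(1)] f(2)] by blast
  define l where "l = k div 2"
  define h where "h = (if even k then 1 else wB)"
  define y where "y = vp powi l * h"
  have kl: "k = l + l + (if even k then 0 else 1)" unfolding l_def by presburger
  have y0: "y \<noteq> 0" by (simp add: y_def h_def)
  have Nh: "N h * N h = rho powi (if even k then 0 else 1)" using N_wB(3) by (simp add: h_def)
  have "N (y * cj y) = rho powi l * rho powi l * (N h * N h)"
    by (simp add: y_def N_mult N_cj N_power_int N_vp)
  also have "\<dots> = rho powi k" unfolding Nh rho_powi_add[symmetric] using kl by simp
  finally have Ny: "N (y * cj y) = N f" using k by simp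
  define g where "g = f * inverse (y * cj y)"
  have "g \<in> Fs" unfolding g_def by (intro Fs_closed(3,5) f(1) norm_in)
  moreover have "N g = 1" using Ny f(2) by (simp add: g_def N_inverse N_mult[of f])
  ultimately obtain e where e: "e \<in> U" "e * cj e = g" using norm_unit_surjective by blast
  have "e * y * cj (e * y) = g * (y * cj y)" by (simp add: norm_mult e(2))
  also have "\<dots> = f" using y0 by (simp add: g_def mult.assoc)
  finally show ?thesis using y0 U_nonzero[OF e(1)] by (intro exI[of _ "e * y"]) simp
qed

lemma max_ideal_power: "ideal_power OB (max_ideal OB) n = {x. N x \<le> N wB ^ n}"
  using OBv.ideal_power_R[of n] by (simp add: OB_def)

lemma order_s_eq: "order_s oE OB emb (2 * r + 1) = {emb a + x | a x. N (emb a) \<le> 1 \<and> N x \<le> N wB ^ (2 * r)}"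
  by (simp add: order_s_def max_ideal_power oE_def)

end

section \<open>Representations of the quaternion algebra\<close>

text \<open>A nonzero polynomial \<open>p\<close> of least degree with \<open>p(T) w = 0\<close> has
  a complex root \<open>c\<close>, and the cofactor of its linear factor sends \<open>w\<close> to
  an eigenvector. Starting from a vector of \<open>W\<close> keeps everything inside this invariant
  subspace.\<close>

lemma ex_eigenvector:
  fixes smul :: "complex \<Rightarrow> 'v::ab_group_add \<Rightarrow> 'v"
  assumes fd: "finite_dimensional_vector_space smul Bv"
    and T: "\<And>u v. T (u + v) = T u + T v" "\<And>c v. T (smul c v) = smul c (T v)"
    and W: "module.subspace smul W" "\<And>v. v \<in> W \<Longrightarrow> T v \<in> W"
    and w: "w \<in> W" "w \<noteq> 0"
  shows "\<exists>v c. v \<in> W \<and> v \<noteq> 0 \<and> T v = smul c v"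
proof -
  interpret X: finite_dimensional_vector_space smul Bv by (rule fd)
  define f where "f i = (T ^^ i) w" for i
  have T0: "T 0 = 0" using T(2)[of 0 0] by simp
  have T_sum: "T (sum g A) = (\<Sum>a\<in>A. T (g a))" for g and A :: "nat set"
    by (induction A rule: infinite_finite_induct) (auto simp: T0 T)
  have fW: "f i \<in> W" for i unfolding f_def by (induction i) (auto simp: w W(2))
  have f_Suc: "f (Suc i) = T (f i)" for i by (simp add: f_def)
  \<comment> \<open>\<open>ev p\<close> stands for \<open>p(T) w\<close>.\<close>
  define ev where "ev p = (\<Sum>i\<le>degree p. smul (coeff p i) (f i))" for p
  have ev_eq: "ev p = (\<Sum>i<n. smul (coeff p i) (f i))" if "degree p < n" for p n
    unfolding ev_def using that by (intro sum.mono_neutral_left) (auto simp: coeff_eq_0)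
  have evW: "ev p \<in> W" for p
    unfolding ev_def by (intro X.subspace_sum W X.subspace_scale fW)
  have ev_linear_factor: "ev ([:- c, 1:] * q) = T (ev q) - smul c (ev q)" for c q
  proof -
    define n where "n = Suc (degree q)"
    have "degree ([:- c, 1:] * q) < Suc n"
      using degree_mult_le[of "[:- c, 1:]" q] by (simp add: n_def)
    then have "ev ([:- c, 1:] * q) = (\<Sum>i<Suc n. smul (coeff ([:- c, 1:] * q) i) (f i))" by (rule ev_eq)
    also have "\<dots> = (\<Sum>i<Suc n. smul (coeff (pCons 0 q) i) (f i) - smul c (smul (coeff q i) (f i)))"
      by (intro sum.cong refl) (simp add: X.scale_left_diff_distrib algebra_simps)
    also have "\<dots> = (\<Sum>i<Suc n. smul (coeff (pCons 0 q) i) (f i)) - smul c (\<Sum>i<Suc n. smul (coeff q i) (f i))"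
      by (simp only: sum_subtractf X.scale_sum_right)
    also have "(\<Sum>i<Suc n. smul (coeff q i) (f i)) = ev q" by (rule ev_eq[symmetric]) (simp add: n_def)
    also have "(\<Sum>i<Suc n. smul (coeff (pCons 0 q) i) (f i)) = (\<Sum>i<n. smul (coeff q i) (T (f i)))"
      by (subst sum.lessThan_Suc_shift) (simp add: f_Suc)
    also have "\<dots> = T (\<Sum>i<n. smul (coeff q i) (f i))" by (simp only: T_sum T(2))
    also have "(\<Sum>i<n. smul (coeff q i) (f i)) = ev q" by (rule ev_eq[symmetric]) (simp add: n_def)
    finally show ?thesis .
  qed
  have "\<exists>n. f n \<in> X.span (f ` {..<n})"
  proof (rule ccontr)
    assume neg: "\<not> ?thesis"
    have "X.independent (f ` {..<n}) \<and> card (f ` {..<n}) = n" for n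
    proof (induction n)
      case (Suc n)
      have nin: "f n \<notin> X.span (f ` {..<n})" using neg by blast
      have "f n \<notin> f ` {..<n}"
      proof
        assume "f n \<in> f ` {..<n}"
        then have "f n \<in> X.span (f ` {..<n})" by (rule X.span_base)
        with nin show False ..
      qed
      then show ?case using Suc nin by (simp add: lessThan_Suc X.independent_insert)
    qed (simp add: X.independent_empty)
    from this[of "Suc (card Bv)"] show False
      using X.independent_span_bound[OF X.finite_Basis, of "f ` {..<Suc (card Bv)}"] by (simp add: X.span_Basis)
  qed
  \<comment> \<open>Before the first linear dependence the iterates are distinct, so the dependence
    can be indexed by exponents and becomes a monic polynomial of degree \<open>n\<close>.\<close>
  define n where "n = (LEAST n. f n \<in> X.span (f ` {..<n}))"
  have n: "f n \<in> X.span (f ` {..<n})" unfolding n_def by (rule LeastI_ex) fact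
  have less: "f i \<notin> X.span (f ` {..<i})" if "i < n" for i using not_less_Least that unfolding n_def by blast
  have "inj_on f {..<n}"
  proof (rule linorder_inj_onI)
    fix i k assume ik: "i < k" "i \<in> {..<n}" "k \<in> {..<n}"
    then have "f i \<in> X.span (f ` {..<k})" by (intro X.span_base) auto
    then show "f i \<noteq> f k" using less[of k] ik by auto
  qed auto
  moreover obtain u where "f n = (\<Sum>v\<in>f ` {..<n}. smul (u v) v)"
    using n X.span_finite[of "f ` {..<n}"] by auto
  ultimately have u: "f n = (\<Sum>i<n. smul (u (f i)) (f i))" by (simp add: sum.reindex)
  define p where "p = monom 1 n - (\<Sum>i<n. monom (u (f i)) i)"
  have cp: "coeff p i = (if i = n then 1 else 0) - (if i < n then u (f i) else 0)" for i
    by (auto simp: p_def coeff_sum)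
  have "p \<noteq> 0" using cp[of n] by auto
  moreover have "ev p = 0"
  proof -
    have "degree p < Suc n" using cp by (simp add: less_Suc_eq_le) (intro degree_le, auto)
    from ev_eq[OF this] show ?thesis by (simp add: cp u X.scale_minus_left sum_negf)
  qed
  ultimately have ex: "\<exists>p. p \<noteq> 0 \<and> ev p = 0" by blast
  define m where "m = (LEAST m. \<exists>p. p \<noteq> 0 \<and> ev p = 0 \<and> degree p = m)"
  have "\<exists>p. p \<noteq> 0 \<and> ev p = 0 \<and> degree p = m"
    unfolding m_def by (rule LeastI_ex) (use ex in blast)
  then obtain q where q: "q \<noteq> 0" "ev q = 0" "degree q = m" by blast
  have "degree q \<noteq> 0"
  proof
    assume d: "degree q = 0"
    then have "ev q = smul (coeff q 0) w" by (simp add: ev_def f_def)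
    then show False using q w d by (metis X.scale_eq_0_iff leading_coeff_0_iff)
  qed
  then obtain c where c: "poly q c = 0" using fundamental_theorem_of_algebra constant_degree by metis
  then obtain s where s: "q = [:- c, 1:] * s" by (auto simp: poly_eq_0_iff_dvd elim: dvdE)
  have "s \<noteq> 0" using q(1) s by auto
  then have "degree q = degree [:- c, 1:] + degree s" unfolding s by (intro degree_mult_eq) auto
  then have "degree s < m" using q(3) by simp
  then have "ev s \<noteq> 0" using not_less_Least[of "degree s" "\<lambda>m. \<exists>p. p \<noteq> 0 \<and> ev p = 0 \<and> degree p = m"] \<open>s \<noteq> 0\<close>
    by (auto simp: m_def)
  moreover have "T (ev s) = smul c (ev s)" using q(2) s ev_linear_factor by simp
  ultimately show ?thesis using evW by blast
qed

locale quaternion_rep = local_quaternion p nrm j Bs jE jB emb jF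
  for p :: nat and nrm :: "'k::field_char_0 \<Rightarrow> real" and j :: "'k \<Rightarrow> 'b::division_ring" and Bs
    and jE :: "'f::field \<Rightarrow> 'e::field" and jB :: "'f \<Rightarrow> 'b" and emb :: "'e \<Rightarrow> 'b" and jF :: "'k \<Rightarrow> 'f" +
  fixes smul :: "complex \<Rightarrow> 'v::ab_group_add \<Rightarrow> 'v" and \<pi> :: "'b \<Rightarrow> 'v \<Rightarrow> 'v" and \<omega> :: "'f \<Rightarrow> complex"
  assumes irrep: "smooth_irrep OB smul \<pi>"
    and central: "has_central_character jB smul \<pi> \<omega>"
begin

sublocale X: vector_space smul using irrep by (simp add: smooth_irrep_def)

lemma pi_linear: "g \<noteq> 0 \<Longrightarrow> Vector_Spaces.linear smul smul (\<pi> g)"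
  using irrep by (simp add: smooth_irrep_def)

lemma pi_add: "g \<noteq> 0 \<Longrightarrow> \<pi> g (u + v) = \<pi> g u + \<pi> g v"
  and pi_scale: "g \<noteq> 0 \<Longrightarrow> \<pi> g (smul c v) = smul c (\<pi> g v)"
  and pi_0: "g \<noteq> 0 \<Longrightarrow> \<pi> g 0 = 0"
  and pi_sum: "g \<noteq> 0 \<Longrightarrow> \<pi> g (sum f A) = (\<Sum>a\<in>A. \<pi> g (f a))"
proof -
  assume "g \<noteq> 0"
  then interpret L: Vector_Spaces.linear smul smul "\<pi> g" by (rule pi_linear)
  show "\<pi> g (u + v) = \<pi> g u + \<pi> g v" by (rule L.add)
  show "\<pi> g (smul c v) = smul c (\<pi> g v)" by (rule L.scale)
  show "\<pi> g 0 = 0" by (rule L.zero)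
  show "\<pi> g (sum f A) = (\<Sum>a\<in>A. \<pi> g (f a))" by (rule L.sum)
qed

lemma pi_1 [simp]: "\<pi> 1 v = v" using irrep by (simp add: smooth_irrep_def)
lemma pi_mult: "g \<noteq> 0 \<Longrightarrow> h \<noteq> 0 \<Longrightarrow> \<pi> (g * h) v = \<pi> g (\<pi> h v)"
proof -
  have "\<forall>g h. g \<noteq> 0 \<and> h \<noteq> 0 \<longrightarrow> \<pi> (g * h) = \<pi> g \<circ> \<pi> h" using irrep unfolding smooth_irrep_def by blast
  then show "g \<noteq> 0 \<Longrightarrow> h \<noteq> 0 \<Longrightarrow> \<pi> (g * h) v = \<pi> g (\<pi> h v)" by simp
qed
lemma pi_inverse: "g \<noteq> 0 \<Longrightarrow> \<pi> (inverse g) (\<pi> g v) = v" "g \<noteq> 0 \<Longrightarrow> \<pi> g (\<pi> (inverse g) v) = v"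
  by (simp_all flip: pi_mult)

lemma pi_smooth: "openin (subtopology (adic_topology OB) (- {0})) {g. g \<noteq> 0 \<and> \<pi> g v = v}"
  using irrep unfolding smooth_irrep_def by blast
lemma ex_nonzero: "\<exists>v::'v. v \<noteq> 0" using irrep unfolding smooth_irrep_def by blast
lemma pi_irreducible: "X.subspace W \<Longrightarrow> (\<And>g. g \<noteq> 0 \<Longrightarrow> \<pi> g ` W \<subseteq> W) \<Longrightarrow> W = {0} \<or> W = UNIV"
  using irrep unfolding smooth_irrep_def by blast
lemma pi_central: "z \<noteq> 0 \<Longrightarrow> \<pi> (jB z) v = smul (\<omega> z) v"
  using central by (simp add: has_central_character_def)

abbreviation UU where "UU \<equiv> higher_units OB"

lemma OB_R: "OB = OBv.R" by (simp add: OB_def)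

lemma UU_0: "UU 0 = {x. N x = 1}" unfolding OB_R by (rule OBv.higher_units_0)
lemma UU_pos: "0 < n \<Longrightarrow> UU n = {x. N (x - 1) \<le> N wB ^ n}" unfolding OB_R by (rule OBv.higher_units_pos)

lemma wB_pow_less: "0 < n \<Longrightarrow> N wB ^ n < 1" using N_wB by (simp add: power_less_one_iff)
lemma wB_pow_le: "m \<le> n \<Longrightarrow> N wB ^ n \<le> N wB ^ m" using N_wB by (intro power_decreasing) auto

lemma near_1: "N (x - 1) < 1 \<Longrightarrow> N x = 1" using N_close[of 1 x] by (simp add: N_commute)

lemma UU_N: "x \<in> UU n \<Longrightarrow> N x = 1"
  by (cases "n = 0") (use UU_0 UU_pos near_1 wB_pow_less[of n] in \<open>auto intro: le_less_trans\<close>)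

lemma UU_nonzero: "x \<in> UU n \<Longrightarrow> x \<noteq> 0" using UU_N by fastforce

lemma UU_mono: "m \<le> n \<Longrightarrow> UU n \<subseteq> UU m"
proof
  fix x assume "m \<le> n" "x \<in> UU n"
  then show "x \<in> UU m"
    using UU_N[of x n] wB_pow_le[of m n] by (cases "m = 0") (auto simp: UU_0 UU_pos)
qed

lemma UU_1: "1 \<in> UU n" by (cases "n = 0") (auto simp: UU_0 UU_pos)

lemma UU_mult: "x \<in> UU n \<Longrightarrow> y \<in> UU n \<Longrightarrow> x * y \<in> UU n"
proof (cases "n = 0")
  case False
  assume xy: "x \<in> UU n" "y \<in> UU n"
  have "x * y - 1 = x * (y - 1) + (x - 1)" by (simp add: algebra_simps)
  moreover have "N (x * (y - 1)) \<le> N wB ^ n" using xy UU_N[OF xy(1)] False by (simp add: N_mult UU_pos)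
  moreover have "N (x - 1) \<le> N wB ^ n" using xy False by (simp add: UU_pos)
  ultimately have "N (x * y - 1) \<le> N wB ^ n" by (simp only: N_add_le)
  then show ?thesis using False by (simp add: UU_pos)
qed (auto simp: UU_0 N_mult)

lemma UU_inverse: "x \<in> UU n \<Longrightarrow> inverse x \<in> UU n"
proof (cases "n = 0")
  case False
  assume x: "x \<in> UU n"
  have "inverse x - 1 = inverse x * (1 - x)" using UU_nonzero[OF x] by (simp add: right_diff_distrib)
  then have "N (inverse x - 1) = N (x - 1)" using UU_N[OF x] by (simp add: N_mult N_inverse N_commute)
  then show ?thesis using x False by (simp add: UU_pos)
qed (auto simp: UU_0 N_inverse)

lemma UU_conj: "x \<in> UU n \<Longrightarrow> g \<noteq> 0 \<Longrightarrow> g * x * inverse g \<in> UU n"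
proof (cases "n = 0")
  case False
  assume x: "x \<in> UU n" and g: "g \<noteq> 0"
  have "g * x * inverse g - 1 = g * (x - 1) * inverse g" using g by (simp add: algebra_simps)
  then have "N (g * x * inverse g - 1) = N (x - 1)" by (simp only: N_conj[OF g])
  then show ?thesis using x False by (simp add: UU_pos)
qed (auto simp: UU_0 N_conj)

lemma UU_quotient: "N x = 1 \<Longrightarrow> N (x - y) \<le> N wB ^ n \<Longrightarrow> 0 < n \<Longrightarrow> inverse x * y \<in> UU n"
proof -
  assume x: "N x = 1" "N (x - y) \<le> N wB ^ n" "0 < n"
  then have "x \<noteq> 0" by auto
  then have "inverse x * y - 1 = inverse x * (y - x)" by (simp add: right_diff_distrib)
  then have "N (inverse x * y - 1) \<le> N wB ^ n" using x by (simp add: N_mult N_inverse N_commute)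
  then show ?thesis using x(3) by (simp add: UU_pos)
qed

section \<open>Vectors fixed by the unit filtration, and the conductor\<close>

definition Vfix :: "nat \<Rightarrow> 'v set" where "Vfix n = {v. \<forall>g\<in>UU n. \<pi> g v = v}"

text \<open>\<open>UU n\<close> is normal in the multiplicative group, so its fixed vectors form an
  invariant subspace.\<close>

lemma Vfix_dichotomy: "Vfix n = {0} \<or> Vfix n = UNIV"
proof (rule pi_irreducible)
  show "X.subspace (Vfix n)"
    by (rule X.subspaceI) (auto simp: Vfix_def pi_0 pi_add pi_scale UU_nonzero)
  fix g :: 'b assume g: "g \<noteq> 0"
  show "\<pi> g ` Vfix n \<subseteq> Vfix n"
  proof
    fix u assume "u \<in> \<pi> g ` Vfix n"
    then obtain v where v: "v \<in> Vfix n" "u = \<pi> g v" by blast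
    have "\<pi> x u = u" if x: "x \<in> UU n" for x
    proof -
      define y where "y = inverse g * x * g"
      have y: "y \<in> UU n" using UU_conj[OF x, of "inverse g"] g by (simp add: y_def)
      have xg: "x * g = g * y" using g by (simp add: y_def flip: mult.assoc)
      have "\<pi> x u = \<pi> (x * g) v" using v x g by (simp add: pi_mult UU_nonzero)
      also have "\<dots> = \<pi> g (\<pi> y v)" using g UU_nonzero[OF y] by (simp add: xg pi_mult)
      also have "\<pi> y v = v" using v(1) y by (simp add: Vfix_def)
      finally show ?thesis by (simp add: v(2))
    qed
    then show "u \<in> Vfix n" by (simp add: Vfix_def)
  qed
qed

text \<open>By the dichotomy, smoothness of one nonzero vector is enough. The step from
  \<open>n\<close> to \<open>Suc n\<close> avoids level 0, where membership is not a distance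
  condition.\<close>

lemma ex_trivial_level: "\<exists>n\<ge>1. Vfix (n - 1) = UNIV"
proof -
  obtain v :: 'v where v: "v \<noteq> 0" using ex_nonzero by blast
  obtain T where T: "openin (adic_topology OB) T" "{g. g \<noteq> 0 \<and> \<pi> g v = v} = T \<inter> - {0}"
    using pi_smooth[of v] by (auto simp: openin_subtopology)
  have "1 \<in> {g. g \<noteq> 0 \<and> \<pi> g v = v}" by simp
  then have "1 \<in> T" using T(2) by blast
  then obtain n where n: "\<And>y. N (y - 1) \<le> N wB ^ n \<Longrightarrow> y \<in> T"
    using OBv.openin_adicD[of T 1] T(1) unfolding OB_R by blast
  have "\<pi> g v = v" if g: "g \<in> UU (Suc n)" for g
  proof -
    have "N (g - 1) \<le> N wB ^ n" using g wB_pow_le[of n "Suc n"] by (simp add: UU_pos)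
    then have "g \<in> T \<inter> - {0}" using n UU_nonzero[OF g] by auto
    then show ?thesis using T(2) by blast
  qed
  then have "v \<in> Vfix (Suc n)" by (simp add: Vfix_def)
  then have "Vfix (Suc n) = UNIV" using Vfix_dichotomy[of "Suc n"] v by auto
  then show ?thesis by (intro exI[of _ "Suc (Suc n)"]) simp
qed

definition cc :: nat where "cc = rep_conductor OB \<pi>"

lemma cc: "1 \<le> cc" "Vfix (cc - 1) = UNIV"
proof -
  have eq: "cc = (LEAST n. 1 \<le> n \<and> Vfix (n - 1) = UNIV)"
    unfolding cc_def rep_conductor_def Vfix_def by (rule arg_cong[of _ _ Least], rule ext) (auto simp: set_eq_iff)
  have "1 \<le> cc \<and> Vfix (cc - 1) = UNIV"
    unfolding eq by (rule LeastI_ex) (use ex_trivial_level in blast)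
  then show "1 \<le> cc" "Vfix (cc - 1) = UNIV" by auto
qed

lemma pi_trivial: "g \<in> UU n \<Longrightarrow> cc \<le> Suc n \<Longrightarrow> \<pi> g v = v"
proof -
  assume g: "g \<in> UU n" and n: "cc \<le> Suc n"
  have "UU n \<subseteq> UU (cc - 1)" using n by (intro UU_mono) simp
  moreover have "v \<in> Vfix (cc - 1)" using cc(2) by simp
  ultimately show ?thesis using g unfolding Vfix_def by blast
qed

lemma Vfix_small: "Suc n < cc \<Longrightarrow> Vfix n = {0}"
proof -
  assume n: "Suc n < cc"
  have "Vfix n \<noteq> UNIV"
  proof
    assume "Vfix n = UNIV"
    then have "rep_conductor OB \<pi> \<le> Suc n"
      unfolding rep_conductor_def by (intro Least_le) (auto simp: Vfix_def)
    then show False using n by (simp add: cc_def)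
  qed
  then show ?thesis using Vfix_dichotomy by blast
qed

lemma conductor_le: "v \<in> Vfix n \<Longrightarrow> v \<noteq> 0 \<Longrightarrow> cc \<le> Suc n"
  using Vfix_small[of n] by (cases "Suc n < cc") auto

lemma pi_eqI: "N x = 1 \<Longrightarrow> N (x - y) \<le> N wB ^ n \<Longrightarrow> 0 < n \<Longrightarrow> cc \<le> Suc n \<Longrightarrow> \<pi> x v = \<pi> y v"
proof -
  assume x: "N x = 1" "N (x - y) \<le> N wB ^ n" "0 < n" "cc \<le> Suc n"
  have q: "inverse x * y \<in> UU n" using x by (intro UU_quotient)
  have x0: "x \<noteq> 0" using x(1) by auto
  have "y = x * (inverse x * y)" using x0 by (simp flip: mult.assoc)
  then have "\<pi> y v = \<pi> x (\<pi> (inverse x * y) v)" using x0 UU_nonzero[OF q] pi_mult by metis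
  then show ?thesis using pi_trivial[OF q x(4)] by simp
qed

text \<open>On units \<open>\<pi>\<close> depends only on the class modulo \<open>UU cc\<close>;
  hence sums over finite sets of operators can replace integrals over compact groups.\<close>

lemma finite_unit_image: "A \<subseteq> {x. N x = 1} \<Longrightarrow> finite (\<pi> ` A)"
proof (rule finite_image_of_locally_constant)
  show "0 < N wB ^ cc" using N_wB by simp
  show "\<pi> x = \<pi> y" if "A \<subseteq> {x. N x = 1}" "x \<in> A" "y \<in> A" "N (x - y) < N wB ^ cc" for x y
    using that cc(1) by (intro ext pi_eqI[of x y cc]) auto
qed auto

text \<open>Powers of the central \<open>vp\<close> account for the even valuations, which leaves
  \<open>1\<close> and \<open>wB\<close> as representatives: the multiplicative group is compact
  modulo its centre.\<close>

lemma B_decompose: "x \<noteq> 0 \<Longrightarrow> \<exists>f\<in>Fs. \<exists>h\<in>{1, wB}. \<exists>u. f \<noteq> 0 \<and> N u = 1 \<and> x = f * h * u"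
proof -
  assume x: "x \<noteq> 0"
  obtain k where k: "N x = N wB powi k" using OBv.valuation[OF x] by blast
  define l where "l = k div 2"
  define h where "h = (if even k then 1 else wB)"
  define f where "f = vp powi l"
  have f: "f \<in> Fs" "f \<noteq> 0" using Fs_closed(7)[OF vp_F] by (auto simp: f_def)
  have h0: "h \<noteq> 0" by (simp add: h_def)
  define u where "u = inverse h * (inverse f * x)"
  have xu: "x = f * h * u"
  proof -
    have "f * h * u = f * (h * inverse h) * (inverse f * x)" by (simp only: u_def mult.assoc)
    also have "\<dots> = f * inverse f * x" using h0 by (simp add: mult.assoc)
    finally show ?thesis using f(2) by simp
  qed
  have kl: "k = 2 * l + (if even k then 0 else 1)" unfolding l_def by presburger
  have "N wB powi k = N wB powi (2 * l) * N wB powi (if even k then 0 else 1)"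
    using N_wB by (subst kl) (rule power_int_add, simp)
  also have "\<dots> = N f * N h" by (simp add: N_wB_even f_def N_power_int N_vp h_def)
  finally have "N f * N h * N u = N f * N h" using k by (metis xu N_mult)
  then have "N u = 1" using f(2) h0 by simp
  then show ?thesis using f xu by (intro bexI[of _ f] bexI[of _ h] exI[of _ u]) (auto simp: h_def)
qed

lemma span_orbit:
  assumes "v \<noteq> 0"
  shows "X.span {\<pi> g v | g. g \<noteq> 0} = UNIV"
proof -
  have "\<pi> h ` X.span {\<pi> g v | g. g \<noteq> 0} \<subseteq> X.span {\<pi> g v | g. g \<noteq> 0}" if h: "h \<noteq> 0" for h
  proof
    fix u assume "u \<in> \<pi> h ` X.span {\<pi> g v | g. g \<noteq> 0}"
    then obtain t where t: "t \<in> X.span {\<pi> g v | g. g \<noteq> 0}" "u = \<pi> h t" by blast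
    from t(1) have "\<pi> h t \<in> X.span {\<pi> g v | g. g \<noteq> 0}"
    proof (induction rule: X.span_induct_alt)
      case base
      then show ?case by (simp add: pi_0 h X.span_zero)
    next
      case (step c x y)
      then obtain g where g: "g \<noteq> 0" "x = \<pi> g v" by blast
      have "\<pi> (h * g) v \<in> X.span {\<pi> g v | g. g \<noteq> 0}" using g h by (intro X.span_base) (auto intro!: exI[of _ "h * g"])
      then have "\<pi> h x \<in> X.span {\<pi> g v | g. g \<noteq> 0}" using g h by (simp add: pi_mult)
      then show ?case using step h by (simp add: pi_add pi_scale X.span_add X.span_scale)
    qed
    then show "u \<in> X.span {\<pi> g v | g. g \<noteq> 0}" using t(2) by simp
  qed
  then have "X.span {\<pi> g v | g. g \<noteq> 0} = {0} \<or> X.span {\<pi> g v | g. g \<noteq> 0} = UNIV"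
    by (intro pi_irreducible X.subspace_span)
  moreover have "v \<in> X.span {\<pi> g v | g. g \<noteq> 0}"
    by (rule X.span_base) (auto intro!: exI[of _ 1])
  ultimately show ?thesis using assms by auto
qed

text \<open>The orbit of one vector spans, and up to central scalars it is finite by
  \<open>B_decompose\<close> and \<open>finite_unit_image\<close>.\<close>

lemma finite_dimensional: "\<exists>Bv. finite_dimensional_vector_space smul Bv"
proof -
  obtain v :: 'v where v: "v \<noteq> 0" using ex_nonzero by blast
  define S where "S = (\<lambda>(h, T). \<pi> h (T v)) ` ({1, wB} \<times> \<pi> ` {u. N u = 1})"
  have finS: "finite S" 
  proof -
    have "finite ({1, wB} \<times> \<pi> ` {u. N u = 1})" using finite_unit_image[of "{u. N u = 1}"] by simp
    then show ?thesis unfolding S_def by (rule finite_imageI)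
  qed
  have "{\<pi> g v | g. g \<noteq> 0} \<subseteq> X.span S"
  proof
    fix x assume "x \<in> {\<pi> g v | g. g \<noteq> 0}"
    then obtain g where g: "g \<noteq> 0" "x = \<pi> g v" by blast
    obtain f h u where fhu: "f \<in> Fs" "h \<in> {1, wB}" "f \<noteq> 0" "N u = 1" "g = f * h * u" using B_decompose[OF g(1)] by blast
    obtain z where z: "f = jB z" "z \<noteq> 0" using fhu by auto
    have nz: "h \<noteq> 0" "u \<noteq> 0" using fhu by auto
    have "x = smul (\<omega> z) (\<pi> h (\<pi> u v))"
      using g fhu z nz by (simp add: pi_mult mult.assoc pi_central)
    moreover have "\<pi> h (\<pi> u v) \<in> S" unfolding S_def using fhu by (intro image_eqI[of _ _ "(h, \<pi> u)"]) auto
    ultimately show "x \<in> X.span S" by (simp add: X.span_scale X.span_base)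
  qed
  then have "X.span S = UNIV" using span_orbit[OF v] X.span_minimal[OF _ X.subspace_span] by blast
  moreover obtain Bas where "Bas \<subseteq> S" "X.independent Bas" "S \<subseteq> X.span Bas"
    by (rule X.maximal_independent_subset)
  ultimately have "finite Bas" "X.independent Bas" "X.span Bas = UNIV"
    using finite_subset[OF _ finS] X.span_minimal[OF _ X.subspace_span, of S Bas] by auto
  then have "finite_dimensional_vector_space smul Bas" by unfold_locales
  then show ?thesis by blast
qed

lemma dim_pos: "0 < X.dim (UNIV :: 'v set)"
proof -
  obtain Bv where "finite_dimensional_vector_space smul Bv" using finite_dimensional by blast
  then interpret Y: finite_dimensional_vector_space smul Bv .
  obtain v :: 'v where "v \<noteq> 0" using ex_nonzero by blast
  then show ?thesis using Y.dim_eq_0[of UNIV] by auto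
qed

lemma dim_1_if_span: "v \<noteq> 0 \<Longrightarrow> v \<in> W \<Longrightarrow> (\<And>w. w \<in> W \<Longrightarrow> \<exists>c. w = smul c v) \<Longrightarrow> X.dim W = 1"
proof (rule X.dim_unique[of "{v}"])
  show "W \<subseteq> X.span {v}" if "\<And>w. w \<in> W \<Longrightarrow> \<exists>c. w = smul c v"
    using that by (auto simp: X.span_singleton)
qed auto

section \<open>One-dimensional representations\<close>

lemma one_dimensional:
  assumes "X.dim (UNIV :: 'v set) = 1"
  shows "\<exists>\<xi>. \<forall>g v. g \<noteq> 0 \<longrightarrow> \<pi> g v = smul (\<xi> g) v"
proof -
  obtain Bv where Bv: "X.independent Bv" "UNIV \<subseteq> X.span Bv" "card Bv = X.dim (UNIV :: 'v set)"
    by (rule X.basis_exists[of UNIV])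
  then obtain v0 where "Bv = {v0}" using assms card_1_singletonE by metis
  then have "\<exists>c. v = smul c v0" for v using Bv(2) by (auto simp: X.span_singleton)
  then obtain c where c: "\<And>v. v = smul (c v) v0" by metis
  have "\<pi> g v = smul (c (\<pi> g v0)) v" if "g \<noteq> 0" for g v
  proof -
    have "\<pi> g v = smul (c v) (\<pi> g v0)" using c[of v] pi_scale[OF that, of "c v" v0] by simp
    also have "\<dots> = smul (c v) (smul (c (\<pi> g v0)) v0)" using c[of "\<pi> g v0"] by simp
    also have "\<dots> = smul (c (\<pi> g v0)) (smul (c v) v0)" by (simp add: mult.commute)
    finally show ?thesis using c[of v] by simp
  qed
  then show ?thesis by (intro exI[of _ "\<lambda>g. c (\<pi> g v0)"] allI impI)
qed

text \<open>A one-dimensional representation factors through the reduced norm, so a twist makes it trivial.\<close>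
lemma one_dimensional_minimal:
  assumes dim: "X.dim (UNIV :: 'v set) = 1" and minimal: "minimal_rep oF jB OB smul \<pi>"
  shows "cc = 1"
proof -
  obtain \<xi> where chi: "\<And>g v. g \<noteq> 0 \<Longrightarrow> \<pi> g v = smul (\<xi> g) v" using one_dimensional[OF dim] by blast
  obtain v :: 'v where v: "v \<noteq> 0" using ex_nonzero by blast
  have cancel: "a = b" if "smul a v = smul b v" for a b using that v by (simp add: X.scale_cancel_right)
  have chi_mult: "\<xi> (g * h) = \<xi> g * \<xi> h" if "g \<noteq> 0" "h \<noteq> 0" for g h
    by (rule cancel) (use that pi_mult[OF that, of v] in \<open>simp add: chi\<close>)
  have chi_1: "\<xi> 1 = 1" by (rule cancel) (use chi[of 1 v] in simp)
  have chi_inv: "\<xi> g * \<xi> (inverse g) = 1" if "g \<noteq> 0" for g using chi_mult[of g "inverse g"] that chi_1 by simp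
  have chi_nz: "\<xi> g \<noteq> 0" if "g \<noteq> 0" for g using chi_inv[OF that] by auto
  \<comment> \<open>The quotient of two elements of equal reduced norm has norm 1, hence is 1 or a
    commutator, and \<open>\<xi>\<close> is trivial there.\<close>
  have chi_norm: "\<xi> x = \<xi> y" if xy: "x \<noteq> 0" "y \<noteq> 0" "x * cj x = y * cj y" for x y
  proof -
    define z where "z = x * inverse y"
    have z0: "z \<noteq> 0" using xy by (simp add: z_def)
    have x: "x = z * y" using xy by (simp add: z_def mult.assoc)
    have "(z * cj z) * (y * cj y) = 1 * (y * cj y)" using xy(3) unfolding x norm_mult by simp
    then have "z * cj z = 1" using xy(2) by (simp only: mult_cancel_right) simp
    from norm_1_commutator[OF this] have "\<xi> z = 1"
    proof (elim disjE exE conjE)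
      fix a s assume as: "a \<noteq> 0" "s \<noteq> 0" "z = a * s * inverse a * inverse s"
      then have "\<xi> z = (\<xi> a * \<xi> (inverse a)) * (\<xi> s * \<xi> (inverse s))" by (simp add: chi_mult)
      then show ?thesis using as by (simp add: chi_inv)
    qed (simp add: chi_1)
    then show ?thesis using z0 xy(2) by (simp add: x chi_mult)
  qed
  \<comment> \<open>By \<open>chi_norm\<close> the choice does not matter: \<open>\<xi>\<close> is
    inverse to \<open>\<mu>\<close> composed with the reduced norm, so twisting by
    \<open>\<mu>\<close> makes \<open>\<pi>\<close> trivial.\<close>
  define \<mu> where "\<mu> f = inverse (\<xi> (SOME x. x \<noteq> 0 \<and> x * cj x = jB f))" for f
  have mu: "\<mu> f = inverse (\<xi> x)" if "x \<noteq> 0" "x * cj x = jB f" for f x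
  proof -
    have "(SOME x. x \<noteq> 0 \<and> x * cj x = jB f) \<noteq> 0 \<and>
        (SOME x. x \<noteq> 0 \<and> x * cj x = jB f) * cj (SOME x. x \<noteq> 0 \<and> x * cj x = jB f) = jB f"
      by (rule someI[of _ x]) (use that in blast)
    then have "\<xi> (SOME x. x \<noteq> 0 \<and> x * cj x = jB f) = \<xi> x" using that by (intro chi_norm) auto
    then show ?thesis by (simp add: \<mu>_def)
  qed
  have norm_ex: "\<exists>x. x \<noteq> 0 \<and> x * cj x = jB f" if "f \<noteq> 0" for f
    by (rule norm_surjective) (use that in auto)
  have mu_mult: "\<mu> (f * g) = \<mu> f * \<mu> g" if fg: "f \<noteq> 0" "g \<noteq> 0" for f g
  proof -
    obtain x where x: "x \<noteq> 0" "x * cj x = jB f" using norm_ex[OF fg(1)] by blast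
    obtain y where y: "y \<noteq> 0" "y * cj y = jB g" using norm_ex[OF fg(2)] by blast
    have "\<mu> (f * g) = inverse (\<xi> (x * y))" using x y by (intro mu) (simp_all add: norm_mult)
    then show ?thesis using mu[OF x] mu[OF y] x y by (simp add: chi_mult)
  qed
  have mu_nz: "\<mu> f \<noteq> 0" if f: "f \<noteq> 0" for f
  proof -
    obtain x where x: "x \<noteq> 0" "x * cj x = jB f" using norm_ex[OF f] by blast
    then show ?thesis using mu[OF x] chi_nz by simp
  qed
  \<comment> \<open>This gives continuity of \<open>\<mu>\<close>: an element of \<open>F\<close>
    near 1 is the norm of a unit of \<open>E\<close> equally near 1, on which \<open>\<pi>\<close>
    is trivial.\<close>
  have mu_trivial: "\<mu> f = 1" if f: "N (jB f - 1) \<le> rho ^ cc" for f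
  proof -
    have less: "rho ^ cc < 1" using rho cc(1) by (simp add: power_less_one_iff)
    have "N (jB f) = 1" using near_1 f less by simp
    then obtain e where e: "e \<in> U" "N (e - 1) \<le> rho ^ cc" "e * cj e = jB f"
      using norm_lift[of "jB f" 1 cc] f cc(1) U_closed(4) by auto
    have e0: "e \<noteq> 0" by (rule U_nonzero[OF e(1)])
    have "N (e - 1) \<le> N wB ^ (2 * cc)" using e(2) by (simp only: rho_even)
    then have "e \<in> UU (2 * cc)" using cc(1) by (simp add: UU_pos)
    then have "\<pi> e v = v" by (intro pi_trivial[of e "2 * cc"]) auto
    then have "\<xi> e = 1" using chi[OF e0, of v] by (intro cancel) simp
    then show ?thesis using mu[OF e0 e(3)] by simp
  qed
  have char: "is_character oF (- {0}) \<mu>"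
  proof -
    have "continuous_map (subtopology (adic_topology oF) (- {0})) euclidean \<mu>"
      unfolding continuous_map_def
    proof (intro conjI allI impI)
      fix O' :: "complex set" assume "openin euclidean O'"
      define G where "G = {f. f \<noteq> 0 \<and> \<mu> f \<in> O'}"
      have "openin (adic_topology OF.R) G"
      proof (rule OF.openin_adicI)
        fix f assume f: "f \<in> G"
        then have f0: "f \<noteq> 0" by (simp add: G_def)
        have pos: "0 < N (jB f) * rho ^ cc" using N_pos[of "jB f"] f0 rho by simp
        obtain n where n: "rho ^ n < N (jB f) * rho ^ cc"
          using OF.ex_w_power_less[OF pos] by (auto simp: rho_def)
        show "\<exists>n. \<forall>y. N (jB (y - f)) \<le> N (jB pF) ^ n \<longrightarrow> y \<in> G"
        proof (intro exI[of _ n] allI impI)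
          fix y assume "N (jB (y - f)) \<le> N (jB pF) ^ n"
          then have Ny: "N (jB y - jB f) \<le> N (jB f) * rho ^ cc" using n by (simp add: rho_def)
          define u where "u = y / f"
          have y: "y = f * u" using f0 by (simp add: u_def)
          have "jB y - jB f = jB f * (jB u - 1)" by (simp add: y right_diff_distrib)
          then have "N (jB f) * N (jB u - 1) \<le> N (jB f) * rho ^ cc" using Ny by (simp only: N_mult)
          then have Nu: "N (jB u - 1) \<le> rho ^ cc" using N_pos[of "jB f"] f0 by simp
          have "N (jB u) = 1" using near_1[of "jB u"] Nu rho cc(1) power_less_one_iff[of rho cc] by simp
          then have u0: "u \<noteq> 0" by auto
          then have "\<mu> y = \<mu> f" using mu_mult[OF f0 u0] mu_trivial[OF Nu] by (simp add: y)
          then show "y \<in> G" using f u0 f0 by (simp add: G_def y)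
        qed
      qed
      moreover have "{x \<in> topspace (subtopology (adic_topology oF) (- {0})). \<mu> x \<in> O'} = G \<inter> - {0}"
        using OF.topspace_adic by (auto simp: G_def oF_def)
      ultimately show "openin (subtopology (adic_topology oF) (- {0})) {x \<in> topspace (subtopology (adic_topology oF) (- {0})). \<mu> x \<in> O'}"
        by (auto simp: openin_subtopology oF_def)
    qed auto
    then show ?thesis using mu_mult mu_nz by (simp add: is_character_def)
  qed
  have "rep_conductor OB (twist jB smul \<pi> \<mu>) \<le> 1"
    unfolding rep_conductor_def
  proof (intro Least_le conjI ballI allI)
    fix g u assume "g \<in> UU (1 - 1)"
    then have g0: "g \<noteq> 0" using UU_nonzero by auto
    have "\<mu> (reduced_norm jB g) = inverse (\<xi> g)" by (rule mu[OF g0 reduced_norm[symmetric]])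
    then show "twist jB smul \<pi> \<mu> g u = u" using chi[OF g0, of u] chi_nz[OF g0] by (simp add: twist_def)
  qed simp
  moreover have "rep_conductor OB \<pi> \<le> rep_conductor OB (twist jB smul \<pi> \<mu>)"
    using minimal char unfolding minimal_rep_def by blast
  ultimately show ?thesis using cc(1) by (simp add: cc_def)
qed

lemma UU_subset_units: "UU (2 * r) \<subseteq> unit_group (order_s oE OB emb (2 * r + 1))"
proof -
  have in_order: "x \<in> order_s oE OB emb (2 * r + 1)" if x: "x \<in> UU (2 * r)" for x
  proof (cases "r = 0")
    case True
    then show ?thesis using UU_N[OF x] unfolding order_s_eq
      by (intro CollectI exI[of _ 0] exI[of _ x]) simp
  next
    case False
    then show ?thesis using x unfolding order_s_eq
      by (intro CollectI exI[of _ 1] exI[of _ "x - 1"]) (simp add: UU_pos)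
  qed
  show ?thesis
  proof
    fix x assume x: "x \<in> UU (2 * r)"
    then show "x \<in> unit_group (order_s oE OB emb (2 * r + 1))"
      using in_order[OF x] in_order[OF UU_inverse[OF x]] UU_nonzero[OF x]
      unfolding unit_group_def by (intro CollectI conjI bexI[of _ "inverse x"]) simp_all
  qed
qed

lemma U_subset_units: "U \<subseteq> unit_group (order_s oE OB emb (2 * r + 1))"
proof
  have in_order: "x \<in> order_s oE OB emb (2 * r + 1)" if x: "x \<in> U" for x
  proof -
    obtain a where "x = emb a" using U_E[OF x] by blast
    then show ?thesis using U_N[OF x] unfolding order_s_eq
      by (intro CollectI exI[of _ a] exI[of _ 0]) simp
  qed
  fix x assume x: "x \<in> U"
  then show "x \<in> unit_group (order_s oE OB emb (2 * r + 1))"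
    using in_order[OF x] in_order[OF U_closed(2)[OF x]] U_nonzero[OF x]
    unfolding unit_group_def by (intro CollectI conjI bexI[of _ "inverse x"]) simp_all
qed

text \<open>For \<open>r > 0\<close> the component from \<open>oE\<close> of a unit is itself a
  unit, and dividing by it leaves a factor near 1. For \<open>r = 0\<close> the order is all of
  \<open>OB\<close>, and 1 serves as the component.\<close>

lemma units_decompose:
  assumes g: "g \<in> unit_group (order_s oE OB emb (2 * r + 1))"
  shows "\<exists>x\<in>U. \<exists>z\<in>UU (2 * r). g = x * z"
proof -
  have N_le: "N y \<le> 1" if y: "y \<in> order_s oE OB emb (2 * r + 1)" for y
  proof -
    obtain a x where "y = emb a + x" "N (emb a) \<le> 1" "N x \<le> N wB ^ (2 * r)" using y unfolding order_s_eq by blast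
    then show ?thesis using wB_pow_le[of 0 "2 * r"] by (auto intro: N_add_le)
  qed
  obtain h where h: "g \<in> order_s oE OB emb (2 * r + 1)" "h \<in> order_s oE OB emb (2 * r + 1)" "g * h = 1"
    using g unfolding unit_group_def by blast
  have "N g * N h = 1" using h(3) by (simp flip: N_mult)
  moreover have "N g * N h \<le> N g * 1" using N_le[OF h(2)] by (intro mult_left_mono) auto
  ultimately have gN: "N g = 1" using N_le[OF h(1)] by simp
  show ?thesis
  proof (cases "r = 0")
    case True
    then show ?thesis using gN U_closed(4) by (intro bexI[of _ 1] bexI[of _ g]) (auto simp: UU_0)
  next
    case False
    obtain a x where ax: "g = emb a + x" "N (emb a) \<le> 1" "N x \<le> N wB ^ (2 * r)" using h(1) unfolding order_s_eq by blast
    have "N (g - emb a) < N g" using ax(1,3) wB_pow_less[of "2 * r"] False gN by simp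
    then have Na: "N (emb a) = 1" using N_close gN by metis
    then have aU: "emb a \<in> U" by (simp add: U_def)
    have "inverse (emb a) * g \<in> UU (2 * r)" using ax Na False by (intro UU_quotient) (auto simp: N_commute)
    moreover have "g = emb a * (inverse (emb a) * g)" using U_nonzero[OF aU] by (simp flip: mult.assoc)
    ultimately show ?thesis using aU by blast
  qed
qed

end

section \<open>The eigenspaces\<close>

lemma sum_self_map:
  assumes "finite I" "inj_on h I" "h ` I \<subseteq> I"
  shows "(\<Sum>i\<in>I. f (h i)) = (\<Sum>i\<in>I. f i)"
  using sum.reindex[OF assms(2), of f] endo_inj_surj[OF assms(1,3,2)] by (simp add: o_def)

text \<open>The extension is recorded through its restriction to \<open>U\<close>.
  \<open>Om_conductor\<close> bounds the conductor of \<open>\<Omega>\<close> on the units of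
  \<open>E\<close> by that of \<open>\<omega>\<close>, phrased level by level so that no
  \<open>LEAST\<close> remains.\<close>

locale quaternion_rep_character = quaternion_rep p nrm j Bs jE jB emb jF smul \<pi> \<omega>
  for p :: nat and nrm :: "'k::field_char_0 \<Rightarrow> real" and j :: "'k \<Rightarrow> 'b::division_ring" and Bs
    and jE :: "'f::field \<Rightarrow> 'e::field" and jB :: "'f \<Rightarrow> 'b" and emb :: "'e \<Rightarrow> 'b" and jF :: "'k \<Rightarrow> 'f"
    and smul :: "complex \<Rightarrow> 'v::ab_group_add \<Rightarrow> 'v" and \<pi> :: "'b \<Rightarrow> 'v \<Rightarrow> 'v" and \<omega> :: "'f \<Rightarrow> complex" +
  fixes \<Omega> :: "'b \<Rightarrow> complex" and r :: nat
  assumes Om_nonzero: "x \<in> U \<Longrightarrow> \<Omega> x \<noteq> 0"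
    and Om_mult: "x \<in> U \<Longrightarrow> y \<in> U \<Longrightarrow> \<Omega> (x * y) = \<Omega> x * \<Omega> y"
    and Om_trivial: "x \<in> U \<Longrightarrow> x \<in> UU (2 * r) \<Longrightarrow> \<Omega> x = 1"
    and Om_F: "f \<noteq> 0 \<Longrightarrow> jB f \<in> U \<Longrightarrow> \<Omega> (jB f) = \<omega> f"
    and Om_conductor: "(\<And>f. jB f \<in> U \<Longrightarrow> N (jB f - 1) \<le> rho ^ m \<Longrightarrow> \<omega> f = 1) \<Longrightarrow>
      x \<in> U \<Longrightarrow> N (x - 1) \<le> rho ^ m \<Longrightarrow> \<Omega> x = 1"
begin

lemma Om_1 [simp]: "\<Omega> 1 = 1"
  using Om_mult[of 1 1] Om_nonzero[of 1] U_closed(4) by simp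

lemma Om_inverse: "x \<in> U \<Longrightarrow> \<Omega> (inverse x) = inverse (\<Omega> x)"
  using Om_mult[of x "inverse x"] Om_1 U_closed(2)[of x] U_nonzero[of x] inverse_unique[of "\<Omega> x" "\<Omega> (inverse x)"] by simp

text \<open>Eigenvectors for the units of \<open>E\<close> alone. Once the conductor of
  \<open>\<pi>\<close> is at most \<open>2 * r + 1\<close>, both \<open>\<pi>\<close> and
  \<open>\<Omega>\<close> are trivial on the other factor \<open>UU (2 * r)\<close>, and
  \<open>W\<close> is the eigenspace of the theorem.\<close>

definition W :: "'v set" where "W = {v. \<forall>x\<in>U. \<pi> x v = smul (\<Omega> x) v}"

lemma W_subspace: "X.subspace W"
  by (rule X.subspaceI) (auto simp: W_def pi_0 pi_add pi_scale U_nonzero X.scale_right_distrib mult.commute)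

text \<open>A finite stand-in for \<open>U\<close>: the pairs represent the quotient through which
  \<open>\<Omega>\<close> and \<open>\<pi>\<close> both factor, and sums over them replace integrals
  over \<open>U\<close>.\<close>

definition I :: "(complex \<times> ('v \<Rightarrow> 'v)) set" where "I = (\<lambda>x. (\<Omega> x, \<pi> x)) ` U"

lemma finite_I: "finite I"
proof -
  define n where "n = max (Suc (2 * r)) cc"
  have n: "0 < n" "cc \<le> Suc n" "2 * r \<le> n" by (auto simp: n_def)
  have "finite ((\<lambda>x. (\<Omega> x, \<pi> x)) ` U)"
  proof (rule finite_image_of_locally_constant)
    show "0 < N wB ^ n" using N_wB by simp
    fix x y assume xy: "x \<in> U" "y \<in> U" "N (x - y) < N wB ^ n"
    have "\<pi> x = \<pi> y" using xy n by (intro ext pi_eqI[of x y n]) (auto simp: U_N)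
    moreover have "\<Omega> x = \<Omega> y"
    proof -
      have "inverse x * y \<in> UU n" using xy n by (intro UU_quotient) (auto simp: U_N)
      then have "inverse x * y \<in> UU (2 * r)" using UU_mono[OF n(3)] by blast
      then have "\<Omega> (inverse x * y) = 1" using xy by (intro Om_trivial U_closed) auto
      then have "inverse (\<Omega> x) * \<Omega> y = 1" using xy by (simp add: Om_mult Om_inverse U_closed)
      then show ?thesis using Om_nonzero[OF xy(1)] by (simp add: field_simps)
    qed
    ultimately show "(\<Omega> x, \<pi> x) = (\<Omega> y, \<pi> y)" by simp
  qed (auto simp: U_N)
  then show ?thesis by (simp add: I_def)
qed

lemma I_nonempty: "(1, \<pi> 1) \<in> I" unfolding I_def using U_closed(4) by (intro image_eqI[of _ _ 1]) auto

lemma card_I: "of_nat (card I) \<noteq> (0 :: complex)"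
  using finite_I I_nonempty by (auto simp: card_eq_0_iff)

text \<open>Up to the factor \<open>card I\<close> this is the projection onto the \<open>\<Omega>\<close>-eigenspace \<open>W\<close>.\<close>
definition pr :: "'v \<Rightarrow> 'v" where "pr v = (\<Sum>(a, T)\<in>I. smul (inverse a) (T v))"

lemma I_linear:
  assumes "(a, T) \<in> I"
  shows "T (u + v) = T u + T v" "T (smul c v) = smul c (T v)" "T 0 = 0"
  using assms by (auto simp: I_def pi_add pi_scale pi_0 U_nonzero)

lemma pr_add: "pr (u + v) = pr u + pr v"
  unfolding pr_def sum.distrib[symmetric]
  by (intro sum.cong refl) (auto simp: I_linear X.scale_right_distrib)
lemma pr_scale: "pr (smul c v) = smul c (pr v)"
  unfolding pr_def X.scale_sum_right by (intro sum.cong refl) (auto simp: I_linear mult.commute)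
lemma pr_0: "pr 0 = 0" using pr_scale[of 0 0] by simp

lemma inj_pi: "g \<noteq> 0 \<Longrightarrow> \<pi> g u = \<pi> g v \<longleftrightarrow> u = v" using pi_inverse(1) by metis

text \<open>The analogue of the invariance of Haar measure: multiplication by fixed units permutes
  the finite set \<open>I\<close>.\<close>

lemma I_shift:
  assumes x: "x \<in> U" and y: "y \<in> U"
  shows "(\<Sum>i\<in>I. f (\<Omega> x * fst i * \<Omega> y, \<lambda>v. \<pi> x (snd i (\<pi> y v)))) = (\<Sum>i\<in>I. f i)"
proof (rule sum_self_map[OF finite_I])
  let ?h = "\<lambda>i. (\<Omega> x * fst i * \<Omega> y, \<lambda>v. \<pi> x (snd i (\<pi> y v)))"
  have nz: "\<Omega> x \<noteq> 0" "\<Omega> y \<noteq> 0" "x \<noteq> 0" "y \<noteq> 0" using assms Om_nonzero U_nonzero by auto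
  show "inj_on ?h I"
  proof (rule inj_onI)
    fix i k assume eq: "?h i = ?h k"
    then have "\<pi> x (snd i (\<pi> y v)) = \<pi> x (snd k (\<pi> y v))" for v by (auto dest: fun_cong)
    then have "snd i (\<pi> y v) = snd k (\<pi> y v)" for v using inj_pi[OF nz(3)] by simp
    from this[of "\<pi> (inverse y) _"] have "snd i = snd k" using pi_inverse(2)[OF nz(4)] by (intro ext) metis
    then show "i = k" using eq nz by (simp add: prod_eq_iff)
  qed
  show "?h ` I \<subseteq> I"
  proof
    fix k assume "k \<in> ?h ` I"
    then obtain z where z: "z \<in> U" "k = (\<Omega> x * \<Omega> z * \<Omega> y, \<lambda>v. \<pi> x (\<pi> z (\<pi> y v)))" by (auto simp: I_def)
    have "k = (\<Omega> (x * z * y), \<pi> (x * z * y))"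
      using z assms nz U_nonzero[OF z(1)] by (simp add: Om_mult U_closed pi_mult fun_eq_iff)
    moreover have "x * z * y \<in> U" using z assms by (intro U_closed)
    ultimately show "k \<in> I" by (auto simp: I_def)
  qed
qed

lemma pr_pi: "y \<in> U \<Longrightarrow> pr (\<pi> y v) = smul (\<Omega> y) (pr v)"
proof -
  assume y: "y \<in> U"
  have "smul (inverse (\<Omega> y)) (pr (\<pi> y v)) = (\<Sum>i\<in>I. smul (inverse (\<Omega> 1 * fst i * \<Omega> y)) (\<pi> 1 (snd i (\<pi> y v))))"
    unfolding pr_def X.scale_sum_right
    by (intro sum.cong refl) (auto simp: mult.commute)
  also have "\<dots> = pr v"
    using I_shift[OF U_closed(4) y, of "\<lambda>i. smul (inverse (fst i)) (snd i v)"] by (simp add: pr_def case_prod_beta)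
  finally have "smul (\<Omega> y) (smul (inverse (\<Omega> y)) (pr (\<pi> y v))) = smul (\<Omega> y) (pr v)" by simp
  then show ?thesis using Om_nonzero[OF y] by simp
qed

lemma pi_pr: "y \<in> U \<Longrightarrow> \<pi> y (pr v) = smul (\<Omega> y) (pr v)"
proof -
  assume y: "y \<in> U"
  have "smul (inverse (\<Omega> y)) (\<pi> y (pr v)) = (\<Sum>i\<in>I. smul (inverse (\<Omega> y * fst i * \<Omega> 1)) (\<pi> y (snd i (\<pi> 1 v))))"
    unfolding pr_def pi_sum[OF U_nonzero[OF y]] X.scale_sum_right
    by (intro sum.cong refl) (auto simp: pi_scale U_nonzero[OF y])
  also have "\<dots> = pr v"
    using I_shift[OF y U_closed(4), of "\<lambda>i. smul (inverse (fst i)) (snd i v)"] by (simp add: pr_def case_prod_beta)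
  finally have "smul (\<Omega> y) (smul (inverse (\<Omega> y)) (\<pi> y (pr v))) = smul (\<Omega> y) (pr v)" by simp
  then show ?thesis using Om_nonzero[OF y] by simp
qed

lemma pr_in_W: "pr v \<in> W" by (simp add: W_def pi_pr)

lemma pr_W: "v \<in> W \<Longrightarrow> pr v = smul (of_nat (card I)) v"
proof -
  assume v: "v \<in> W"
  have "pr v = (\<Sum>i\<in>I. v)"
    unfolding pr_def
    by (intro sum.cong refl) (use v in \<open>auto simp: I_def W_def Om_nonzero\<close>)
  then show ?thesis by (simp add: X.sum_constant_scale)
qed

text \<open>Up to a scalar, the action on \<open>W\<close> of the double coset of \<open>g\<close>,
  that is, of an element of the Hecke algebra of \<open>\<Omega>\<close>-equivariant
  functions.\<close>

definition Tg :: "'b \<Rightarrow> 'v \<Rightarrow> 'v" where "Tg g v = pr (\<pi> g (pr v))"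

lemma Tg_add: "g \<noteq> 0 \<Longrightarrow> Tg g (u + v) = Tg g u + Tg g v" by (simp add: Tg_def pr_add pi_add)
lemma Tg_scale: "g \<noteq> 0 \<Longrightarrow> Tg g (smul c v) = smul c (Tg g v)" by (simp add: Tg_def pr_scale pi_scale)

lemma Tg_UgU:
  assumes "x \<in> U" "y \<in> U" "g \<noteq> 0"
  shows "Tg (x * g * y) v = smul (\<Omega> x * \<Omega> y) (Tg g v)"
proof -
  have "\<pi> (x * g * y) (pr v) = \<pi> x (\<pi> g (\<pi> y (pr v)))" using assms U_nonzero by (simp add: pi_mult)
  also have "\<dots> = smul (\<Omega> y) (\<pi> x (\<pi> g (pr v)))" using assms U_nonzero by (simp add: pi_pr pi_scale)
  finally show ?thesis using assms by (simp add: Tg_def pr_scale pr_pi mult.commute)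
qed

text \<open>
  Gelfand's trick: the anti-involution \<open>x \<mapsto> wB * cj x * wB\<^sup>-\<^sup>1\<close> fixes \<open>E\<close> and, by Hilbert 90,
  moves every element inside its conjugacy class under \<open>U\<close>.
\<close>
definition io :: "'b \<Rightarrow> 'b" where "io x = wB * cj x * inverse wB"

lemma io_mult: "io (x * y) = io y * io x"
proof -
  have "io y * io x = wB * cj y * (inverse wB * wB) * cj x * inverse wB" by (simp only: io_def mult.assoc)
  then show ?thesis by (simp only: io_def cj_mult left_inverse[OF wB_nonzero] mult_1_right mult.assoc)
qed

lemma io_E: "x \<in> Es \<Longrightarrow> io x = x"
  using wB_E[of "cj x"] by (simp add: io_def Es_closed cj_cj mult.assoc)

text \<open>For \<open>g = a + b * wB\<close> one has \<open>io g = a - cj b * wB\<close>, and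
  conjugation by \<open>e\<close> achieves this if \<open>e * b = - (cj b * cj e)\<close>. The
  trace-zero \<open>dd\<close> gives the solution \<open>dd * cj b\<close>, which a factor from
  \<open>F\<close> turns into a unit.\<close>

lemma io_conj:
  assumes "g \<noteq> 0"
  shows "\<exists>e\<in>U. io g = e * g * inverse e"
proof -
  obtain a b where ab: "a \<in> Es" "b \<in> Es" "g = a + b * wB" using wB_decompose by blast
  have io_g: "io g = a - cj b * wB"
  proof -
    have "io g = io a + io (b * wB)" by (simp add: ab(3) io_def cj_add distrib_left distrib_right)
    also have "io (b * wB) = io wB * b" by (simp add: io_mult io_E ab)
    also have "io wB = - wB" by (simp add: io_def cj_wB mult.assoc)
    finally show ?thesis using wB_E[OF ab(2)] by (simp add: io_E ab)
  qed
  show ?thesis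
  proof (cases "b = 0")
    case True
    then show ?thesis using io_g ab U_closed(4) by (intro bexI[of _ 1]) auto
  next
    case False
    have "dd * cj b \<in> Es" by (rule Es_closed(3)[OF dd(1) Es_closed(7)[OF ab(2)]])
    moreover have "dd * cj b \<noteq> 0" using False by simp
    ultimately obtain f where f: "f \<in> Fs" "f \<noteq> 0" "N (f * (dd * cj b)) = 1" using E_scale by blast
    define e where "e = f * (dd * cj b)"
    have eE: "e \<in> Es" unfolding e_def by (rule Es_closed(3)[OF Fs_E[OF f(1)] \<open>dd * cj b \<in> Es\<close>])
    then have eU: "e \<in> U" using f(3) by (simp add: U_def e_def)
    have e0: "e \<noteq> 0" by (rule U_nonzero[OF eU])
    have cje: "cj e = - (f * (dd * b))"
      using E_commute[OF ab(2) dd(1)] f(1) by (simp add: e_def cj_mult cj_cj dd(3) Fs_cj Fs_central[OF f(1)])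
    have "e * g = (a - cj b * wB) * e"
    proof -
      have "e * g = e * a + e * b * wB" by (simp add: ab(3) distrib_left mult.assoc)
      also have "e * a = a * e" by (rule E_commute[OF eE ab(1)])
      also have "e * b = - (cj b * cj e)"
      proof -
        have "cj b * (f * (dd * b)) = f * (cj b * dd * b)"
          using Fs_central[OF f(1), of "cj b"] by (simp flip: mult.assoc)
        also have "cj b * dd = dd * cj b" by (rule E_commute[OF Es_closed(7)[OF ab(2)] dd(1)])
        finally show ?thesis unfolding cje unfolding e_def by (simp add: mult.assoc)
      qed
      also have "- (cj b * cj e) * wB = - (cj b * wB * e)" by (simp add: wB_E[OF eE] mult.assoc)
      finally show ?thesis by (simp add: left_diff_distrib)
    qed
    then have "io g = e * g * inverse e" using e0 by (simp add: io_g mult.assoc)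
    then show ?thesis using eU by blast
  qed
qed


lemma Tg_io: "g \<noteq> 0 \<Longrightarrow> Tg (io g) v = Tg g v"
proof -
  assume g: "g \<noteq> 0"
  obtain e where e: "e \<in> U" "io g = e * g * inverse e" using io_conj[OF g] by blast
  have "\<Omega> e * \<Omega> (inverse e) = 1" using e Om_nonzero by (simp add: Om_inverse)
  then show ?thesis using Tg_UgU[OF e(1) U_closed(2)[OF e(1)] g] by (simp add: e(2))
qed

text \<open>Inserting the sum for the inner projection writes the product of two operators as a
  combination of operators of \<open>g * x * h\<close>, with \<open>x\<close> running over
  \<open>U\<close>.\<close>

lemma Tg_Tg:
  assumes "g \<noteq> 0" "h \<noteq> 0"
  shows "Tg g (Tg h v) = smul (of_nat (card I)) (\<Sum>i\<in>I. smul (inverse (fst i)) (pr (\<pi> g (snd i (\<pi> h (pr v))))))"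
proof -
  have pr_sum: "pr (sum f A) = (\<Sum>a\<in>A. pr (f a))" for f and A :: "(complex \<times> ('v \<Rightarrow> 'v)) set"
    by (induction A rule: infinite_finite_induct) (auto simp: pr_0 pr_add)
  have "Tg g (Tg h v) = pr (\<pi> g (smul (of_nat (card I)) (pr (\<pi> h (pr v)))))"
    unfolding Tg_def by (subst pr_W[OF pr_in_W]) simp
  also have "\<dots> = smul (of_nat (card I)) (pr (\<pi> g (pr (\<pi> h (pr v)))))"
    using assms by (simp add: pi_scale pr_scale)
  also have "pr (\<pi> g (pr (\<pi> h (pr v)))) = pr (\<pi> g (\<Sum>i\<in>I. smul (inverse (fst i)) (snd i (\<pi> h (pr v)))))"
    by (subst (2) pr_def) (simp add: case_prod_beta)
  also have "\<dots> = (\<Sum>i\<in>I. smul (inverse (fst i)) (pr (\<pi> g (snd i (\<pi> h (pr v))))))"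
    using assms by (simp add: pi_sum pr_sum pi_scale pr_scale)
  finally show ?thesis .
qed

text \<open>\<open>io\<close> reverses products and does not change \<open>Tg\<close>, so
  \<open>g * x * h\<close> may be replaced by \<open>io h * x * io g\<close>. With
  \<open>io h\<close> and \<open>io g\<close> written as conjugates, the inner factors
  \<open>e\<close> and \<open>f\<close> are absorbed in the substitution \<open>y\<close>, which
  permutes the terms.\<close>

lemma Tg_commute:
  assumes g: "g \<noteq> 0" and h: "h \<noteq> 0"
  shows "Tg g (Tg h v) = Tg h (Tg g v)"
proof -
  obtain e where e: "e \<in> U" "io h = e * h * inverse e" using io_conj[OF h] by blast
  obtain f where f: "f \<in> U" "io g = f * g * inverse f" using io_conj[OF g] by blast
  have inv: "inverse e \<in> U" "inverse f \<in> U" using e f U_closed by auto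
  define A where "A g h i = smul (inverse (fst i)) (pr (\<pi> g (snd i (\<pi> h (pr v)))))" for g h and i :: "complex \<times> ('v \<Rightarrow> 'v)"
  have A_U: "A g h (\<Omega> x, \<pi> x) = smul (inverse (\<Omega> x)) (Tg (g * x * h) v)" if "x \<in> U" "g \<noteq> 0" "h \<noteq> 0" for g h x
    using that U_nonzero by (simp add: A_def Tg_def pi_mult)
  have "A g h i = A h g (\<Omega> (inverse e) * fst i * \<Omega> f, \<lambda>v. \<pi> (inverse e) (snd i (\<pi> f v)))" if "i \<in> I" for i
  proof -
    obtain x where x: "x \<in> U" "i = (\<Omega> x, \<pi> x)" using \<open>i \<in> I\<close> by (auto simp: I_def)
    define y where "y = inverse e * x * f"
    have y: "y \<in> U" unfolding y_def by (intro U_closed(1) inv x f)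
    have nz: "x \<noteq> 0" "e \<noteq> 0" "f \<noteq> 0" "y \<noteq> 0" using U_nonzero x e f y by auto
    have pair: "(\<Omega> (inverse e) * fst i * \<Omega> f, \<lambda>v. \<pi> (inverse e) (snd i (\<pi> f v))) = (\<Omega> y, \<pi> y)"
      using x e f inv nz by (simp add: y_def Om_mult U_closed pi_mult fun_eq_iff)
    have "io (g * x * h) = io h * x * io g" using x U_E by (simp add: io_mult io_E mult.assoc)
    also have "\<dots> = e * (h * y * g) * inverse f"
      by (simp add: e f y_def mult.assoc)
    finally have "Tg (g * x * h) v = Tg (e * (h * y * g) * inverse f) v"
      using Tg_io[of "g * x * h" v] g h nz by simp
    also have "\<dots> = smul (\<Omega> e * \<Omega> (inverse f)) (Tg (h * y * g) v)"
      using e(1) inv(2) g h nz by (intro Tg_UgU) auto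
    finally have "A g h i = smul (inverse (\<Omega> x) * (\<Omega> e * \<Omega> (inverse f))) (Tg (h * y * g) v)"
      using A_U[OF x(1) g h] by (simp add: x(2))
    moreover have "inverse (\<Omega> x) * (\<Omega> e * \<Omega> (inverse f)) = inverse (\<Omega> y)"
      using x e f inv by (simp add: y_def Om_mult Om_inverse U_closed mult_ac)
    ultimately have "A g h i = smul (inverse (\<Omega> y)) (Tg (h * y * g) v)" by simp
    then show ?thesis unfolding pair using A_U[OF y h g] by simp
  qed
  then have "(\<Sum>i\<in>I. A g h i) = (\<Sum>i\<in>I. A h g (\<Omega> (inverse e) * fst i * \<Omega> f, \<lambda>v. \<pi> (inverse e) (snd i (\<pi> f v))))"
    by (intro sum.cong refl)
  also have "\<dots> = (\<Sum>i\<in>I. A h g i)" by (rule I_shift[OF inv(1) f(1)])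
  finally show ?thesis using g h by (simp add: Tg_Tg A_def)
qed

text \<open>Irreducibility projected to \<open>W\<close>: the images of one vector under the
  operators \<open>Tg g\<close> span it. The property \<open>P\<close> stands for membership in a
  subspace.\<close>

lemma W_span_Tg:
  assumes v: "v \<in> W" "v \<noteq> 0" and w: "w \<in> W"
    and P: "P 0" "\<And>x y. P x \<Longrightarrow> P y \<Longrightarrow> P (x + y)" "\<And>c x. P x \<Longrightarrow> P (smul c x)" "\<And>g. g \<noteq> 0 \<Longrightarrow> P (Tg g v)"
  shows "P w"
proof -
  have "w \<in> X.span {\<pi> g v | g. g \<noteq> 0}" using span_orbit[OF v(2)] by simp
  then have "P (pr w)"
  proof (induction rule: X.span_induct_alt)
    case base
    then show ?case using P(1) by (simp add: pr_0)
  next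
    case (step c x y)
    then obtain g where g: "g \<noteq> 0" "x = \<pi> g v" by blast
    have "Tg g v = smul (of_nat (card I)) (pr x)"
      using g by (simp add: Tg_def pr_W[OF v(1)] pi_scale pr_scale)
    then have "pr x = smul (inverse (of_nat (card I))) (Tg g v)" using card_I by simp
    then have "P (pr x)" using P(3,4) g(1) by simp
    then show ?case using step P by (simp add: pr_add pr_scale)
  qed
  then have "P (smul (inverse (of_nat (card I))) (pr w))" by (rule P(3))
  then show ?thesis using card_I by (simp add: pr_W[OF w])
qed

text \<open>An eigenvector in \<open>W\<close> of one operator \<open>Tg g\<close> generates
  \<open>W\<close> under all of them, and they commute, so each operator is a scalar on
  \<open>W\<close>; applied to \<open>v\<close>, they therefore span only a line.\<close>

lemma multiplicity_one:
  assumes "v \<in> W" "v \<noteq> 0" "w \<in> W"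
  shows "\<exists>c. w = smul c v"
proof -
  have scalar: "\<exists>c. \<forall>u\<in>W. Tg g u = smul c u" if g: "g \<noteq> 0" for g
  proof -
    obtain Bv where "finite_dimensional_vector_space smul Bv" using finite_dimensional by blast
    then obtain v0 c where v0: "v0 \<in> W" "v0 \<noteq> 0" "Tg g v0 = smul c v0"
      using ex_eigenvector[of smul Bv "Tg g" W v] Tg_add[OF g] Tg_scale[OF g] W_subspace assms(1,2) pr_in_W
      by (auto simp: Tg_def)
    have "Tg g u = smul c u" if u: "u \<in> W" for u
    proof (rule W_span_Tg[OF v0(1,2) u])
      show "Tg g 0 = smul c 0" using Tg_scale[OF g, of 0 0] by simp
      show "Tg g (x + y) = smul c (x + y)" if "Tg g x = smul c x" "Tg g y = smul c y" for x y
        using that by (simp add: Tg_add[OF g] X.scale_right_distrib)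
      show "Tg g (smul d x) = smul c (smul d x)" if "Tg g x = smul c x" for d x
        using that by (simp add: Tg_scale[OF g] mult.commute)
      show "Tg g (Tg h v0) = smul c (Tg h v0)" if "h \<noteq> 0" for h
        using Tg_commute[OF g that] v0(3) that by (simp add: Tg_scale)
    qed
    then show ?thesis by blast
  qed
  show ?thesis
  proof (rule W_span_Tg[OF assms])
    show "\<exists>c. 0 = smul c v" by (intro exI[of _ 0]) simp
    show "\<exists>c. x + y = smul c v" if xy: "\<exists>c. x = smul c v" "\<exists>c. y = smul c v" for x y
    proof -
      obtain a b where "x = smul a v" "y = smul b v" using xy by blast
      then show ?thesis by (intro exI[of _ "a + b"]) (simp add: X.scale_left_distrib)
    qed
    show "\<exists>d. smul c x = smul d v" if x: "\<exists>c. x = smul c v" for c x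
    proof -
      obtain a where "x = smul a v" using x by blast
      then show ?thesis by (intro exI[of _ "c * a"]) simp
    qed
    show "\<exists>c. Tg g v = smul c v" if "g \<noteq> 0" for g using scalar[OF that] assms(1) by blast
  qed
qed

lemma uniformizer_powers: "N x \<le> rho ^ n \<longleftrightarrow> N x \<le> N wB ^ (2 * n)" by (simp only: rho_even)

text \<open>
  Because \<open>wB * x = cj x * wB\<close>, conjugation by \<open>1 + \<beta> * wB\<close> changes \<open>x\<close> by \<open>\<beta> * (cj x - x) * wB\<close> to first
  order, and this can be solved for \<open>\<beta>\<close>.
\<close>
lemma commutator_surjective:
  assumes x: "x \<in> U" "N (x - cj x) = rho ^ i" "i < m" and z: "z \<in> UU (2 * m - 1)"
  shows "\<exists>y\<in>UU 1. N (y * x * inverse y - x * z) \<le> N wB ^ (2 * m)"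
proof -
  obtain n where n: "m = Suc n" using x(3) by (cases m) auto
  have "N (z - 1) \<le> N wB ^ (2 * n + 1)" using z by (simp add: UU_pos n)
  then obtain b where b: "b \<in> Es" "N b \<le> rho ^ n" "N (z - 1 - b * wB) \<le> N wB ^ (2 * n + 2)"
    using odd_level by blast
  define d where "d = cj x - x"
  have Nd: "N d = rho ^ i" using x(2) by (simp add: d_def N_commute)
  have d0: "d \<noteq> 0" using Nd rho by auto
  have dE: "d \<in> Es" unfolding d_def by (rule Es_closed(2)[OF Es_closed(7)[OF U_E[OF x(1)]] U_E[OF x(1)]])
  \<comment> \<open>This solves \<open>\<beta> * (cj x - x) = b * x\<close>. The norm is
    \<open>N b / rho ^ i\<close>, at most 1 because \<open>i < m\<close> means
    \<open>i \<le> n\<close>.\<close>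
  define \<beta> where "\<beta> = b * x * inverse d"
  have bE: "\<beta> \<in> Es" unfolding \<beta>_def by (intro Es_closed(3,5) b(1) U_E[OF x(1)] dE)
  have in_le: "rho ^ n \<le> rho ^ i" using x(3) n rho by (intro power_decreasing) auto
  have "N \<beta> \<le> 1"
  proof -
    have "N \<beta> = N b / rho ^ i"
      by (simp only: \<beta>_def N_mult N_inverse Nd U_N[OF x(1)] mult_1_right divide_inverse)
    moreover have "0 < rho ^ i" "N b \<le> rho ^ i" using rho order_trans[OF b(2) in_le] by auto
    ultimately show ?thesis by (simp add: divide_le_eq)
  qed
  define y where "y = 1 + \<beta> * wB"
  have y1: "N (y - 1) \<le> N wB" using \<open>N \<beta> \<le> 1\<close> mult_right_mono[of "N \<beta>" 1 "N wB"] by (simp add: y_def N_mult)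
  have yU: "y \<in> UU 1" using y1 by (simp add: UU_pos)
  have y0: "y \<noteq> 0" and x0: "x \<noteq> 0" using UU_nonzero[OF yU] U_nonzero[OF x(1)] by auto
  have "y * x = x * y + x * (b * wB)"
  proof -
    have "\<beta> * wB * x = \<beta> * cj x * wB" using wB_E[OF U_E[OF x(1)]] by (simp add: mult.assoc)
    also have "\<beta> * cj x = \<beta> * x + \<beta> * d" by (simp add: d_def flip: distrib_left)
    also have "\<beta> * d = b * x" using d0 by (simp add: \<beta>_def mult.assoc)
    also have "b * x = x * b" by (rule E_commute[OF b(1) U_E[OF x(1)]])
    also have "\<beta> * x = x * \<beta>" by (rule E_commute[OF bE U_E[OF x(1)]])
    finally show ?thesis by (simp add: y_def algebra_simps)
  qed
  then have "y * x * inverse y = (x * y + x * (b * wB)) * inverse y" by (simp only:)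
  also have "\<dots> = x + x * (b * wB) * inverse y" using y0 by (simp add: distrib_right mult.assoc)
  \<comment> \<open>The first-order terms cancel. What remains is a product of deviations of levels
    \<open>2 * n + 1\<close> and 1, and the error in approximating \<open>z\<close>; both have level
    \<open>2 * n + 2 = 2 * m\<close>.\<close>
  finally have eq: "y * x * inverse y - x * z = x * (b * wB * (inverse y - 1) - (z - 1 - b * wB))"
    by (simp add: algebra_simps)
  have "N (b * wB * (inverse y - 1)) \<le> N wB ^ (2 * n + 2)"
  proof -
    have "inverse y - 1 = inverse y * (1 - y)" using y0 by (simp add: right_diff_distrib)
    then have "N (inverse y - 1) \<le> N wB" using y1 UU_N[OF yU] by (simp add: N_mult N_inverse N_commute)
    then have "N b * N wB * N (inverse y - 1) \<le> rho ^ n * N wB * N wB"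
      using b(2) rho by (intro mult_mono) auto
    also have "\<dots> = N wB ^ (2 * n + 2)" using rho_even[of "Suc n"] N_wB(3) by (simp add: mult.assoc mult.commute)
    finally show ?thesis by (simp add: N_mult)
  qed
  then have "N (b * wB * (inverse y - 1) - (z - 1 - b * wB)) \<le> N wB ^ (2 * n + 2)" by (rule N_diff_le) (rule b(3))
  then have "N (y * x * inverse y - x * z) \<le> N wB ^ (2 * m)"
    unfolding eq N_mult U_N[OF x(1)] by (simp add: n)
  then show ?thesis using yU by blast
qed

text \<open>A finite stand-in for \<open>UU 1\<close> acting by conjugation; the operators of
  \<open>x\<close> and \<open>inverse x\<close> are kept as a pair, so that conjugating needs no
  inverse of an operator.\<close>

definition J :: "(('v \<Rightarrow> 'v) \<times> ('v \<Rightarrow> 'v)) set" where "J = (\<lambda>x. (\<pi> x, \<pi> (inverse x))) ` UU 1"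

lemma finite_J: "finite J"
proof -
  have "finite (\<pi> ` UU 1)" by (rule finite_unit_image) (auto simp: UU_N)
  then have "finite (\<pi> ` UU 1 \<times> \<pi> ` UU 1)" by simp
  moreover have "J \<subseteq> \<pi> ` UU 1 \<times> \<pi> ` UU 1" using UU_inverse by (auto simp: J_def)
  ultimately show ?thesis by (rule finite_subset[rotated])
qed

lemma card_J: "of_nat (card J) \<noteq> (0 :: complex)"
  using finite_J UU_1[of 1] by (auto simp: card_eq_0_iff J_def)

definition av :: "('v \<Rightarrow> 'v) \<Rightarrow> 'v \<Rightarrow> 'v" where "av T v = (\<Sum>s\<in>J. fst s (T (snd s v)))"

lemma av_conj:
  assumes y: "y \<in> UU 1"
  shows "av (\<lambda>v. \<pi> y (T (\<pi> (inverse y) v))) v = av T v"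
proof -
  let ?h = "\<lambda>s. (\<lambda>v. fst s (\<pi> y v), \<lambda>v. \<pi> (inverse y) (snd s v)) :: ('v \<Rightarrow> 'v) \<times> ('v \<Rightarrow> 'v)"
  have y0: "y \<noteq> 0" by (rule UU_nonzero[OF y])
  have "(\<Sum>s\<in>J. fst (?h s) (T (snd (?h s) v))) = (\<Sum>s\<in>J. fst s (T (snd s v)))"
  proof (rule sum_self_map[OF finite_J])
    show "inj_on ?h J"
    proof (rule inj_onI)
      fix s t assume eq: "?h s = ?h t"
      have "fst s (\<pi> y v) = fst t (\<pi> y v)" for v using eq by (auto dest: fun_cong)
      from this[of "\<pi> (inverse y) _"] have "fst s = fst t" using pi_inverse(2)[OF y0] by (intro ext) metis
      moreover have "\<pi> (inverse y) (snd s v) = \<pi> (inverse y) (snd t v)" for v using eq by (auto dest: fun_cong)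
      then have "snd s = snd t" using inj_pi[of "inverse y"] y0 by (intro ext) simp
      ultimately show "s = t" by (simp add: prod_eq_iff)
    qed
    show "?h ` J \<subseteq> J"
    proof
      fix s assume "s \<in> ?h ` J"
      then obtain x where x: "x \<in> UU 1" "s = (\<lambda>v. \<pi> x (\<pi> y v), \<lambda>v. \<pi> (inverse y) (\<pi> (inverse x) v))" by (auto simp: J_def)
      have x0: "x \<noteq> 0" by (rule UU_nonzero[OF x(1)])
      have "s = (\<pi> (x * y), \<pi> (inverse (x * y)))"
        using x(2) x0 y0 by (simp add: fun_eq_iff pi_mult nonzero_inverse_mult_distrib)
      then show "s \<in> J" using UU_mult[OF x(1) y] by (auto simp: J_def)
    qed
  qed
  then show ?thesis by (simp add: av_def)
qed

text \<open>By \<open>commutator_surjective\<close> the average cannot distinguish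
  \<open>\<pi> x\<close> from \<open>\<pi> x\<close> composed with an operator of
  \<open>UU (2 * m - 1)\<close>. The sum of the latter operators maps into
  \<open>Vfix (2 * m - 1)\<close>, which is zero just below the conductor
  \<open>2 * m + 1\<close>.\<close>

lemma av_zero:
  assumes c: "cc = 2 * m + 1" and x: "x \<in> U" "N (x - cj x) = rho ^ i" "i < m"
  shows "av (\<pi> x) v = 0"
proof -
  have m: "0 < m" using x(3) by simp
  have x0: "x \<noteq> 0" by (rule U_nonzero[OF x(1)])
  define L where "L = \<pi> ` UU (2 * m - 1)"
  have finL: "finite L" unfolding L_def by (rule finite_unit_image) (auto simp: UU_N)
  have av_shift: "av (\<lambda>v. \<pi> x (Z v)) v = av (\<pi> x) v" if Z: "Z \<in> L" for Z
  proof -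
    obtain z where z: "z \<in> UU (2 * m - 1)" "Z = \<pi> z" using Z by (auto simp: L_def)
    obtain y where y: "y \<in> UU 1" "N (y * x * inverse y - x * z) \<le> N wB ^ (2 * m)"
      using commutator_surjective[OF x z(1)] by blast
    have y0: "y \<noteq> 0" and z0: "z \<noteq> 0" using UU_nonzero y z by auto
    have "\<pi> y (\<pi> x (\<pi> (inverse y) v)) = \<pi> x (\<pi> z v)" for v
    proof -
      have "\<pi> (y * x * inverse y) v = \<pi> (x * z) v"
        using y m c UU_N[OF y(1)] U_N[OF x(1)] by (intro pi_eqI[of _ _ "2 * m"]) (auto simp: N_mult N_inverse)
      then show ?thesis using y0 x0 z0 by (simp add: pi_mult)
    qed
    then show ?thesis using av_conj[OF y(1), of "\<pi> x" v] by (simp add: z(2))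
  qed
  have L_zero: "(\<Sum>Z\<in>L. Z u) = 0" for u
  proof -
    have "\<pi> z (\<Sum>Z\<in>L. Z u) = (\<Sum>Z\<in>L. Z u)" if z: "z \<in> UU (2 * m - 1)" for z
    proof -
      have z0: "z \<noteq> 0" by (rule UU_nonzero[OF z])
      have "\<pi> z (\<Sum>Z\<in>L. Z u) = (\<Sum>Z\<in>L. (\<lambda>v. \<pi> z (Z v)) u)" by (simp add: pi_sum[OF z0])
      also have "\<dots> = (\<Sum>Z\<in>L. Z u)"
      proof (rule sum_self_map[OF finL, of "\<lambda>Z v. \<pi> z (Z v)" "\<lambda>Z. Z u"])
        show "inj_on (\<lambda>Z v. \<pi> z (Z v)) L"
          by (rule inj_onI) (metis (no_types, lifting) ext inj_pi[OF z0])
        show "(\<lambda>Z v. \<pi> z (Z v)) ` L \<subseteq> L"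
        proof
          fix Z' assume "Z' \<in> (\<lambda>Z v. \<pi> z (Z v)) ` L"
          then obtain t where t: "t \<in> UU (2 * m - 1)" "Z' = (\<lambda>v. \<pi> z (\<pi> t v))" by (auto simp: L_def)
          then have "Z' = \<pi> (z * t)" using z0 UU_nonzero[OF t(1)] by (simp add: fun_eq_iff pi_mult)
          then show "Z' \<in> L" using UU_mult[OF z t(1)] by (simp add: L_def)
        qed
      qed
      finally show ?thesis .
    qed
    then have "(\<Sum>Z\<in>L. Z u) \<in> Vfix (2 * m - 1)" by (simp add: Vfix_def)
    then show ?thesis using Vfix_small[of "2 * m - 1"] c m by simp
  qed
  have "smul (of_nat (card L)) (av (\<pi> x) v) = (\<Sum>Z\<in>L. av (\<pi> x) v)"
    by (simp add: X.sum_constant_scale)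
  also have "\<dots> = (\<Sum>Z\<in>L. \<Sum>s\<in>J. fst s (\<pi> x (Z (snd s v))))"
  proof (intro sum.cong refl)
    fix Z assume "Z \<in> L"
    from av_shift[OF this] show "av (\<pi> x) v = (\<Sum>s\<in>J. fst s (\<pi> x (Z (snd s v))))" by (simp add: av_def)
  qed
  also have "\<dots> = (\<Sum>s\<in>J. \<Sum>Z\<in>L. fst s (\<pi> x (Z (snd s v))))" by (rule sum.swap)
  also have "\<dots> = (\<Sum>s\<in>J. 0)"
  proof (intro sum.cong refl)
    fix s assume "s \<in> J"
    then obtain y where y: "y \<in> UU 1" "s = (\<pi> y, \<pi> (inverse y))" by (auto simp: J_def)
    have y0: "y \<noteq> 0" by (rule UU_nonzero[OF y(1)])
    have "(\<Sum>Z\<in>L. fst s (\<pi> x (Z (snd s v)))) = \<pi> y (\<pi> x (\<Sum>Z\<in>L. Z (snd s v)))"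
      by (simp add: y(2) pi_sum[OF y0] pi_sum[OF x0])
    then show "(\<Sum>Z\<in>L. fst s (\<pi> x (Z (snd s v)))) = 0" by (simp add: L_zero pi_0 x0 y0)
  qed
  finally have "smul (of_nat (card L)) (av (\<pi> x) v) = 0" by simp
  moreover have "card L \<noteq> 0" using finL UU_1 by (auto simp: card_eq_0_iff L_def)
  ultimately show ?thesis by simp
qed

text \<open>A unit of \<open>F\<close> of level \<open>m\<close> lies in \<open>UU (2 * m)\<close>,
  because \<open>pF\<close> has valuation 2 in \<open>B\<close>, and \<open>\<pi>\<close> is trivial
  there.\<close>

lemma omega_trivial:
  assumes "jB f \<in> U" "N (jB f - 1) \<le> rho ^ m" "0 < m" "cc \<le> 2 * m + 1"
  shows "\<omega> f = 1"
proof -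
  obtain v :: 'v where v: "v \<noteq> 0" using ex_nonzero by blast
  have "jB f \<in> UU (2 * m)" using assms by (simp add: UU_pos uniformizer_powers)
  then have "\<pi> (jB f) v = v" using assms(4) by (intro pi_trivial) auto
  moreover have "f \<noteq> 0" using U_nonzero[OF assms(1)] by auto
  ultimately have "smul (\<omega> f) v = smul 1 v" by (simp add: pi_central)
  then show ?thesis using v by (simp only: X.scale_cancel_right) simp
qed

text \<open>Smallness of \<open>x - cj x\<close> gives \<open>x = a * y\<close> with
  \<open>a\<close> a unit of \<open>F\<close> and \<open>y\<close> of level \<open>m\<close> in
  \<open>E\<close>. On \<open>a\<close> both \<open>\<pi>\<close> and \<open>\<Omega>\<close> are
  given by \<open>\<omega>\<close>. On \<open>y\<close> the former is trivial by the conductor and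
  the latter by minimal ramification, as \<open>\<omega>\<close> is trivial at level
  \<open>m\<close>.\<close>

lemma near_F_scalar:
  assumes c: "cc = 2 * m + 1" and m: "0 < m" and x: "x \<in> U" "N (x - cj x) \<le> rho ^ m"
  shows "smul (inverse (\<Omega> x)) (\<pi> x v) = v"
proof -
  obtain a b where ab: "a \<in> Fs" "b \<in> Fs" "x = a + b * uu" "N b = N (x - cj x)" using E_split[OF U_E[OF x(1)]] by blast
  have Nb: "N b \<le> rho ^ m" "rho ^ m < 1" using ab(4) x(2) m rho by (auto simp: power_less_one_iff)
  have Na: "N a = 1" using N_close[of x a] ab(3) uu(2) Nb U_N[OF x(1)] by (simp add: N_mult)
  have aU: "a \<in> U" using Na Fs_E[OF ab(1)] by (simp add: U_def)
  have a0: "a \<noteq> 0" by (rule U_nonzero[OF aU])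
  define y where "y = inverse a * x"
  have yU: "y \<in> U" unfolding y_def by (intro U_closed aU x(1))
  have "y - 1 = inverse a * (b * uu)" using a0 by (simp add: y_def ab(3) distrib_left)
  then have Ny: "N (y - 1) \<le> rho ^ m" using Na uu(2) Nb by (simp add: N_mult N_inverse)
  have xy: "x = a * y" using a0 by (simp add: y_def flip: mult.assoc)
  obtain f where f: "a = jB f" using ab(1) by blast
  have f0: "f \<noteq> 0" using a0 f by auto
  have "\<Omega> y = 1"
    by (rule Om_conductor[OF _ yU Ny]) (use omega_trivial m c in simp)
  then have "\<Omega> x = \<omega> f" using Om_F[OF f0] aU yU by (simp add: xy Om_mult f)
  moreover have "\<pi> y v = v"
  proof (rule pi_trivial)
    show "y \<in> UU (2 * m)" using Ny m by (simp add: UU_pos uniformizer_powers)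
  qed (use c in simp)
  then have "\<pi> x v = smul (\<omega> f) v" using a0 U_nonzero[OF yU] by (simp add: xy pi_mult) (simp add: f pi_central f0)
  ultimately show ?thesis using Om_nonzero[OF x(1)] by simp
qed

text \<open>
  Averaging the projection onto \<open>W\<close> over the conjugates by \<open>UU 1\<close> leaves only the contribution of the
  elements close to \<open>F\<close>, which is a positive multiple of the identity.
\<close>
lemma W_nonzero:
  assumes c: "cc = 2 * m + 1" and m: "0 < m"
  shows "\<exists>v\<in>W. v \<noteq> 0"
proof (rule ccontr)
  assume "\<not> ?thesis"
  then have pr0: "pr v = 0" for v using pr_in_W by blast
  obtain v :: 'v where v: "v \<noteq> 0" using ex_nonzero by blast
  \<comment> \<open>Membership asks for some \<open>x\<close> behind the pair, since the pair need
    not determine it; for pairs outside \<open>G\<close> every such \<open>x\<close> is far from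
    \<open>F\<close>.\<close>
  define G where "G = {i \<in> I. \<exists>x\<in>U. i = (\<Omega> x, \<pi> x) \<and> N (x - cj x) \<le> rho ^ m}"
  have summand: "smul (inverse (fst i)) (av (snd i) v) = (if i \<in> G then smul (of_nat (card J)) v else 0)" if i: "i \<in> I" for i
  proof (cases "i \<in> G")
    case True
    then obtain x where x: "x \<in> U" "i = (\<Omega> x, \<pi> x)" "N (x - cj x) \<le> rho ^ m" by (auto simp: G_def)
    have px: "\<pi> x u = smul (\<Omega> x) u" for u
    proof -
      have "smul (\<Omega> x) (smul (inverse (\<Omega> x)) (\<pi> x u)) = smul (\<Omega> x) u"
        using near_F_scalar[OF c m x(1,3), of u] by simp
      then show ?thesis using Om_nonzero[OF x(1)] by simp
    qed
    have "av (\<pi> x) v = (\<Sum>s\<in>J. smul (\<Omega> x) v)"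
      unfolding av_def
    proof (intro sum.cong refl)
      fix s assume "s \<in> J"
      then obtain y where y: "y \<in> UU 1" "s = (\<pi> y, \<pi> (inverse y))" by (auto simp: J_def)
      have y0: "y \<noteq> 0" by (rule UU_nonzero[OF y(1)])
      show "fst s (\<pi> x (snd s v)) = smul (\<Omega> x) v"
        using y0 by (simp add: y(2) px pi_scale pi_inverse)
    qed
    then have "smul (inverse (\<Omega> x)) (av (\<pi> x) v) = smul (of_nat (card J)) v"
      using Om_nonzero[OF x(1)] by (simp add: X.sum_constant_scale mult.commute)
    then show ?thesis using True x(2) by simp
  next
    case False
    obtain x where x: "x \<in> U" "i = (\<Omega> x, \<pi> x)" using i by (auto simp: I_def)
    then have far: "rho ^ m < N (x - cj x)" using False i by (auto simp: G_def)
    have "x - cj x \<in> Es" by (rule Es_closed(2)[OF U_E[OF x(1)] Es_closed(7)[OF U_E[OF x(1)]]])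
    moreover have "x - cj x \<noteq> 0"
    proof
      assume "x - cj x = 0"
      then have "rho ^ m < 0" using far by simp
      then show False using rho by (simp add: not_less[symmetric] zero_le_power)
    qed
    ultimately obtain k where k: "N (x - cj x) = rho powi k" using E_valuation by blast
    have "N (x - cj x) \<le> 1" using U_N[OF x(1)] by (intro N_diff_le) (auto simp: N_cj)
    have "0 \<le> k"
    proof (rule ccontr)
      assume "\<not> 0 \<le> k"
      then have "rho powi 0 < rho powi k" using rho by (intro power_int_strict_decreasing) auto
      then show False using \<open>N (x - cj x) \<le> 1\<close> k by simp
    qed
    then obtain i' where i': "k = int i'" using nonneg_int_cases by blast
    then have ki: "N (x - cj x) = rho ^ i'" using k by simp
    have "i' < m"
    proof (rule ccontr)
      assume "\<not> i' < m"
      then have "rho ^ i' \<le> rho ^ m" using rho by (intro power_decreasing) auto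
      then show False using far ki by simp
    qed
    then have "av (\<pi> x) v = 0" by (rule av_zero[OF c x(1) ki])
    then show ?thesis using False x(2) by simp
  qed
  \<comment> \<open>Interchanging the sums turns the combination of averages into the average of
    \<open>pr\<close>, which vanishes by assumption.\<close>
  have "(\<Sum>i\<in>I. smul (inverse (fst i)) (av (snd i) v)) = (\<Sum>s\<in>J. fst s (pr (snd s v)))"
  proof -
    have "(\<Sum>i\<in>I. smul (inverse (fst i)) (av (snd i) v)) = (\<Sum>i\<in>I. \<Sum>s\<in>J. smul (inverse (fst i)) (fst s (snd i (snd s v))))"
      by (simp add: av_def X.scale_sum_right)
    also have "\<dots> = (\<Sum>s\<in>J. \<Sum>i\<in>I. smul (inverse (fst i)) (fst s (snd i (snd s v))))" by (rule sum.swap)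
    also have "\<dots> = (\<Sum>s\<in>J. fst s (pr (snd s v)))"
    proof (intro sum.cong refl)
      fix s assume "s \<in> J"
      then obtain y where y: "y \<in> UU 1" "s = (\<pi> y, \<pi> (inverse y))" by (auto simp: J_def)
      show "(\<Sum>i\<in>I. smul (inverse (fst i)) (fst s (snd i (snd s v)))) = fst s (pr (snd s v))"
        using UU_nonzero[OF y(1)] by (simp add: y(2) pr_def case_prod_beta pi_sum pi_scale)
    qed
    finally show ?thesis .
  qed
  also have "\<dots> = 0"
  proof (intro sum.neutral ballI)
    fix s assume "s \<in> J"
    then show "fst s (pr (snd s v)) = 0" using UU_nonzero by (auto simp: pr0 J_def pi_0)
  qed
  \<comment> \<open>What is left is \<open>card G * card J\<close> times \<open>v\<close>, which is
    nonzero over the complex numbers.\<close>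
  finally have "(\<Sum>i\<in>I. if i \<in> G then smul (of_nat (card J)) v else 0) = 0" using summand by simp
  then have "(\<Sum>i\<in>G. smul (of_nat (card J)) v) = 0"
    using finite_I by (simp add: sum.If_cases G_def Int_absorb1) (simp add: Int_def conj_ac cong: conj_cong)
  then have "smul (of_nat (card G)) (smul (of_nat (card J)) v) = 0" by (simp only: X.sum_constant_scale)
  moreover have "card G \<noteq> 0"
  proof -
    have "(1, \<pi> 1) \<in> G" unfolding G_def using I_nonempty U_closed(4) rho by (auto intro!: bexI[of _ 1])
    then have "G \<noteq> {}" by blast
    moreover have "finite G" using finite_I by (simp add: G_def)
    ultimately show ?thesis by (simp add: card_eq_0_iff)
  qed
  ultimately show False using card_J v by simp
qed

text \<open>In the even case the first nontrivial level of \<open>\<pi>\<close> is covered by \<open>U\<close>.\<close>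
lemma even_conductor:
  assumes v: "v \<in> W" "v \<noteq> 0" and c: "cc = 2 * n + 2"
  shows "\<exists>f. jB f \<in> U \<and> N (jB f - 1) \<le> rho ^ n \<and> \<omega> f \<noteq> 1"
proof (rule ccontr)
  assume neg: "\<not> ?thesis"
  have Om: "\<Omega> x = 1" if "x \<in> U" "N (x - 1) \<le> rho ^ n" for x
    by (rule Om_conductor[OF _ that]) (use neg in blast)
  have "\<pi> g v = v" if g: "g \<in> UU (2 * n)" for g
  proof -
    have gN: "N g = 1" by (rule UU_N[OF g])
    have "\<exists>x\<in>U. N (x - 1) \<le> rho ^ n \<and> N (x - g) \<le> N wB ^ (2 * n + 1)"
    proof (cases "n = 0")
      \<comment> \<open>At level 0 there is no \<open>1 + a\<close> to work with:
        \<open>UU 0\<close> consists of all units, and \<open>g\<close> itself is approximated by a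
        unit of \<open>E\<close>.\<close>
      case True
      obtain a where a: "a \<in> Es" "N (g - a) \<le> N wB" using even_level[of g 0] gN by auto
      have "N a = 1" using N_close[of g a] a(2) gN N_wB by simp
      then have "a \<in> U" "N (a - 1) \<le> 1" using a(1) by (auto simp: U_def intro: N_diff_le)
      then show ?thesis using a(2) True by (intro bexI[of _ a]) (auto simp: N_commute)
    next
      case False
      then have "N (g - 1) \<le> N wB ^ (2 * n)" using g by (simp add: UU_pos)
      then obtain a where a: "a \<in> Es" "N a \<le> rho ^ n" "N (g - 1 - a) \<le> N wB ^ (2 * n + 1)" using even_level by blast
      have "rho ^ n < 1" using rho False by (simp add: power_less_one_iff)
      then have "N (1 + a) = 1" using near_1[of "1 + a"] a(2) by simp
      then have "1 + a \<in> U" using Es_closed(1)[OF one_E(1) a(1)] by (simp add: U_def)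
      moreover have "N ((1 + a) - g) \<le> N wB ^ (2 * n + 1)" using a(3) N_commute[of g "1 + a"] by (simp add: diff_diff_add)
      ultimately show ?thesis using a(2) by (intro bexI[of _ "1 + a"]) auto
    qed
    then obtain x where x: "x \<in> U" "N (x - 1) \<le> rho ^ n" "N (x - g) \<le> N wB ^ (2 * n + 1)" by blast
    \<comment> \<open>An error of level \<open>2 * n + 1\<close> is invisible to
      \<open>\<pi>\<close>, whose conductor is \<open>2 * n + 2\<close>.\<close>
    have "\<pi> x v = \<pi> g v" using x c by (intro pi_eqI[of x g "2 * n + 1"]) (auto simp: U_N)
    then show ?thesis using v(1) x(1) Om[OF x(1,2)] by (simp add: W_def)
  qed
  then have "v \<in> Vfix (2 * n)" by (simp add: Vfix_def)
  then show False using Vfix_small[of "2 * n"] c v(2) by simp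
qed

text \<open>At conductor 1 all units act trivially, so \<open>\<omega>\<close> is trivial on the
  units of \<open>F\<close>, and by \<open>Om_conductor\<close> at level 0 \<open>\<Omega>\<close>
  is trivial on \<open>U\<close>.\<close>

lemma level_1:
  assumes "cc = 1"
  shows "W = UNIV"
proof -
  have triv: "\<pi> x v = v" if "x \<in> U" for x v
    using that assms by (intro pi_trivial[of x 0]) (auto simp: UU_0 U_N)
  obtain v0 :: 'v where v0: "v0 \<noteq> 0" using ex_nonzero by blast
  have om: "\<omega> f = 1" if "jB f \<in> U" for f
  proof -
    have "f \<noteq> 0" using U_nonzero[OF that] by auto
    then have "smul (\<omega> f) v0 = smul 1 v0" using triv[OF that] by (simp add: pi_central)
    then show ?thesis using v0 by (simp only: X.scale_cancel_right) simp
  qed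
  have "\<Omega> x = 1" if x: "x \<in> U" for x
  proof (rule Om_conductor[OF _ x])
    show "N (x - 1) \<le> rho ^ 0" using U_N[OF x] by (simp add: N_diff_le)
  qed (rule om)
  then show ?thesis using triv by (simp add: W_def)
qed

end

text \<open>Translates the rings and conductors of the definitions into norm conditions, from which
  the locale assumptions follow.\<close>

lemma quaternion_rep_characterI:
  fixes \<omega> :: "'f::field \<Rightarrow> complex"
  assumes "quaternion_rep p nrm j Bs jE jB emb jF smul \<pi> \<omega>"
    and oF: "oF = integer_ring nrm jF" and oE: "oE = integer_ring nrm (jE \<circ> jF)"
    and OB: "OB = maximal_order oF jB"
    and hE: "unital_ring_hom (jE \<circ> jF)" and hB: "\<And>a. j a = jB (jF a)"
    and ext: "minimally_ramified_extension oF oE OB jB emb r \<omega> \<Omega>"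
  shows "quaternion_rep_character p nrm j Bs jE jB emb jF smul \<pi> \<omega> \<Omega> r"
proof -
  interpret Q: quaternion_rep p nrm j Bs jE jB emb jF smul \<pi> \<omega> by (rule assms(1))
  have F: "oF = Q.oF" unfolding oF Q.oF_def
    by (rule Q.integer_ring_eq[OF Q.jB_hom Q.jF_hom]) (simp add: hB)
  have E: "oE = Q.oE" unfolding oE Q.oE_def
    by (rule Q.integer_ring_eq[OF Q.emb_hom hE]) (simp add: hB Q.emb_jE)
  have B: "OB = Q.OB" unfolding OB F by (rule Q.maximal_order_eq)
  have ext1: "is_character Q.OB (unit_group (order_s Q.oE Q.OB emb (2 * r + 1))) \<Omega>"
    and ext2: "\<And>g. g \<in> Q.UU (2 * r) \<Longrightarrow> \<Omega> g = 1"
    and ext3: "\<And>a. a \<in> unit_group Q.oF \<Longrightarrow> \<Omega> (jB a) = \<omega> a"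
    and ext4: "char_conductor Q.oE (\<Omega> \<circ> emb) = char_conductor Q.oF \<omega>"
    using ext unfolding minimally_ramified_extension_def F E B by auto
  have mult: "\<And>x y. x \<in> unit_group (order_s Q.oE Q.OB emb (2 * r + 1)) \<Longrightarrow> y \<in> unit_group (order_s Q.oE Q.OB emb (2 * r + 1)) \<Longrightarrow> \<Omega> (x * y) = \<Omega> x * \<Omega> y"
    and nz: "\<And>x. x \<in> unit_group (order_s Q.oE Q.OB emb (2 * r + 1)) \<Longrightarrow> \<Omega> x \<noteq> 0"
    using ext1 unfolding is_character_def by auto
  note sub = subsetD[OF Q.U_subset_units]
  show ?thesis
  proof (intro quaternion_rep_character.intro quaternion_rep_character_axioms.intro assms(1))
    show "\<Omega> x \<noteq> 0" if "x \<in> Q.U" for x using nz sub that by blast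
    show "\<Omega> (x * y) = \<Omega> x * \<Omega> y" if "x \<in> Q.U" "y \<in> Q.U" for x y using mult sub that by blast
    show "\<Omega> x = 1" if "x \<in> Q.U" "x \<in> Q.UU (2 * r)" for x using ext2 that by blast
    show "\<Omega> (jB f) = \<omega> f" if "f \<noteq> 0" "jB f \<in> Q.U" for f
    proof (rule ext3)
      show "f \<in> unit_group Q.oF" using that Q.OF.unit_group_R by (simp add: Q.oF_def Q.U_def)
    qed
    fix m x assume om: "\<And>f. jB f \<in> Q.U \<Longrightarrow> Q.N (jB f - 1) \<le> Q.rho ^ m \<Longrightarrow> \<omega> f = 1"
      and x: "x \<in> Q.U" "Q.N (x - 1) \<le> Q.rho ^ m"
    have "char_conductor Q.oF \<omega> \<le> m" by (rule char_conductor_le) (use om in \<open>simp add: Q.oF_units\<close>)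
    then have le: "char_conductor Q.oE (\<Omega> \<circ> emb) \<le> m" by (simp only: ext4)
    obtain y where y: "x = emb y" using Q.U_E[OF x(1)] by blast
    have "(\<Omega> \<circ> emb) y = 1"
    \<comment> \<open>\<open>LEAST\<close> needs some trivial level: \<open>\<Omega>\<close> is
      trivial on \<open>UU (2 * r)\<close>, which contains the units of \<open>E\<close> of level
      \<open>Suc r\<close>. The level \<open>r\<close> may be 0, where \<open>UU_pos\<close> does
      not apply; hence the successor.\<close>
    proof (rule char_conductor_trivial[where R = Q.oE and m = "Suc r" and \<theta> = "\<Omega> \<circ> emb"])
      show "(\<Omega> \<circ> emb) z = 1" if "z \<in> higher_units Q.oE (Suc r)" for z
      proof -
        have "Q.N (emb z - 1) \<le> Q.N Q.wB ^ (2 * Suc r)" using that unfolding Q.oE_units Q.rho_even by simp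
        then have "emb z \<in> Q.UU (2 * Suc r)" by (simp add: Q.UU_pos)
        then have "emb z \<in> Q.UU (2 * r)" using Q.UU_mono[of "2 * r" "2 * Suc r"] by auto
        then show ?thesis using ext2 by simp
      qed
      have "y \<in> higher_units Q.oE m" using x y by (simp add: Q.oE_units)
      then show "y \<in> higher_units Q.oE (char_conductor Q.oE (\<Omega> \<circ> emb))"
        using Q.oE_units_mono[OF le] by blast
    qed
    then show "\<Omega> x = 1" by (simp add: y)
  qed
qed

theorem theorem3p5:
  fixes p r c :: nat
    and nrm :: "'k::field_char_0 \<Rightarrow> real"
    and jF :: "'k \<Rightarrow> 'f::field"
    and jE :: "'f \<Rightarrow> 'e::field"
    and jB :: "'f \<Rightarrow> 'b::division_ring"
    and emb :: "'e \<Rightarrow> 'b"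
    and oF :: "'f set" and oE :: "'e set" and OB Or :: "'b set"
    and smul :: "complex \<Rightarrow> 'v::ab_group_add \<Rightarrow> 'v"
    and \<pi> :: "'b \<Rightarrow> 'v \<Rightarrow> 'v"
    and \<omega> :: "'f \<Rightarrow> complex"
    and \<Omega> :: "'b \<Rightarrow> complex"
  assumes Qp: "is_Qp p nrm"
    and F: "finite_extension jF"
    and B: "quaternion_division_algebra jB"
    and E: "unramified_quadratic nrm jF jE"
    and emb: "unital_ring_hom emb" "emb \<circ> jE = jB"
    and oF: "oF = integer_ring nrm jF"
    and oE: "oE = integer_ring nrm (jE \<circ> jF)"
    and OB: "OB = maximal_order oF jB"
    and Or: "Or = order_s oE OB emb (2 * r + 1)"
    and irrep: "smooth_irrep OB smul \<pi>"
    and central: "has_central_character jB smul \<pi> \<omega>"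
    and minimal: "minimal_rep oF jB OB smul \<pi>"
    and ext: "minimally_ramified_extension oF oE OB jB emb r \<omega> \<Omega>"
    and c: "c = rep_conductor OB \<pi>"
  shows "(\<not> (c \<le> 2 * r + 1 \<and>
             (vector_space.dim smul (UNIV :: 'v set) = 1 \<or>
              (vector_space.dim smul (UNIV :: 'v set) > 1 \<and> odd c) \<or>
              (even c \<and> char_conductor oF \<omega> = c div 2)))
            \<longrightarrow> eigenspace Or smul \<pi> \<Omega> = {0}) \<and>
         (c \<le> 2 * r + 1 \<and> vector_space.dim smul (UNIV :: 'v set) = 1
            \<longrightarrow> vector_space.dim smul (eigenspace Or smul \<pi> \<Omega>) = 1) \<and>
         (c \<le> 2 * r + 1 \<and> vector_space.dim smul (UNIV :: 'v set) > 1 \<and> odd c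
            \<longrightarrow> vector_space.dim smul (eigenspace Or smul \<pi> \<Omega>) = 1)"
proof -
  have jF_hom: "unital_ring_hom jF" using F by (simp add: finite_extension_def)
  have jB_hom: "unital_ring_hom jB" using B by (simp add: quaternion_division_algebra_def)
  have jE_hom: "unital_ring_hom jE" and dimE: "vector_space.dim (scale_along jE) (UNIV :: 'e set) = 2"
    and unram: "ideal_times oE (jE ` max_ideal oF) = max_ideal oE"
    using E by (auto simp: unramified_quadratic_def Let_def oF oE)
  have hom: "unital_ring_hom (jB \<circ> jF)" "unital_ring_hom (jE \<circ> jF)"
    by (simp_all add: unital_ring_hom_def unital_ring_hom_facts[OF jF_hom] unital_ring_hom_facts[OF jB_hom]
        unital_ring_hom_facts[OF jE_hom])
  obtain BF where BF: "finite_dimensional_vector_space (scale_along jF) BF"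
    using F by (auto simp: finite_extension_def)
  obtain BB where BB: "finite_dimensional_vector_space (scale_along jB) BB"
    using finite_dimensional_of_dim[OF jB_hom] B by (auto simp: quaternion_division_algebra_def)
  obtain Bs where Bs: "finite_dimensional_vector_space (scale_along (jB \<circ> jF)) Bs"
    using finite_dimensional_tower[OF jF_hom jB_hom BF BB] by blast
  have two: "(2::'f) \<noteq> 0"
  proof -
    have "jF 2 = jF (of_nat 2)" by simp
    also have "\<dots> = of_nat 2" by (rule unital_ring_hom_facts(8)[OF jF_hom])
    finally show ?thesis using unital_ring_hom_eq_0[OF jF_hom, of 2] by auto
  qed
  have cent: "jB f * x = x * jB f" for f x
    using B unfolding quaternion_division_algebra_def by blast
  have Q: "padic_quaternion p nrm (jB \<circ> jF) Bs jE jB emb jF"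
    using Qp hom(1) cent Bs B jE_hom dimE emb(1) fun_cong[OF emb(2)] two jF_hom
    by (intro padic_quaternion.intro padic_division_algebra.intro padic_numbers.intro
        padic_division_algebra_axioms.intro quaternion.intro padic_quaternion_axioms.intro) simp_all
  interpret Q: padic_quaternion p nrm "jB \<circ> jF" Bs jE jB emb jF by (rule Q)
  have oF': "oF = Q.oF" unfolding oF Q.oF_def
    by (rule Q.integer_ring_eq[OF jB_hom jF_hom]) simp
  have oE': "oE = {y. Q.N (emb y) \<le> 1}" unfolding oE
    by (rule Q.integer_ring_eq[OF emb(1) hom(2)]) (simp add: Q.emb_jE)
  have OB': "OB = Q.OB" unfolding OB oF' by (rule Q.maximal_order_eq)
  have "local_quaternion p nrm (jB \<circ> jF) Bs jE jB emb jF"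
    using unram unfolding oF' oE' by unfold_locales
  then interpret L: local_quaternion p nrm "jB \<circ> jF" Bs jE jB emb jF .
  have R: "quaternion_rep p nrm (jB \<circ> jF) Bs jE jB emb jF smul \<pi> \<omega>"
    using irrep central unfolding OB' by unfold_locales
  have "quaternion_rep_character p nrm (jB \<circ> jF) Bs jE jB emb jF smul \<pi> \<omega> \<Omega> r"
    by (rule quaternion_rep_characterI[OF R oF oE OB hom(2) _ ext]) simp
  then interpret C: quaternion_rep_character p nrm "jB \<circ> jF" Bs jE jB emb jF smul \<pi> \<omega> \<Omega> r .
  have cC: "c = C.cc" unfolding c C.cc_def OB' ..
  have Or': "Or = order_s L.oE Q.OB emb (2 * r + 1)" unfolding Or oE' OB' L.oE_def ..
  have ext2: "\<And>g. g \<in> C.UU (2 * r) \<Longrightarrow> \<Omega> g = 1"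
    and Om_mult: "\<And>x y. x \<in> unit_group Or \<Longrightarrow> y \<in> unit_group Or \<Longrightarrow> \<Omega> (x * y) = \<Omega> x * \<Omega> y"
    using ext unfolding minimally_ramified_extension_def is_character_def OB' Or[unfolded OB', symmetric] by auto
  let ?V = "eigenspace Or smul \<pi> \<Omega>"
  have V_W: "?V \<subseteq> C.W"
    using C.U_subset_units unfolding eigenspace_def C.W_def Or' by blast
  have V_fix: "v \<in> C.Vfix (2 * r)" if "v \<in> ?V" for v
    using that C.UU_subset_units[of r] ext2 unfolding eigenspace_def C.Vfix_def Or' by fastforce
  have c_le: "c \<le> 2 * r + 1" if "v \<in> ?V" "v \<noteq> 0" for v
    using C.conductor_le[OF V_fix[OF that(1)] that(2)] by (simp add: cC)
  \<comment> \<open>Units of the order are products from \<open>U\<close> and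
    \<open>UU (2 * r)\<close>, and on the second factor both \<open>\<pi>\<close> and
    \<open>\<Omega>\<close> are trivial.\<close>
  have V_eq: "?V = C.W" if "c \<le> 2 * r + 1"
  proof (rule antisym[OF V_W])
    show "C.W \<subseteq> ?V"
    proof
      fix v assume v: "v \<in> C.W"
      have "\<pi> g v = smul (\<Omega> g) v" if g: "g \<in> unit_group Or" for g
      proof -
        obtain x z where xz: "x \<in> L.U" "z \<in> C.UU (2 * r)" "g = x * z"
          using C.units_decompose[of g r] g unfolding Or' by blast
        have "\<pi> z v = v" by (rule C.pi_trivial[OF xz(2)]) (use \<open>c \<le> 2 * r + 1\<close> cC in simp)
        then have "\<pi> g v = \<pi> x v" using C.pi_mult[of x z] L.U_nonzero[OF xz(1)] C.UU_nonzero[OF xz(2)] xz(3) by simp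
        moreover have "\<Omega> g = \<Omega> x"
          using Om_mult[of x z] C.U_subset_units[of r] C.UU_subset_units[of r] xz ext2 unfolding Or' by auto
        ultimately show ?thesis using v xz(1) by (simp add: C.W_def)
      qed
      then show "v \<in> ?V" by (simp add: eigenspace_def)
    qed
  qed
  have dim_W: "C.X.dim C.W = 1" if "v \<in> C.W" "v \<noteq> 0" for v
    by (rule C.dim_1_if_span[OF that(2,1)]) (rule C.multiplicity_one[OF that])
  have c1: "1 \<le> c" using C.cc(1) cC by simp
  have odd_W: "\<exists>v\<in>C.W. v \<noteq> 0" if "odd c"
  proof -
    obtain m where m: "c = 2 * m + 1" using \<open>odd c\<close> by (rule oddE)
    show ?thesis
    proof (cases "m = 0")
      case True
      then have "C.cc = 1" using m cC by simp
      then show ?thesis using C.level_1 C.ex_nonzero by simp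
    next
      case False
      then show ?thesis using C.W_nonzero[of m] m cC by simp
    qed
  qed
  have even_c: "char_conductor oF \<omega> = c div 2" if "even c" and v: "v \<in> C.W" "v \<noteq> 0" for v
  proof -
    obtain k where k: "c = 2 * k" using \<open>even c\<close> by (rule evenE)
    then obtain n where n: "k = Suc n" using c1 by (cases k) auto
    have cn: "C.cc = 2 * n + 2" using k n cC by simp
    \<comment> \<open>The upper bound: a conductor \<open>2 * n + 2\<close> of \<open>\<pi>\<close>
      already forces the central character to be trivial at level \<open>Suc n\<close>.\<close>
    have triv: "\<omega> f = 1" if "f \<in> higher_units Q.oF (Suc n)" for f
      using that C.omega_trivial[of f "Suc n"] cn by (simp add: L.oF_units)
    have "char_conductor Q.oF \<omega> \<le> Suc n" by (rule char_conductor_le) (rule triv)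
    \<comment> \<open>The lower bound needs the eigenvector: were \<open>\<omega>\<close> trivial at
      level \<open>n\<close>, \<open>even_conductor\<close> would be violated.\<close>
    moreover have "\<not> char_conductor Q.oF \<omega> \<le> n"
    proof
      assume le: "char_conductor Q.oF \<omega> \<le> n"
      obtain f where f: "jB f \<in> L.U" "Q.N (jB f - 1) \<le> L.rho ^ n" "\<omega> f \<noteq> 1"
        using C.even_conductor[OF v cn] by blast
      then have "f \<in> higher_units Q.oF n" by (simp add: L.oF_units)
      then have "f \<in> higher_units Q.oF (char_conductor Q.oF \<omega>)" using L.oF_units_mono[OF le] by blast
      then have "\<omega> f = 1"
        by (rule char_conductor_trivial[where R = Q.oF and m = "Suc n" and \<theta> = \<omega>, rotated]) (rule triv)
      then show False using f(3) by simp
    qed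
    ultimately show ?thesis using k n oF' by simp
  qed
  have min': "minimal_rep Q.oF jB Q.OB smul \<pi>" using minimal by (simp only: oF' OB')
  \<comment> \<open>The vanishing is proved by contraposition: a nonzero eigenvector bounds
    \<open>c\<close>, and then the dimension and the parity of \<open>c\<close> decide which case
    holds.\<close>
  have part1: "c \<le> 2 * r + 1 \<and> (C.X.dim (UNIV :: 'v set) = 1 \<or> (C.X.dim (UNIV :: 'v set) > 1 \<and> odd c) \<or>
      (even c \<and> char_conductor oF \<omega> = c div 2))" if v: "v \<in> ?V" "v \<noteq> 0" for v
    using c_le[OF v] even_c[OF _ subsetD[OF V_W v(1)] v(2)] C.dim_pos by linarith
  have zero: "0 \<in> ?V"
    using C.W_subspace C.X.subspace_0 by (auto simp: eigenspace_def C.pi_0 unit_group_def intro: C.pi_0)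
  have part2: "C.X.dim ?V = 1" if "c \<le> 2 * r + 1" "C.X.dim (UNIV :: 'v set) = 1"
  proof -
    have "C.cc = 1" by (rule C.one_dimensional_minimal[OF that(2) min'])
    then have "?V = UNIV" using V_eq[OF that(1)] C.level_1 by simp
    then show ?thesis using that(2) by simp
  qed
  have part3: "C.X.dim ?V = 1" if "c \<le> 2 * r + 1" "odd c"
    using dim_W odd_W[OF that(2)] V_eq[OF that(1)] by auto
  show ?thesis using part1 part2 part3 zero by blast
qed

end
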